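(* Let $k\ge2$, $\alpha,\beta>0$, $c_{\kappa,k}=\frac{\Gamma(k(\alpha+\beta))}{2\Gamma(\alpha+\beta)^k}$, and for $z,w\in\mathbb{C}$ set $$G(z,w)=c_{\kappa,k}\int_{T^{k-1}}\Big(e^{\langle w,\,z\sum_{j=0}^{k-1}e^{-2ij\pi/k}t_j\rangle}+e^{\langle w,\,z\sum_{j=0}^{k-1}e^{i(2j-1)\pi/k}t_j\rangle}\Big)\prod_{j=0}^{k-1}t_j^{\alpha+\beta-1}\,dt_1\cdots dt_{k-1},\quad t_0=1-\sum_{j=1}^{k-1}t_j.$$ Then there is a function $g$ on $[0,\infty)\times[-1,1]$ with $G(z,w)=g\big(|zw|,\xi_{1,1}(k\phi_1,k\phi_2)\big)$ for all $z=|z|e^{i\phi_1},w=|w|e^{i\phi_2}$, and the generalized Bessel function of $I_{2k}$ with multiplicity $(\alpha,\beta)$ is $$\mathcal J_\kappa(z,w)=\int_{-1}^1\int_{-1}^1 g\big(|zw|,\xi_{u,v}(k\phi_1,k\phi_2)\big)\,d\nu^\alpha(u)\,d\nu^\beta(v).$$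
   Context: Identify $\mathbb{R}^2$ with $\mathbb{C}$, $\langle z,w\rangle=\mathrm{Re}(z\bar w)$, $z=|z|e^{i\phi_1}$, $w=|w|e^{i\phi_2}$. The dihedral group $I_{2k}$ (order $4k$) contains the reflections $z\mapsto\bar ze^{ij\pi/k}$, $j=0,\dots,2k-1$, forming two conjugacy classes ($j$ even, containing $z\mapsto\bar z$; $j$ odd); $\kappa=(\alpha,\beta)$ is $\alpha$ on the class with $j$ even and $\beta$ on the class with $j$ odd. The Dunkl kernel $E_\kappa$ is the joint eigenfunction of the Dunkl operators normalized by $E_\kappa(0,y)=1$, and $\mathcal J_\kappa(x,y)=\frac1{|G|}\sum_{g\in G}E_\kappa(x,gy)$. $d\nu^\alpha(u)=\frac{\Gamma(\alpha+1/2)}{\sqrt\pi\Gamma(\alpha)}(1-u^2)^{\alpha-1}du$ on $[-1,1]$. $\xi_{u,v}(\theta_1,\theta_2)=v\cos\theta_1\cos\theta_2+u\sin\theta_1\sin\theta_2$. $T^{k-1}$ is the open unit simplex $\{t_j>0,\sum_{j=1}^{k-1}t_j<1\}$ in $\mathbb{R}^{k-1}$. *)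

theory Defs
  imports "HOL-Analysis.Analysis"
begin

definition dih_rot :: "nat \<Rightarrow> nat \<Rightarrow> complex \<Rightarrow> complex" where
  "dih_rot k j z = z * cis (real j * pi / real k)"

definition dih_refl :: "nat \<Rightarrow> nat \<Rightarrow> complex \<Rightarrow> complex" where
  "dih_refl k j z = cnj z * cis (real j * pi / real k)"

text \<open>A root (normal vector) of the reflection dih_refl k j: it is mapped to its negative.\<close>
definition dih_root :: "nat \<Rightarrow> nat \<Rightarrow> complex" where
  "dih_root k j = \<i> * cis (real j * pi / (2 * real k))"

definition mult_kappa :: "real \<Rightarrow> real \<Rightarrow> nat \<Rightarrow> real" where
  "mult_kappa a b j = (if even j then a else b)"

text \<open>Dunkl operator T_xi (one positive root per reflection; the expression is
  independent of the length of the root).\<close>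
definition dunkl_op ::
  "nat \<Rightarrow> real \<Rightarrow> real \<Rightarrow> complex \<Rightarrow> (complex \<Rightarrow> real) \<Rightarrow> complex \<Rightarrow> real" where
  "dunkl_op k a b \<xi> f x =
     deriv (\<lambda>t. f (x + of_real t * \<xi>)) 0
     + (\<Sum>j<2*k. mult_kappa a b j * (dih_root k j \<bullet> \<xi>)
                  * (f x - f (dih_refl k j x)) / (dih_root k j \<bullet> x))"

definition entire_ps :: "(complex \<Rightarrow> real) \<Rightarrow> bool" where
  "entire_ps f \<longleftrightarrow> (\<exists>c :: nat \<times> nat \<Rightarrow> real. \<forall>x.
      ((\<lambda>(m,n). c (m,n) * Re x ^ m * Im x ^ n) has_sum f x) UNIV \<and>
      (\<lambda>(m,n). \<bar>c (m,n)\<bar> * \<bar>Re x\<bar> ^ m * \<bar>Im x\<bar> ^ n) summable_on UNIV)"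

text \<open>The Dunkl kernel E_kappa(., y): the (unique) real-analytic joint eigenfunction
  T_xi f = <xi,y> f with f(0) = 1 (the eigen-equation imposed off the reflecting lines,
  where the difference quotients are defined; it extends by continuity).\<close>
definition is_dunkl_kernel :: "nat \<Rightarrow> real \<Rightarrow> real \<Rightarrow> complex \<Rightarrow> (complex \<Rightarrow> real) \<Rightarrow> bool" where
  "is_dunkl_kernel k a b y f \<longleftrightarrow>
     entire_ps f \<and> f 0 = 1 \<and>
     (\<forall>\<xi> x. (\<forall>j<2*k. dih_root k j \<bullet> x \<noteq> 0) \<longrightarrow> dunkl_op k a b \<xi> f x = (\<xi> \<bullet> y) * f x)"

definition dunkl_kernel :: "nat \<Rightarrow> real \<Rightarrow> real \<Rightarrow> complex \<Rightarrow> complex \<Rightarrow> real" where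
  "dunkl_kernel k a b x y = (THE f. is_dunkl_kernel k a b y f) x"

definition gen_bessel :: "nat \<Rightarrow> real \<Rightarrow> real \<Rightarrow> complex \<Rightarrow> complex \<Rightarrow> real" where
  "gen_bessel k a b x y =
     (1 / (4 * real k)) * (\<Sum>j<2*k. dunkl_kernel k a b x (dih_rot k j y)
                                   + dunkl_kernel k a b x (dih_refl k j y))"

definition nu_measure :: "real \<Rightarrow> real measure" where
  "nu_measure a = density lborel (\<lambda>u. ennreal (indicator {-1..1} u *
      (Gamma (a + 1/2) / (sqrt pi * Gamma a)) * (1 - u\<^sup>2) powr (a - 1)))"

definition xi_uv :: "real \<Rightarrow> real \<Rightarrow> real \<Rightarrow> real \<Rightarrow> real" where
  "xi_uv u v \<theta>1 \<theta>2 = v * cos \<theta>1 * cos \<theta>2 + u * sin \<theta>1 * sin \<theta>2"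

definition open_simplex :: "nat \<Rightarrow> (nat \<Rightarrow> real) set" where
  "open_simplex k = {t \<in> space (PiM {1..k-1} (\<lambda>_. lborel)).
      (\<forall>j\<in>{1..k-1}. 0 < t j) \<and> (\<Sum>j\<in>{1..k-1}. t j) < 1}"

definition simplex_coord :: "nat \<Rightarrow> (nat \<Rightarrow> real) \<Rightarrow> nat \<Rightarrow> real" where
  "simplex_coord k t j = (if j = 0 then 1 - (\<Sum>i\<in>{1..k-1}. t i) else t j)"

definition G_fun :: "nat \<Rightarrow> real \<Rightarrow> real \<Rightarrow> complex \<Rightarrow> complex \<Rightarrow> real" where
  "G_fun k a b z w =
    Gamma (real k * (a + b)) / (2 * Gamma (a + b) ^ k) *
    set_lebesgue_integral (PiM {1..k-1} (\<lambda>_. lborel)) (open_simplex k)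
      (\<lambda>t. (exp (w \<bullet> (z * (\<Sum>j<k. cis (- 2 * real j * pi / real k) * of_real (simplex_coord k t j))))
           + exp (w \<bullet> (z * (\<Sum>j<k. cis ((2 * real j - 1) * pi / real k) * of_real (simplex_coord k t j)))))
          * (\<Prod>j<k. simplex_coord k t j powr (a + b - 1)))"

end

theory Submission
  imports Defs
begin

text \<open>
  Write \<open>N = k (a + b)\<close>. The homogeneous components \<open>E\<^sub>n\<close> of the Dunkl kernel are determined by the
  radial equation \<open>(n + N) E\<^sub>n - \<Sum>\<^sub>j \<kappa>\<^sub>j E\<^sub>n \<circ> \<sigma>\<^sub>j = \<langle>x, y\<rangle> E\<^sub>n\<^sub>-\<^sub>1\<close>, by a maximum principle on orbits.
  In polar coordinates the remaining component of the eigenvalue equation follows from the same principle: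
  its defect satisfies the radial equation with the signs of the reflections reversed, because the sum of
  the reflections anticommutes with the angular difference operator.

  The numbers \<open>pochhammer N n * E\<^sub>n (g x)\<close>, \<open>g\<close> in the group, have generating functions \<open>f\<^sub>g(t)\<close> with
  \<open>(1 - \<langle>g x, y\<rangle> t) (t f\<^sub>g' + N f\<^sub>g) = \<Sum>\<^sub>j \<kappa>\<^sub>j f\<^bsub>\<sigma>\<^sub>j g\<^esub>\<close>, and the right-hand side depends only on the class of \<open>g\<close> modulo
  rotations by \<open>2 \<pi> / k\<close>. Summing over the four classes gives a closed system, which involves the group only
  through the products of \<open>1 - \<langle>g x, y\<rangle> t\<close> over the classes. These products are \<open>P(t) - q(t) cos (\<dots>)\<close>, so that the system
  is the pullback along \<open>q / P\<close> of the one for \<open>k = 1\<close>, where the kernel is a product of rank one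
  kernels and has the integral representation with \<open>(1 \<plusminus> u) (1 \<plusminus> v)\<close> against the two beta measures. On the other side,
  \<open>G\<close> is the exponential integrated against a Dirichlet distribution, of which the moments are the
  coefficients of \<open>(P - q \<xi>) powr (- (a + b))\<close> divided by \<open>pochhammer N n\<close>.
\<close>

subsection \<open>Sums over periodic functions\<close>

text \<open>The kernel is specified by a definite description over entire functions, so existence
  and uniqueness both have to come out of the definition. Uniqueness needs only the direction
  \<open>x\<close>: there every quotient of inner products with a root is 1 and the equation closes
  up degree by degree. Existence needs all directions, hence the separate treatment of the angular
  one. No formula for the full kernel is produced. Only class sums are computed: \<open>kap\<close>
  depends on parity alone, so the reflections couple four sums and nothing finer. The series
  \<open>q\<close> comes from a Chebyshev phenomenon: the product of \<open>1 - x cos\<close> over a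
  regular \<open>k\<close>-gon of angles depends on the position of the polygon only through
  \<open>2 (x/2)^k cos (k \<theta>)\<close>. This is why the angles enter as
  \<open>k \<phi>1\<close> and \<open>k \<phi>2\<close>. The second exponential in \<open>G\<close>
  belongs to the polygon turned by \<open>\<pi> / k\<close>, which changes the sign of
  \<open>\<xi>\<close>. So \<open>g\<close> is even in \<open>\<xi>\<close>; this loses nothing
  under the integral, because the odd moments vanish.\<close>

lemma sum_periodic_shift:
  fixes h :: "int \<Rightarrow> 'a::ab_group_add"
  assumes per: "\<And>l. h (l + int K) = h l"
  shows "(\<Sum>l<K. h (int l + s)) = (\<Sum>l<K. h (int l))"
proof -
  have step: "(\<Sum>l<K. h (int l + (s + 1))) = (\<Sum>l<K. h (int l + s))" for s
  proof -
    have "(\<Sum>l<Suc K. h (int l + s)) = h s + (\<Sum>l<K. h (int l + (s + 1)))"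
      by (subst sum.lessThan_Suc_shift) (simp add: algebra_simps)
    moreover have "(\<Sum>l<Suc K. h (int l + s)) = (\<Sum>l<K. h (int l + s)) + h s"
      using per[of s] by (simp add: add.commute)
    ultimately show ?thesis by (simp add: add.commute)
  qed
  show ?thesis
  proof (induction s rule: int_induct[where k=0])
    case base show ?case by simp
  next
    case (step1 i) then show ?case using step[of i] by simp
  next
    case (step2 i) then show ?case using step[of "i - 1"] by simp
  qed
qed

lemma sum_periodic_reflect:
  fixes h :: "int \<Rightarrow> 'a::ab_group_add"
  assumes per: "\<And>l. h (l + int K) = h l"
  shows "(\<Sum>l<K. h (s - int l)) = (\<Sum>l<K. h (int l))"
proof -
  have "(\<Sum>l<K. h (s - int l)) = (\<Sum>l<K. h (int (K - Suc l) + (s + 1 - int K)))"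
    by (rule sum.cong) (auto simp: algebra_simps of_nat_diff)
  also have "\<dots> = (\<Sum>l<K. h (int l + (s + 1 - int K)))"
    by (rule sum.nat_diff_reindex)
  also have "\<dots> = (\<Sum>l<K. h (int l))" by (rule sum_periodic_shift) (rule per)
  finally show ?thesis .
qed

lemma sum_lessThan_double:
  fixes f :: "nat \<Rightarrow> 'a::comm_monoid_add"
  shows "(\<Sum>i<2*k. f i) = (\<Sum>l<k. f (2*l)) + (\<Sum>l<k. f (2*l+1))"
  by (induction k) (simp_all add: ac_simps)

subsection \<open>Binary forms\<close>

text \<open>Used in two coordinate systems: \<open>(x, cnj x)\<close>, in which reflections act by a
  swap, and \<open>(Re x, Im x)\<close>, in which \<open>entire_ps\<close> is phrased.\<close>

definition bform :: "nat \<Rightarrow> (nat \<Rightarrow> complex) \<Rightarrow> complex \<Rightarrow> complex \<Rightarrow> complex" where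
  "bform n c u v = (\<Sum>i\<le>n. c i * u ^ i * v ^ (n - i))"

definition mul_lin :: "complex \<Rightarrow> complex \<Rightarrow> nat \<Rightarrow> (nat \<Rightarrow> complex) \<Rightarrow> nat \<Rightarrow> complex" where
  "mul_lin \<alpha> \<beta> n c i = (if i \<le> n then \<beta> * c i else 0) + (if i = 0 then 0 else \<alpha> * c (i - 1))"

text \<open>This norm grows under multiplication by a linear form by at most the norm of that form,
  which makes all the estimates inductive.\<close>

definition l1 :: "nat \<Rightarrow> (nat \<Rightarrow> complex) \<Rightarrow> real" where
  "l1 n c = (\<Sum>i\<le>n. norm (c i))"

lemma bform_mul_lin:
  "bform (Suc n) (mul_lin \<alpha> \<beta> n c) u v = (\<alpha> * u + \<beta> * v) * bform n c u v"
proof -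
  have "bform (Suc n) (mul_lin \<alpha> \<beta> n c) u v =
     (\<Sum>i\<le>Suc n. (if i \<le> n then \<beta> * c i else 0) * u ^ i * v ^ (Suc n - i))
     + (\<Sum>i\<le>Suc n. (if i = 0 then 0 else \<alpha> * c (i - 1)) * u ^ i * v ^ (Suc n - i))"
    by (simp only: bform_def mul_lin_def sum.distrib[symmetric] algebra_simps)
  also have "(\<Sum>i\<le>Suc n. (if i \<le> n then \<beta> * c i else 0) * u ^ i * v ^ (Suc n - i))
      = (\<Sum>i\<le>n. \<beta> * v * (c i * u ^ i * v ^ (n - i)))"
    by (auto simp: Suc_diff_le intro!: sum.cong)
  also have "(\<Sum>i\<le>Suc n. (if i = 0 then 0 else \<alpha> * c (i - 1)) * u ^ i * v ^ (Suc n - i))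
      = (\<Sum>i\<le>n. \<alpha> * u * (c i * u ^ i * v ^ (n - i)))"
    by (subst sum.atMost_Suc_shift) (auto intro!: sum.cong)
  finally show ?thesis
    by (simp add: bform_def sum_distrib_left[symmetric] algebra_simps)
qed

lemma l1_mul_lin: "l1 (Suc n) (mul_lin \<alpha> \<beta> n c) \<le> (norm \<alpha> + norm \<beta>) * l1 n c"
proof -
  have "l1 (Suc n) (mul_lin \<alpha> \<beta> n c) \<le>
     (\<Sum>i\<le>Suc n. norm (if i \<le> n then \<beta> * c i else 0) + norm (if i = 0 then 0 else \<alpha> * c (i - 1)))"
    unfolding l1_def mul_lin_def by (intro sum_mono norm_triangle_ineq)
  also have "\<dots> = (\<Sum>i\<le>Suc n. norm (if i \<le> n then \<beta> * c i else 0))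
     + (\<Sum>i\<le>Suc n. norm (if i = 0 then 0 else \<alpha> * c (i - 1)))"
    by (rule sum.distrib)
  also have "(\<Sum>i\<le>Suc n. norm (if i \<le> n then \<beta> * c i else 0)) = norm \<beta> * l1 n c"
    by (simp add: l1_def sum_distrib_left norm_mult)
  also have "(\<Sum>i\<le>Suc n. norm (if i = 0 then 0 else \<alpha> * c (i - 1))) = norm \<alpha> * l1 n c"
    by (subst sum.atMost_Suc_shift) (simp add: l1_def sum_distrib_left norm_mult)
  finally show ?thesis by (simp add: algebra_simps)
qed

lemma l1_nonneg: "0 \<le> l1 n c"
  by (auto simp: l1_def intro!: sum_nonneg)

lemma norm_bform_le:
  assumes "norm u \<le> r" "norm v \<le> r"
  shows "norm (bform n c u v) \<le> l1 n c * r ^ n"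
proof -
  have r: "0 \<le> r" using assms(1) norm_ge_zero order_trans by blast
  have "norm (bform n c u v) \<le> (\<Sum>i\<le>n. norm (c i * u ^ i * v ^ (n - i)))"
    unfolding bform_def by (rule norm_sum)
  also have "\<dots> \<le> (\<Sum>i\<le>n. norm (c i) * r ^ n)"
  proof (rule sum_mono)
    fix i assume "i \<in> {..n}"
    have "norm u ^ i * norm v ^ (n - i) \<le> r ^ i * r ^ (n - i)"
      using assms r by (intro mult_mono power_mono) auto
    also have "\<dots> = r ^ n" using \<open>i \<in> {..n}\<close> by (simp flip: power_add)
    finally show "norm (c i * u ^ i * v ^ (n - i)) \<le> norm (c i) * r ^ n"
      by (simp add: norm_mult norm_power mult.assoc mult_left_mono)
  qed
  finally show ?thesis by (simp add: l1_def sum_distrib_right)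
qed

lemma bform_cong: "(\<And>i. i \<le> n \<Longrightarrow> c i = d i) \<Longrightarrow> bform n c u v = bform n d u v"
  by (simp add: bform_def)

lemma bform_smult: "bform n (\<lambda>i. s * c i) u v = s * bform n c u v"
  by (simp add: bform_def sum_distrib_left mult.assoc)

lemma bform_diff: "bform n (\<lambda>i. c i - d i) u v = bform n c u v - bform n d u v"
  by (simp add: bform_def sum_subtractf algebra_simps)

lemma bform_sum: "bform n (\<lambda>i. \<Sum>j\<in>J. c j i) u v = (\<Sum>j\<in>J. bform n (c j) u v)"
  unfolding bform_def sum_distrib_right by (rule sum.swap)

subsection \<open>The dihedral setting\<close>

locale dihedral =
  fixes k :: nat and a b :: real
  assumes k_pos: "k > 0" and a_pos: "a > 0" and b_pos: "b > 0"
begin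

text \<open>Integer indices: composing reflections produces differences \<open>i - j\<close>, and
  periodicity modulo \<open>2 k\<close> then takes the place of residues.\<close>

definition om :: "int \<Rightarrow> complex" where "om j = cis (of_int j * pi / real k)"
definition kap :: "int \<Rightarrow> real" where "kap j = (if even j then a else b)"
definition rfl :: "int \<Rightarrow> complex \<Rightarrow> complex" where "rfl j x = cnj x * om j"
definition N :: real where "N = real k * (a + b)"

lemma N_pos: "N > 0" using k_pos a_pos b_pos by (simp add: N_def)

lemma kap_pos: "kap j > 0" using a_pos b_pos by (simp add: kap_def)

lemma kap_period [simp]: "kap (j + 2 * int k) = kap j" by (simp add: kap_def)

lemma kap_reflect [simp]: "kap (2 * i - j) = kap j" by (simp add: kap_def)

lemma om_add: "om (i + j) = om i * om j"
  by (simp add: om_def cis_mult add_divide_distrib distrib_right)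

lemma om_0 [simp]: "om 0 = 1" by (simp add: om_def)

lemma om_period [simp]: "om (j + 2 * int k) = om j"
proof -
  have "om (2 * int k) = 1" using k_pos by (simp add: om_def)
  then show ?thesis by (simp add: om_add)
qed

lemma cnj_om [simp]: "cnj (om j) = om (- j)"
  by (simp add: om_def cis_cnj)

lemma om_uminus_mult [simp]: "om (- j) * om j = 1" "om j * om (- j) = 1"
  by (simp_all flip: om_add)

lemma norm_om [simp]: "norm (om j) = 1" by (simp add: om_def)

lemma om_power: "om j ^ n = om (j * int n)"
  by (simp add: om_def Complex.DeMoivre ac_simps)

lemma rfl_period [simp]: "rfl (j + 2 * int k) x = rfl j x" by (simp add: rfl_def)

lemma rfl_rfl: "rfl i (rfl j x) = x * om (i - j)"
  by (simp add: rfl_def om_add[of i "- j", simplified] mult_ac)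

lemma rfl_rot: "rfl i (x * om j) = cnj x * om (i - j)"
  by (simp add: rfl_def om_add[of i "- j", simplified] mult_ac)

lemma sum_kap: "(\<Sum>j<2*k. kap (int j)) = N"
  unfolding sum_lessThan_double by (simp add: kap_def N_def distrib_left)

text \<open>\<open>N - Kop\<close> is the difference part of the Dunkl operator in direction
  \<open>x\<close>, the quotients of inner products being 1 there.\<close>

definition Kop :: "(complex \<Rightarrow> real) \<Rightarrow> complex \<Rightarrow> real" where
  "Kop f x = (\<Sum>j<2*k. kap (int j) * f (rfl (int j) x))"

text \<open>Discrete Fourier transform of \<open>kap\<close>. On forms of degree \<open>n\<close> in
  \<open>x, cnj x\<close>, \<open>Kop\<close> puts \<open>lam (n - 2 m)\<close> times the old
  coefficient \<open>n - m\<close> in place of coefficient \<open>m\<close>.\<close>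

definition lam :: "int \<Rightarrow> complex" where
  "lam l = (\<Sum>j<2*k. of_real (kap (int j)) * om (int j * l))"

lemma norm_lam: "norm (lam l) \<le> N"
proof -
  have "norm (lam l) \<le> (\<Sum>j<2*k. norm (of_real (kap (int j)) * om (int j * l)))"
    unfolding lam_def by (rule norm_sum)
  also have "\<dots> = (\<Sum>j<2*k. kap (int j))"
    using kap_pos by (intro sum.cong) (auto simp: norm_mult abs_of_pos)
  finally show ?thesis by (simp add: sum_kap)
qed

section \<open>Homogeneous components of the Dunkl kernel\<close>

definition den :: "nat \<Rightarrow> nat \<Rightarrow> complex" where
  "den n m = of_real ((real n + N)\<^sup>2) - lam (int n - 2 * int m) * lam (2 * int m - int n)"

text \<open>The bound is \<open>(n + N)^2 - N^2\<close>, positive for \<open>n > 0\<close>, so the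
  two by two systems are invertible.\<close>

lemma norm_den: "norm (den n m) \<ge> real n * (real n + 2 * N)"
proof -
  have "norm (lam (int n - 2 * int m) * lam (2 * int m - int n)) \<le> N * N"
    unfolding norm_mult using N_pos by (intro mult_mono norm_lam) auto
  moreover have "norm (of_real ((real n + N)\<^sup>2) :: complex) = (real n + N)\<^sup>2"
    unfolding norm_of_real by simp
  ultimately have "norm (den n m) \<ge> (real n + N)\<^sup>2 - N * N"
    unfolding den_def using norm_triangle_ineq2 by (smt (verit))
  then show ?thesis by (simp add: power2_eq_square algebra_simps)
qed

text \<open>The coefficients of the homogeneous components of the Dunkl kernel in the variables
  \<open>x, cnj x\<close>. The reflections couple only the coefficients \<open>m\<close> and \<open>n - m\<close>, so that the
  radial equation is solved by inverting two by two matrices with determinant \<open>den n m\<close>.\<close>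

primrec cf :: "complex \<Rightarrow> nat \<Rightarrow> nat \<Rightarrow> complex" where
  "cf y 0 = (\<lambda>m. 1)"
| "cf y (Suc n) = (\<lambda>m.
     (of_real (real (Suc n) + N) * mul_lin (cnj y / 2) (y / 2) n (cf y n) m
      + lam (int (Suc n) - 2 * int m) * mul_lin (cnj y / 2) (y / 2) n (cf y n) (Suc n - m))
     / den (Suc n) m)"

text \<open>Summed over \<open>m\<close>, the inverse matrices cost at most
  \<open>(s + N) + N\<close> over \<open>s (s + 2 N)\<close>, that is \<open>1 / s\<close>. The
  linear form contributes \<open>norm y / 2\<close> twice. Iterating gives the terms of the
  exponential series.\<close>

lemma l1_cf: "l1 n (cf y n) \<le> norm y ^ n / fact n"
proof (induction n)
  case 0 show ?case by (simp add: l1_def)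
next
  case (Suc n)
  define d where "d = mul_lin (cnj y / 2) (y / 2) n (cf y n)"
  define s where "s = real (Suc n)"
  have s: "s > 0" by (simp add: s_def)
  have sN: "s * (s + 2 * N) > 0" using N_pos s by auto
  have "l1 (Suc n) (cf y (Suc n)) \<le>
     (\<Sum>m\<le>Suc n. ((s + N) * norm (d m) + N * norm (d (Suc n - m))) / (s * (s + 2 * N)))"
    unfolding l1_def
  proof (rule sum_mono)
    fix m
    have "norm (of_real (s + N) * d m + lam (int (Suc n) - 2 * int m) * d (Suc n - m))
       \<le> (s + N) * norm (d m) + N * norm (d (Suc n - m))"
      using N_pos s norm_lam
      by (intro order_trans[OF norm_triangle_ineq] add_mono)
         (auto simp: norm_mult simp del: of_real_add intro!: mult_right_mono)
    moreover have "norm (den (Suc n) m) \<ge> s * (s + 2 * N)" unfolding s_def by (rule norm_den)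
    ultimately show "norm (cf y (Suc n) m) \<le>
       ((s + N) * norm (d m) + N * norm (d (Suc n - m))) / (s * (s + 2 * N))"
      using sN N_pos s unfolding cf.simps d_def[symmetric] s_def[symmetric] norm_divide
      by (intro frac_le) auto
  qed
  also have "\<dots> = ((s + N) * l1 (Suc n) d + N * (\<Sum>m\<le>Suc n. norm (d (Suc n - m)))) / (s * (s + 2 * N))"
    by (simp only: l1_def sum_divide_distrib[symmetric] sum.distrib sum_distrib_left[symmetric])
  also have "(\<Sum>m\<le>Suc n. norm (d (Suc n - m))) = l1 (Suc n) d"
    unfolding l1_def by (rule sum.nat_diff_reindex[of "\<lambda>i. norm (d i)" "Suc (Suc n)", simplified lessThan_Suc_atMost diff_Suc_Suc])
  also have "((s + N) * l1 (Suc n) d + N * l1 (Suc n) d) / (s * (s + 2 * N)) = l1 (Suc n) d / s"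
  proof -
    have "s + 2 * N \<noteq> 0" "s \<noteq> 0" using N_pos s by linarith+
    then show ?thesis by (simp add: divide_simps) (simp add: algebra_simps)
  qed
  also have "\<dots> \<le> (norm y * l1 n (cf y n)) / s"
    using l1_mul_lin[of n "cnj y / 2" "y / 2" "cf y n"] s
    by (intro divide_right_mono) (auto simp: d_def norm_divide)
  also have "\<dots> \<le> (norm y * (norm y ^ n / fact n)) / s"
    using Suc s by (intro divide_right_mono mult_left_mono) auto
  finally show ?case by (simp add: s_def field_simps)
qed

definition cker :: "complex \<Rightarrow> nat \<Rightarrow> complex \<Rightarrow> complex" where
  "cker y n x = bform n (cf y n) x (cnj x)"

lemma bform_refl:
  "bform n c (rfl j x) (cnj (rfl j x)) =
   bform n (\<lambda>m. c (n - m) * om (j * (int n - 2 * int m))) x (cnj x)"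
proof -
  have "bform n c (rfl j x) (cnj (rfl j x)) =
     (\<Sum>m\<le>n. c (n - m) * rfl j x ^ (n - m) * cnj (rfl j x) ^ (n - (n - m)))"
    unfolding bform_def
    by (rule sum.nat_diff_reindex[of "\<lambda>m. c m * rfl j x ^ m * cnj (rfl j x) ^ (n - m)" "Suc n",
         simplified lessThan_Suc_atMost diff_Suc_Suc, symmetric])
  also have "\<dots> = (\<Sum>m\<le>n. c (n - m) * om (j * (int n - 2 * int m)) * x ^ m * cnj x ^ (n - m))"
  proof (rule sum.cong)
    fix m assume "m \<in> {..n}"
    then have "om (j * (int n - 2 * int m)) = om (j * int (n - m)) * om (- j * int m)"
      by (simp add: om_add[symmetric] of_nat_diff algebra_simps)
    then show "c (n - m) * rfl j x ^ (n - m) * cnj (rfl j x) ^ (n - (n - m)) =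
       c (n - m) * om (j * (int n - 2 * int m)) * x ^ m * cnj x ^ (n - m)"
      using \<open>m \<in> {..n}\<close> by (simp add: rfl_def power_mult_distrib om_power)
  qed simp
  finally show ?thesis by (simp add: bform_def)
qed

lemma inner_eq_complex: "of_real (x \<bullet> y) = cnj y / 2 * x + y / 2 * cnj x"
  by (simp add: complex_eq_iff inner_complex_def field_simps)

lemma cker_0 [simp]: "cker y 0 x = 1" by (simp add: cker_def bform_def)

lemma cker_Suc:
  "of_real (real (Suc n) + N) * cker y (Suc n) x
   - (\<Sum>j<2*k. of_real (kap (int j)) * cker y (Suc n) (rfl (int j) x))
   = of_real (x \<bullet> y) * cker y n x"
proof -
  define d where "d = mul_lin (cnj y / 2) (y / 2) n (cf y n)"
  define c where "c = cf y (Suc n)"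
  have "(\<Sum>j<2*k. of_real (kap (int j)) * cker y (Suc n) (rfl (int j) x)) =
    bform (Suc n) (\<lambda>m. lam (int (Suc n) - 2 * int m) * c (Suc n - m)) x (cnj x)"
    by (simp only: cker_def bform_refl bform_smult[symmetric] bform_sum[symmetric] c_def[symmetric]
         lam_def sum_distrib_left sum_distrib_right mult_ac)
  then have "of_real (real (Suc n) + N) * cker y (Suc n) x
     - (\<Sum>j<2*k. of_real (kap (int j)) * cker y (Suc n) (rfl (int j) x)) =
     bform (Suc n) (\<lambda>m. of_real (real (Suc n) + N) * c m
        - lam (int (Suc n) - 2 * int m) * c (Suc n - m)) x (cnj x)"
    by (simp only: bform_diff bform_smult cker_def c_def)
  also have "\<dots> = bform (Suc n) d x (cnj x)"
  proof (rule bform_cong)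
    fix m assume m: "m \<le> Suc n"
    define L where "L = lam (int (Suc n) - 2 * int m)"
    define L' where "L' = lam (2 * int m - int (Suc n))"
    define s :: complex where "s = of_real (real (Suc n) + N)"
    \<comment> \<open>Passing from \<open>m\<close> to \<open>Suc n - m\<close> exchanges
      \<open>L\<close> and \<open>L'\<close>, so both equations of the pair have the same
      determinant and Cramer's rule applies.\<close>
    have L': "lam (int (Suc n) - 2 * int (Suc n - m)) = L'"
      "lam (2 * int (Suc n - m) - int (Suc n)) = L"
      unfolding L_def L'_def using m by (auto simp: of_nat_diff intro!: arg_cong[of _ _ lam])
    have dd: "den (Suc n) m = s\<^sup>2 - L * L'" "den (Suc n) (Suc n - m) = s\<^sup>2 - L' * L"
      unfolding den_def L' unfolding L_def L'_def s_def by simp_all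
    have "norm (den (Suc n) m) > 0"
      using norm_den[of "Suc n" m] N_pos by (smt (verit) mult_pos_pos of_nat_0_less_iff zero_less_Suc)
    then have nz: "s\<^sup>2 - L * L' \<noteq> 0" using dd by auto
    have c: "c m = (s * d m + L * d (Suc n - m)) / (s\<^sup>2 - L * L')"
      "c (Suc n - m) = (s * d (Suc n - m) + L' * d m) / (s\<^sup>2 - L * L')"
      unfolding c_def cf.simps L' dd unfolding d_def[symmetric] L_def[symmetric] s_def[symmetric]
      using m by (simp_all add: mult.commute)
    show "of_real (real (Suc n) + N) * c m - lam (int (Suc n) - 2 * int m) * c (Suc n - m) = d m"
      unfolding c s_def[symmetric] L_def[symmetric] using nz
      by (simp add: divide_simps) (simp add: algebra_simps power2_eq_square)
  qed
  also have "\<dots> = of_real (x \<bullet> y) * cker y n x"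
    unfolding d_def bform_mul_lin inner_eq_complex cker_def ..
  finally show ?thesis .
qed

lemma norm_cker: "norm (cker y n x) \<le> (norm y * norm x) ^ n / fact n"
proof -
  have "norm (cker y n x) \<le> l1 n (cf y n) * norm x ^ n"
    unfolding cker_def by (rule norm_bform_le) auto
  also have "\<dots> \<le> norm y ^ n / fact n * norm x ^ n"
    by (intro mult_right_mono l1_cf) auto
  finally show ?thesis by (simp add: power_mult_distrib)
qed

text \<open>\<open>cker_Suc\<close> has real coefficients, so the real part solves the same
  recursion with the same initial value.\<close>

definition ker :: "complex \<Rightarrow> nat \<Rightarrow> complex \<Rightarrow> real" where
  "ker y n x = Re (cker y n x)"

lemma ker_0 [simp]: "ker y 0 x = 1" by (simp add: ker_def)

lemma ker_Suc: "(real (Suc n) + N) * ker y (Suc n) x - Kop (ker y (Suc n)) x = (x \<bullet> y) * ker y n x"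
  using arg_cong[OF cker_Suc, of Re n y x] by (simp add: ker_def Kop_def)

lemma abs_ker: "\<bar>ker y n x\<bar> \<le> (norm y * norm x) ^ n / fact n"
  using abs_Re_le_cmod norm_cker order_trans unfolding ker_def by blast

subsection \<open>A maximum principle on orbits\<close>

definition orbit_sum :: "(complex \<Rightarrow> real) \<Rightarrow> complex \<Rightarrow> real" where
  "orbit_sum h x = (\<Sum>j<2*k. h (x * om (int j)) + h (rfl (int j) x))"

text \<open>The mirror of \<open>rfl j\<close> is spanned by \<open>cis (j \<pi> / (2 k))\<close>.
  Ranging over all integers \<open>j\<close> makes invariance under reflections a mere change of
  index.\<close>

definition off_lines :: "complex \<Rightarrow> bool" where
  "off_lines x \<longleftrightarrow> (\<forall>j. Im (x * cis (- of_int j * pi / (2 * real k))) \<noteq> 0)"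

lemma orbit_sum_refl: "orbit_sum (\<lambda>z. h (rfl i z)) x = orbit_sum h x"
proof -
  have per: "h (cnj x * om (l + int (2*k))) = h (cnj x * om l)" "h (x * om (l + int (2*k))) = h (x * om l)" for l
    by simp_all
  have "orbit_sum (\<lambda>z. h (rfl i z)) x =
     (\<Sum>j<2*k. h (cnj x * om (i - int j))) + (\<Sum>j<2*k. h (x * om (i - int j)))"
    by (simp add: orbit_sum_def rfl_rot rfl_rfl sum.distrib)
  also have "\<dots> = (\<Sum>j<2*k. h (cnj x * om (int j))) + (\<Sum>j<2*k. h (x * om (int j)))"
    by (subst (1 2) sum_periodic_reflect) (use per in simp_all)
  finally show ?thesis by (simp add: orbit_sum_def rfl_def sum.distrib)
qed

text \<open>Reflections permute an orbit, so on the orbit sum of the absolute values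
  \<open>Kop\<close> costs at most a factor \<open>N\<close>, and \<open>s + N > N\<close> forces
  the sum to vanish. The absolute values in \<open>eq\<close> cover \<open>Kop W\<close> and
  \<open>- Kop W\<close> alike; \<open>S\<close> is later the whole plane or the complement of the
  mirrors.\<close>

lemma orbit_max_principle:
  fixes W :: "complex \<Rightarrow> real"
  assumes inv: "\<And>z j. S z \<Longrightarrow> S (rfl j z)"
    and eq: "\<And>z. S z \<Longrightarrow> \<bar>(s + N) * W z\<bar> = \<bar>Kop W z\<bar>"
    and s: "s > 0" and x: "S x"
  shows "W x = 0"
proof -
  have le: "(s + N) * \<bar>W z\<bar> \<le> (\<Sum>j<2*k. kap (int j) * \<bar>W (rfl (int j) z)\<bar>)" if "S z" for z
  proof -
    have "(s + N) * \<bar>W z\<bar> = \<bar>Kop W z\<bar>" using eq[OF that] s N_pos by (simp add: abs_mult)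
    also have "\<dots> \<le> (\<Sum>j<2*k. \<bar>kap (int j) * W (rfl (int j) z)\<bar>)"
      unfolding Kop_def by (rule sum_abs)
    finally show ?thesis using kap_pos by (simp add: abs_mult abs_of_pos)
  qed
  have Srot: "S (x * om (int j))" for j
    using inv[OF inv[OF x, of 0], of "int j"] by (simp add: rfl_rfl)
  have "(s + N) * orbit_sum (\<lambda>z. \<bar>W z\<bar>) x = orbit_sum (\<lambda>z. (s + N) * \<bar>W z\<bar>) x"
    by (simp add: orbit_sum_def sum_distrib_left distrib_left)
  also have "\<dots> \<le> orbit_sum (\<lambda>z. \<Sum>j<2*k. kap (int j) * \<bar>W (rfl (int j) z)\<bar>) x"
    unfolding orbit_sum_def by (intro sum_mono add_mono le Srot inv x)
  also have "\<dots> = (\<Sum>j<2*k. kap (int j) * orbit_sum (\<lambda>z. \<bar>W (rfl (int j) z)\<bar>) x)"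
    unfolding orbit_sum_def sum.distrib[symmetric] sum_distrib_left distrib_left by (rule sum.swap)
  also have "\<dots> = N * orbit_sum (\<lambda>z. \<bar>W z\<bar>) x"
    by (simp add: orbit_sum_refl[of "\<lambda>z. \<bar>W z\<bar>"] sum_kap flip: sum_distrib_right)
  finally have "s * orbit_sum (\<lambda>z. \<bar>W z\<bar>) x \<le> 0" by (simp add: algebra_simps)
  then have "orbit_sum (\<lambda>z. \<bar>W z\<bar>) x \<le> 0" using s by (simp add: mult_le_0_iff)
  moreover have "\<bar>W (x * om (int 0))\<bar> \<le> orbit_sum (\<lambda>z. \<bar>W z\<bar>) x"
    unfolding orbit_sum_def
    by (rule order_trans[OF _ member_le_sum[of 0]]) (use k_pos in auto)
  ultimately show ?thesis by simp
qed

end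

context dihedral
begin

subsection \<open>The angular equation\<close>

text \<open>Real directional derivative of \<open>cker y n\<close> at \<open>x\<close> along
  \<open>v\<close>. Where an exponent is truncated at 0, the integer factor in front
  vanishes.\<close>

definition ddir :: "complex \<Rightarrow> nat \<Rightarrow> complex \<Rightarrow> complex \<Rightarrow> complex" where
  "ddir y n x v = (\<Sum>i\<le>n. cf y n i * (of_nat i * x ^ (i - 1) * v * cnj x ^ (n - i)
      + x ^ i * (of_nat (n - i) * cnj x ^ (n - i - 1) * cnj v)))"

definition kang :: "complex \<Rightarrow> nat \<Rightarrow> complex \<Rightarrow> real" where
  "kang y n x = Re (ddir y n x (\<i> * x))"

lemma has_vector_derivative_power_comp:
  fixes g :: "real \<Rightarrow> complex"
  assumes "(g has_vector_derivative g') (at t)"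
  shows "((\<lambda>s. g s ^ i) has_vector_derivative of_nat i * g t ^ (i - 1) * g') (at t)"
proof -
  have "((\<lambda>z. z ^ i) has_field_derivative of_nat i * g t ^ (i - 1)) (at (g t))"
    by (auto intro!: derivative_eq_intros)
  from field_vector_diff_chain_at[OF assms this] show ?thesis
    by (simp add: o_def mult_ac)
qed

lemma cker_has_vector_derivative:
  assumes g: "(g has_vector_derivative g') (at t)"
  shows "((\<lambda>s. cker y n (g s)) has_vector_derivative ddir y n (g t) g') (at t)"
proof -
  have gc: "((\<lambda>s. cnj (g s)) has_vector_derivative cnj g') (at t)"
    using g by (rule has_vector_derivative_cnj)
  have "((\<lambda>s. cf y n i * (g s ^ i * cnj (g s) ^ (n - i))) has_vector_derivative
      cf y n i * (g t ^ i * (of_nat (n - i) * cnj (g t) ^ (n - i - 1) * cnj g')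
        + (of_nat i * g t ^ (i - 1) * g') * cnj (g t) ^ (n - i))) (at t)" for i
    by (intro has_vector_derivative_mult_right has_vector_derivative_mult
         has_vector_derivative_power_comp g gc)
  then have "((\<lambda>s. \<Sum>i\<le>n. cf y n i * (g s ^ i * cnj (g s) ^ (n - i))) has_vector_derivative
      (\<Sum>i\<le>n. cf y n i * (g t ^ i * (of_nat (n - i) * cnj (g t) ^ (n - i - 1) * cnj g')
        + (of_nat i * g t ^ (i - 1) * g') * cnj (g t) ^ (n - i)))) (at t)"
    by (intro has_vector_derivative_sum)
  then show ?thesis
    by (simp add: cker_def bform_def ddir_def algebra_simps)
qed

lemma ker_has_real_derivative:
  assumes g: "(g has_vector_derivative g') (at t)"
  shows "((\<lambda>s. ker y n (g s)) has_real_derivative Re (ddir y n (g t) g')) (at t)"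
  using bounded_linear.has_vector_derivative[OF bounded_linear_Re cker_has_vector_derivative[OF g]]
  by (simp add: ker_def has_real_derivative_iff_has_vector_derivative)

lemma ddir_linear:
  "ddir y n x (of_real \<alpha> * v + of_real \<beta> * w) = of_real \<alpha> * ddir y n x v + of_real \<beta> * ddir y n x w"
  by (simp add: ddir_def sum_distrib_left sum.distrib[symmetric] algebra_simps)

lemma ddir_uminus: "ddir y n x (- v) = - ddir y n x v"
  using ddir_linear[of y n x "-1" v 0 0] by simp

text \<open>Euler's identity for homogeneous polynomials.\<close>

lemma ddir_radial: "ddir y n x x = of_nat n * cker y n x"
proof -
  have "cf y n i * (of_nat i * x ^ (i - 1) * x * cnj x ^ (n - i)
      + x ^ i * (of_nat (n - i) * cnj x ^ (n - i - 1) * cnj x))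
     = of_nat n * (cf y n i * x ^ i * cnj x ^ (n - i))" if "i \<le> n" for i
  proof -
    have p: "of_nat j * (z ^ (j - 1) * z) = of_nat j * z ^ j" for j and z :: complex
      by (cases j) (auto simp: mult.commute)
    have "cf y n i * (of_nat i * x ^ (i - 1) * x * cnj x ^ (n - i)
      + x ^ i * (of_nat (n - i) * cnj x ^ (n - i - 1) * cnj x))
      = cf y n i * ((of_nat i * (x ^ (i - 1) * x)) * cnj x ^ (n - i)
      + x ^ i * (of_nat (n - i) * (cnj x ^ (n - i - 1) * cnj x)))"
      by (simp only: mult.assoc)
    also have "\<dots> = cf y n i * x ^ i * cnj x ^ (n - i) * (of_nat i + of_nat (n - i))"
      unfolding p by (simp only: algebra_simps)
    also have "of_nat i + of_nat (n - i) = (of_nat n :: complex)"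
      using that by (simp flip: of_nat_add)
    finally show ?thesis by (simp only: mult_ac)
  qed
  then show ?thesis
    unfolding ddir_def cker_def bform_def sum_distrib_left by (intro sum.cong) auto
qed

lemma Re_ddir_polar:
  "Re (ddir y n x (of_real \<alpha> * x + of_real \<beta> * (\<i> * x))) = \<alpha> * (real n * ker y n x) + \<beta> * kang y n x"
  by (simp add: ddir_linear ddir_radial kang_def ker_def)

lemma norm_ddir:
  assumes "norm x \<le> r"
  shows "norm (ddir y n x v) \<le> norm y ^ n / fact n * (real n * r ^ (n - 1) * norm v)"
proof -
  have r: "0 \<le> r" using assms norm_ge_zero order_trans by blast
  have "norm (ddir y n x v) \<le> (\<Sum>i\<le>n. norm (cf y n i) * (real n * r ^ (n - 1) * norm v))"
    unfolding ddir_def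
  proof (rule sum_norm_le)
    fix i assume i: "i \<in> {..n}"
    have 1: "norm (of_nat i * x ^ (i - 1) * v * cnj x ^ (n - i)) \<le> real i * r ^ (n - 1) * norm v"
    proof (cases "i = 0")
      case False
      have "norm x ^ (i - 1) * norm x ^ (n - i) \<le> r ^ (i - 1) * r ^ (n - i)"
        using assms r by (intro mult_mono power_mono) auto
      also have "\<dots> = r ^ (n - 1)" using False i by (simp flip: power_add)
      finally have "real i * norm v * (norm x ^ (i - 1) * norm x ^ (n - i)) \<le> real i * norm v * r ^ (n - 1)"
        by (intro mult_left_mono) auto
      then show ?thesis by (simp add: norm_mult norm_power mult_ac)
    qed simp
    have 2: "norm (x ^ i * (of_nat (n - i) * cnj x ^ (n - i - 1) * cnj v)) \<le> real (n - i) * r ^ (n - 1) * norm v"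
    proof (cases "i = n")
      case False
      have "norm x ^ i * norm x ^ (n - i - 1) \<le> r ^ i * r ^ (n - i - 1)"
        using assms r by (intro mult_mono power_mono) auto
      also have "\<dots> = r ^ (n - 1)" using False i by (simp flip: power_add)
      finally have "real (n - i) * norm v * (norm x ^ i * norm x ^ (n - i - 1)) \<le> real (n - i) * norm v * r ^ (n - 1)"
        by (intro mult_left_mono) auto
      then show ?thesis by (simp add: norm_mult norm_power mult_ac)
    qed simp
    have "real n = real i + real (n - i)" using i by simp
    then have "norm (of_nat i * x ^ (i - 1) * v * cnj x ^ (n - i)
        + x ^ i * (of_nat (n - i) * cnj x ^ (n - i - 1) * cnj v)) \<le> real n * r ^ (n - 1) * norm v"
      using order_trans[OF norm_triangle_ineq add_mono[OF 1 2]] by (simp only: distrib_right)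
    then show "norm (cf y n i * (of_nat i * x ^ (i - 1) * v * cnj x ^ (n - i)
        + x ^ i * (of_nat (n - i) * cnj x ^ (n - i - 1) * cnj v)))
       \<le> norm (cf y n i) * (real n * r ^ (n - 1) * norm v)"
      unfolding norm_mult[of "cf y n i"] by (intro mult_left_mono) auto
  qed
  also have "\<dots> = l1 n (cf y n) * (real n * r ^ (n - 1) * norm v)"
    by (simp add: l1_def sum_distrib_right)
  also have "\<dots> \<le> norm y ^ n / fact n * (real n * r ^ (n - 1) * norm v)"
    using r by (intro mult_right_mono l1_cf) auto
  finally show ?thesis .
qed

text \<open>Obtained by differentiating \<open>ker_Suc\<close> along the rotation of
  \<open>x\<close>. A reflection reverses the sense of rotation, whence the plus sign before the
  sum.\<close>

lemma kang_Suc: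
  "(real (Suc n) + N) * kang y (Suc n) x + (\<Sum>j<2*k. kap (int j) * kang y (Suc n) (rfl (int j) x))
   = ((\<i> * x) \<bullet> y) * ker y n x + (x \<bullet> y) * kang y n x"
proof -
  have rot: "((\<lambda>s. z * cis s) has_vector_derivative \<i> * z) (at 0)" for z
    by (auto intro!: derivative_eq_intros simp: has_vector_derivative_def has_derivative_cis scaleR_conv_of_real mult_ac)
  have rot': "((\<lambda>s. z * cis (- s)) has_vector_derivative - (\<i> * z)) (at 0)" for z
    by (auto intro!: derivative_eq_intros simp: has_vector_derivative_def has_derivative_cis scaleR_conv_of_real mult_ac)
  have d: "((\<lambda>s. ker y m (z * cis s)) has_real_derivative kang y m z) (at 0)" for m z
    using ker_has_real_derivative[OF rot, of y m z] by (simp add: kang_def)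
  have d': "((\<lambda>s. ker y m (rfl j (z * cis s))) has_real_derivative - kang y m (rfl j z)) (at 0)" for m z j
  proof -
    have "rfl j (z * cis s) = rfl j z * cis (- s)" for s by (simp add: rfl_def cis_cnj mult_ac)
    then show ?thesis
      using ker_has_real_derivative[OF rot', of y m "rfl j z"] by (simp add: kang_def ddir_uminus)
  qed
  have "((\<lambda>s. (x * cis s) \<bullet> y) has_vector_derivative (\<i> * x) \<bullet> y) (at 0)"
    by (rule bounded_linear.has_vector_derivative[OF bounded_linear_inner_left rot])
  then have di: "((\<lambda>s. (x * cis s) \<bullet> y) has_real_derivative (\<i> * x) \<bullet> y) (at 0)"
    by (simp add: has_real_derivative_iff_has_vector_derivative)
  have "((\<lambda>s. (real (Suc n) + N) * ker y (Suc n) (x * cis s)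
       - (\<Sum>j<2*k. kap (int j) * ker y (Suc n) (rfl (int j) (x * cis s))))
      has_real_derivative ((real (Suc n) + N) * kang y (Suc n) x
       - (\<Sum>j<2*k. kap (int j) * - kang y (Suc n) (rfl (int j) x)))) (at 0)"
    by (intro DERIV_diff DERIV_cmult DERIV_sum d d')
  moreover have "((\<lambda>s. ((x * cis s) \<bullet> y) * ker y n (x * cis s)) has_real_derivative
      ((\<i> * x) \<bullet> y) * ker y n x + (x \<bullet> y) * kang y n x) (at 0)"
    using DERIV_mult[OF di d[of n x]] by (simp add: mult_ac add.commute)
  ultimately have "(real (Suc n) + N) * kang y (Suc n) x
       - (\<Sum>j<2*k. kap (int j) * - kang y (Suc n) (rfl (int j) x))
     = ((\<i> * x) \<bullet> y) * ker y n x + (x \<bullet> y) * kang y n x"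
    unfolding ker_Suc[unfolded Kop_def] by (rule DERIV_unique)
  then show ?thesis by (simp add: sum_negf)
qed

text \<open>Turns mirror \<open>j\<close> into the real axis, so that the inner product with the
  root becomes an imaginary part.\<close>

definition half :: "int \<Rightarrow> complex \<Rightarrow> complex" where
  "half j x = x * cis (- of_int j * pi / (2 * real k))"

text \<open>Cotangent of the angle from mirror \<open>j\<close> to \<open>x\<close>, the coefficient
  of reflection \<open>j\<close> in the Dunkl operator in the tangential direction
  \<open>\<i> * x\<close>.\<close>

definition cq :: "int \<Rightarrow> complex \<Rightarrow> real" where
  "cq j x = Re (half j x) / Im (half j x)"

lemma half_period: "half (j + 2 * int k) x = - half j x"
proof -
  have "- of_int (j + 2 * int k) * pi / (2 * real k) = - of_int j * pi / (2 * real k) + - pi"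
    using k_pos by (simp add: field_simps)
  then have "cis (- of_int (j + 2 * int k) * pi / (2 * real k)) = cis (- of_int j * pi / (2 * real k)) * cis (- pi)"
    by (simp only: cis_mult)
  moreover have "cis (- pi) = - 1" by (simp add: complex_eq_iff)
  ultimately show ?thesis by (simp add: half_def)
qed

lemma half_refl: "half j (rfl i x) = cnj (half (2 * i - j) x)"
proof -
  have "of_int i * pi / real k + - of_int j * pi / (2 * real k) = - (- of_int (2 * i - j) * pi / (2 * real k))"
    using k_pos by (simp add: field_simps)
  then have "cis (of_int i * pi / real k) * cis (- of_int j * pi / (2 * real k))
      = cis (- (- of_int (2 * i - j) * pi / (2 * real k)))"
    by (simp only: cis_mult)
  then show ?thesis by (simp add: half_def rfl_def om_def cis_cnj mult.assoc)
qed

lemma off_lines_iff: "off_lines x \<longleftrightarrow> (\<forall>j. Im (half j x) \<noteq> 0)"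
  by (simp add: off_lines_def half_def)

lemma off_lines_refl: "off_lines x \<Longrightarrow> off_lines (rfl i x)"
  by (simp add: off_lines_iff half_refl)

lemma cq_period: "cq (j + 2 * int k) x = cq j x"
  by (simp add: cq_def half_period)

lemma cq_refl: "cq j (rfl i x) = - cq (2 * i - j) x"
  by (simp add: cq_def half_refl)

text \<open>With the mirror as real axis this is
  \<open>(Re w / Im w) (w - cnj w) = \<i> (w + cnj w)\<close>. It removes the poles of the
  cotangents in \<open>Mop_inner\<close>.\<close>

lemma cq_mult_diff:
  assumes "off_lines x"
  shows "of_real (cq j x) * (x - rfl j x) = \<i> * rfl j x + \<i> * x"
proof -
  define e where "e = cis (of_int j * pi / (2 * real k))"
  have e: "cis (- of_int j * pi / (2 * real k)) * e = 1" "cnj e * om j = e"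
    using k_pos by (simp_all add: e_def om_def cis_mult cis_cnj field_simps)
  have x: "x = half j x * e" using e by (simp add: half_def mult.assoc)
  have r: "rfl j x = cnj (half j x) * e"
    using arg_cong[OF x, of cnj] e(2) by (simp add: rfl_def mult.assoc)
  have nz: "Im (half j x) \<noteq> 0" using assms by (simp add: off_lines_iff)
  define w where "w = half j x"
  have "of_real (cq j x) * (w - cnj w) = \<i> * cnj w + \<i> * w"
    using nz by (simp add: cq_def w_def complex_eq_iff)
  then have A: "of_real (cq j x) * (w - cnj w) * e = (\<i> * cnj w + \<i> * w) * e" by simp
  have B: "x - rfl j x = w * e - cnj w * e" "\<i> * rfl j x + \<i> * x = \<i> * (cnj w * e) + \<i> * (w * e)"
    by (simp_all only: r w_def x[symmetric])
  show ?thesis unfolding B using A by (simp only: algebra_simps)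
qed

text \<open>Difference part of the Dunkl operator in direction \<open>\<i> * x\<close>.\<close>

definition Mop :: "(complex \<Rightarrow> real) \<Rightarrow> complex \<Rightarrow> real" where
  "Mop f x = (\<Sum>j<2*k. kap (int j) * cq (int j) x * (f x - f (rfl (int j) x)))"

lemma Kop_Mop: "Kop (Mop f) x = - Mop (Kop f) x"
proof -
  have "Kop (Mop f) x = (\<Sum>i<2*k. kap (int i) *
      (\<Sum>j<2*k. - kap (int j) * cq (2 * int i - int j) x * (f (rfl (int i) x) - f (x * om (int j - int i)))))"
    by (simp add: Kop_def Mop_def cq_refl rfl_rfl)
  also have "\<dots> = (\<Sum>i<2*k. kap (int i) *
      (\<Sum>j<2*k. - kap (int j) * cq (int j) x * (f (rfl (int i) x) - f (x * om (int i - int j)))))"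
  proof (rule sum.cong[OF HOL.refl], rule arg_cong[where f="\<lambda>x. _ * x"])
    fix i :: nat
    define h where "h l = - kap l * cq (2 * int i - l) x * (f (rfl (int i) x) - f (x * om (l - int i)))" for l
    have per: "h (l + int (2*k)) = h l" for l
    proof -
      have "cq (2 * int i - (l + 2 * int k)) x = cq (2 * int i - l) x"
        using cq_period[of "2 * int i - (l + 2 * int k)" x] by simp
      moreover have "om (l + 2 * int k - int i) = om (l - int i)"
        using om_period[of "l - int i"] by (simp add: algebra_simps)
      ultimately show ?thesis by (simp add: h_def)
    qed
    have "(\<Sum>l<2*k. h (int l)) = (\<Sum>l<2*k. h (2 * int i - int l))"
      by (rule sum_periodic_reflect[symmetric]) (rule per)
    then show "(\<Sum>j<2*k. - kap (int j) * cq (2 * int i - int j) x * (f (rfl (int i) x) - f (x * om (int j - int i))))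
       = (\<Sum>j<2*k. - kap (int j) * cq (int j) x * (f (rfl (int i) x) - f (x * om (int i - int j))))"
      by (simp add: h_def)
  qed
  also have "\<dots> = (\<Sum>j<2*k. \<Sum>i<2*k.
       - (kap (int j) * cq (int j) x * (kap (int i) * f (rfl (int i) x) - kap (int i) * f (x * om (int i - int j)))))"
    unfolding sum_distrib_left by (subst sum.swap) (simp add: algebra_simps)
  also have "\<dots> = - Mop (Kop f) x"
    unfolding Mop_def Kop_def rfl_rfl sum_subtractf[symmetric] sum_distrib_left sum_negf[symmetric] ..
  finally show ?thesis .
qed

text \<open>A Leibniz rule: the increment of the inner product across each mirror absorbs the
  cotangent by \<open>cq_mult_diff\<close>, leaving a correction regular on the mirrors.\<close>

lemma Mop_inner:
  assumes "off_lines x"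
  shows "Mop (\<lambda>z. (z \<bullet> y) * f z) x = (x \<bullet> y) * Mop f x
    + (\<Sum>j<2*k. kap (int j) * (((\<i> * rfl (int j) x) \<bullet> y + (\<i> * x) \<bullet> y) * f (rfl (int j) x)))"
proof -
  have key: "cq j x * (x \<bullet> y - rfl j x \<bullet> y) = (\<i> * rfl j x) \<bullet> y + (\<i> * x) \<bullet> y" for j
  proof -
    have "(of_real (cq j x) * (x - rfl j x)) \<bullet> y = cq j x * ((x - rfl j x) \<bullet> y)"
      by (simp flip: scaleR_conv_of_real)
    then show ?thesis by (simp only: cq_mult_diff[OF assms] inner_add_left inner_diff_left)
  qed
  have "kap j * cq j x * ((x \<bullet> y) * f x - (rfl j x \<bullet> y) * f (rfl j x))
     = (x \<bullet> y) * (kap j * cq j x * (f x - f (rfl j x)))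
       + kap j * (((\<i> * rfl j x) \<bullet> y + (\<i> * x) \<bullet> y) * f (rfl j x))" for j
    unfolding key[symmetric] by (simp add: algebra_simps)
  then show ?thesis
    by (simp add: Mop_def sum.distrib sum_distrib_left)
qed

text \<open>Degree \<open>n\<close> part of the defect in the eigenvalue equation for direction
  \<open>\<i> * x\<close>; degree 0 has no predecessor.\<close>

definition Wang :: "complex \<Rightarrow> nat \<Rightarrow> complex \<Rightarrow> real" where
  "Wang y n x = kang y n x + Mop (ker y n) x - (if n = 0 then 0 else ((\<i> * x) \<bullet> y) * ker y (n - 1) x)"

lemma Wang_Suc:
  assumes x: "off_lines x"
  shows "(real (Suc n) + N) * Wang y (Suc n) x + Kop (Wang y (Suc n)) x = (x \<bullet> y) * Wang y n x"
proof -
  let ?s = "real (Suc n) + N"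
  have M: "?s * Mop (ker y (Suc n)) x + Kop (Mop (ker y (Suc n))) x = Mop (\<lambda>z. (z \<bullet> y) * ker y n z) x"
    unfolding Kop_Mop ker_Suc[symmetric]
    by (simp add: Mop_def algebra_simps sum_distrib_left sum_subtractf sum.distrib)
  have E: "(real n + N) * ker y n x - Kop (ker y n) x = (if n = 0 then 0 else (x \<bullet> y) * ker y (n - 1) x)"
    using ker_Suc[of "n - 1" y x] by (cases n) (simp_all add: Kop_def sum_kap)
  have "Kop (Wang y (Suc n)) x = (\<Sum>j<2*k. kap (int j) * kang y (Suc n) (rfl (int j) x))
      + Kop (Mop (ker y (Suc n))) x - (\<Sum>j<2*k. kap (int j) * (((\<i> * rfl (int j) x) \<bullet> y) * ker y n (rfl (int j) x)))"
    by (simp add: Kop_def Wang_def sum.distrib sum_subtractf algebra_simps)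
  then have "?s * Wang y (Suc n) x + Kop (Wang y (Suc n)) x =
      (?s * kang y (Suc n) x + (\<Sum>j<2*k. kap (int j) * kang y (Suc n) (rfl (int j) x)))
      + (?s * Mop (ker y (Suc n)) x + Kop (Mop (ker y (Suc n))) x)
      - ?s * (((\<i> * x) \<bullet> y) * ker y n x)
      - (\<Sum>j<2*k. kap (int j) * (((\<i> * rfl (int j) x) \<bullet> y) * ker y n (rfl (int j) x)))"
    by (simp add: Wang_def algebra_simps)
  also have "\<dots> = ((\<i> * x) \<bullet> y) * ker y n x + (x \<bullet> y) * kang y n x + (x \<bullet> y) * Mop (ker y n) x
      + ((\<Sum>j<2*k. kap (int j) * (((\<i> * rfl (int j) x) \<bullet> y + (\<i> * x) \<bullet> y) * ker y n (rfl (int j) x)))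
      - (\<Sum>j<2*k. kap (int j) * (((\<i> * rfl (int j) x) \<bullet> y) * ker y n (rfl (int j) x))))
      - ?s * (((\<i> * x) \<bullet> y) * ker y n x)"
    unfolding kang_Suc M Mop_inner[OF x] by simp
  \<comment> \<open>The terms with a reflected inner product cancel. What survives carries the
    factor \<open>(\<i> * x) \<bullet> y\<close>, and its cofactor is the radial equation one degree
    lower, stated in \<open>E\<close>.\<close>
  also have "((\<Sum>j<2*k. kap (int j) * (((\<i> * rfl (int j) x) \<bullet> y + (\<i> * x) \<bullet> y) * ker y n (rfl (int j) x)))
      - (\<Sum>j<2*k. kap (int j) * (((\<i> * rfl (int j) x) \<bullet> y) * ker y n (rfl (int j) x))))
      = ((\<i> * x) \<bullet> y) * Kop (ker y n) x"
    unfolding Kop_def sum_subtractf[symmetric] sum_distrib_left by (intro sum.cong) (simp_all add: algebra_simps)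
  also have "((\<i> * x) \<bullet> y) * ker y n x + (x \<bullet> y) * kang y n x + (x \<bullet> y) * Mop (ker y n) x
      + ((\<i> * x) \<bullet> y) * Kop (ker y n) x - ?s * (((\<i> * x) \<bullet> y) * ker y n x)
      = (x \<bullet> y) * (kang y n x + Mop (ker y n) x)
        - ((\<i> * x) \<bullet> y) * ((real n + N) * ker y n x - Kop (ker y n) x)"
    by (simp add: algebra_simps)
  also have "\<dots> = (x \<bullet> y) * Wang y n x"
    unfolding E by (simp add: Wang_def algebra_simps)
  finally show ?thesis .
qed

lemma Wang_eq_0: "off_lines x \<Longrightarrow> Wang y n x = 0"
proof (induction n arbitrary: x)
  case 0
  have "kang y 0 x = 0" by (simp add: kang_def ddir_def)
  then show ?case by (simp add: Wang_def Mop_def)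
next
  case (Suc n)
  show ?case
  proof (rule orbit_max_principle[where S = off_lines and s = "real (Suc n)"])
    fix z assume z: "off_lines z"
    have "(real (Suc n) + N) * Wang y (Suc n) z = - Kop (Wang y (Suc n)) z"
      using Wang_Suc[OF z, of n y] Suc.IH[OF z] by simp
    then show "\<bar>(real (Suc n) + N) * Wang y (Suc n) z\<bar> = \<bar>Kop (Wang y (Suc n)) z\<bar>" by simp
  qed (use Suc.prems off_lines_refl in auto)
qed

lemma kang_Mop: "off_lines x \<Longrightarrow>
    kang y n x + Mop (ker y n) x = (if n = 0 then 0 else ((\<i> * x) \<bullet> y) * ker y (n - 1) x)"
  using Wang_eq_0[of x y n] by (simp add: Wang_def)

subsection \<open>The kernel is a joint eigenfunction\<close>

definition Eker :: "complex \<Rightarrow> complex \<Rightarrow> real" where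
  "Eker y x = (\<Sum>n. ker y n x)"

lemma summable_ker: "summable (\<lambda>n. ker y n x)"
proof (rule summable_comparison_test')
  show "summable (\<lambda>n. (norm y * norm x) ^ n / fact n)"
    using summable_exp[of "norm y * norm x"] by (simp add: field_simps)
  show "norm (ker y n x) \<le> (norm y * norm x) ^ n / fact n" for n using abs_ker by simp
qed

lemma ker_sums: "(\<lambda>n. ker y n x) sums Eker y x"
  unfolding Eker_def by (rule summable_sums[OF summable_ker])

lemma Eker_0: "Eker y 0 = 1"
proof -
  have "ker y (Suc n) 0 = 0" for n using abs_ker[of y "Suc n" 0] by simp
  then have "(\<lambda>n. ker y n 0) sums (\<Sum>n\<in>{0}. ker y n 0)"
    by (intro sums_finite) (auto simp: gr0_conv_Suc)
  then show ?thesis using ker_sums sums_unique2 by fastforce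
qed

lemma Eker_directional:
  "summable (\<lambda>n. Re (ddir y n x v))"
  "((\<lambda>t. Eker y (x + of_real t * v)) has_real_derivative (\<Sum>n. Re (ddir y n x v))) (at 0)"
proof -
  \<comment> \<open>Bounds the segment \<open>x + t v\<close> for \<open>|t| \<le> 1\<close>, on
    which the series of derivatives passes the Weierstrass test.\<close>
  define r where "r = norm x + norm v"
  have g: "((\<lambda>t. x + of_real t * v) has_vector_derivative v) (at t)" for t
    by (auto intro!: derivative_eq_intros)
  have bd: "norm (Re (ddir y n (x + of_real t * v) v)) \<le> norm y ^ n / fact n * (real n * r ^ (n - 1) * norm v)"
    if "t \<in> {-1..1}" for n t
  proof -
    have "norm (x + of_real t * v) \<le> norm x + \<bar>t\<bar> * norm v"
      using norm_triangle_ineq[of x "of_real t * v"] by (simp add: norm_mult)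
    also have "\<dots> \<le> r" unfolding r_def using that by (intro add_left_mono mult_left_le_one_le) auto
    finally show ?thesis using norm_ddir abs_Re_le_cmod order_trans unfolding real_norm_def by blast
  qed
  have "summable (\<lambda>n. norm y * norm v * ((norm y * r) ^ n / fact n))"
    using summable_exp[of "norm y * r"] by (intro summable_mult) (simp add: field_simps)
  then have "summable (\<lambda>n. norm y ^ Suc n / fact (Suc n) * (real (Suc n) * r ^ (Suc n - 1) * norm v))"
  proof (rule back_subst[of summable], intro ext)
    fix n
    have "real (Suc n) / fact (Suc n) = 1 / (fact n :: real)" by (simp add: divide_simps)
    then have "norm y ^ Suc n * r ^ n * norm v * (real (Suc n) / fact (Suc n))
        = norm y ^ Suc n * r ^ n * norm v * (1 / fact n)" by (simp only:)
    then show "norm y * norm v * ((norm y * r) ^ n / fact n)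
        = norm y ^ Suc n / fact (Suc n) * (real (Suc n) * r ^ (Suc n - 1) * norm v)"
      by (simp only: power_mult_distrib) (simp add: mult_ac del: fact_Suc of_nat_Suc)
  qed
  then have sm: "summable (\<lambda>n. norm y ^ n / fact n * (real n * r ^ (n - 1) * norm v))"
    by (subst (asm) summable_Suc_iff)
  show "summable (\<lambda>n. Re (ddir y n x v))"
    using bd[of 0] by (intro summable_comparison_test'[OF sm, of 0]) auto
  have "((\<lambda>t. \<Sum>n. ker y n (x + of_real t * v)) has_field_derivative
      (\<Sum>n. Re (ddir y n (x + of_real 0 * v) v))) (at 0)"
  proof (rule has_field_derivative_series'(2))
    show "convex {-1..1::real}" by simp
    show "((\<lambda>t. ker y n (x + of_real t * v)) has_field_derivative Re (ddir y n (x + of_real t * v) v)) (at t within {-1..1})"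
      for n t using ker_has_real_derivative[OF g] by (rule has_field_derivative_at_within)
    show "uniformly_convergent_on {-1..1} (\<lambda>n t. \<Sum>i<n. Re (ddir y i (x + of_real t * v) v))"
      using bd by (intro Weierstrass_m_test'[OF _ sm])
    show "(0::real) \<in> {-1..1}" "(0::real) \<in> interior {-1..1}" by auto
    show "summable (\<lambda>n. ker y n (x + of_real 0 * v))" by (rule summable_ker)
  qed
  then show "((\<lambda>t. Eker y (x + of_real t * v)) has_real_derivative (\<Sum>n. Re (ddir y n x v))) (at 0)"
    by (simp add: Eker_def)
qed

lemma dih_root_inner: "dih_root k j \<bullet> x = Im (half (int j) x)"
  by (simp add: dih_root_def half_def inner_complex_def)

lemma dih_root_inner_polar:
  "dih_root k j \<bullet> (of_real \<alpha> * x + of_real \<beta> * (\<i> * x)) = \<alpha> * Im (half (int j) x) + \<beta> * Re (half (int j) x)"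
  unfolding dih_root_inner half_def by (simp add: algebra_simps)

lemma off_linesI:
  assumes "\<forall>j<2*k. dih_root k j \<bullet> x \<noteq> 0"
  shows "off_lines x"
  unfolding off_lines_iff
proof
  fix j :: int
  define r where "r = j mod (2 * int k)"
  have shift: "Im (half (i + 2 * int k * q) x) = 0 \<longleftrightarrow> Im (half i x) = 0" for i q
  proof (induction q rule: int_induct[where k=0])
    case base show ?case by simp
  next
    case (step1 q)
    have "i + 2 * int k * (q + 1) = i + 2 * int k * q + 2 * int k" by (simp add: algebra_simps)
    then show ?case using step1 by (simp only: half_period) simp
  next
    case (step2 q)
    have "i + 2 * int k * q = i + 2 * int k * (q - 1) + 2 * int k" by (simp add: algebra_simps)
    then have "half (i + 2 * int k * q) x = - half (i + 2 * int k * (q - 1)) x" by (simp only: half_period)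
    then show ?case using step2 by simp
  qed
  have r: "0 \<le> r" "r < 2 * int k" using k_pos by (auto simp: r_def)
  have "j = r + 2 * int k * (j div (2 * int k))" by (simp add: r_def)
  then have "Im (half j x) = 0 \<longleftrightarrow> Im (half r x) = 0" using shift by metis
  moreover have "Im (half r x) \<noteq> 0"
    using assms[rule_format, of "nat r"] r by (simp add: dih_root_inner)
  ultimately show "Im (half j x) \<noteq> 0" by simp
qed

lemma dih_refl_eq: "dih_refl k j x = rfl (int j) x"
  by (simp add: dih_refl_def rfl_def om_def)

lemma mult_kappa_eq: "mult_kappa a b j = kap (int j)"
  by (simp add: mult_kappa_def kap_def)

text \<open>Off the origin \<open>x\<close> and \<open>\<i> * x\<close> form a real basis, in which
  \<open>\<alpha>\<close> and \<open>\<beta>\<close> are the coordinates of \<open>\<xi>\<close>. In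
  each degree the first contributes \<open>ker_Suc\<close>, the second \<open>kang_Mop\<close>;
  summation over degrees shifts the index by one.\<close>

lemma dunkl_op_Eker:
  assumes x: "off_lines x"
  shows "dunkl_op k a b \<xi> (Eker y) x = (\<xi> \<bullet> y) * Eker y x"
proof -
  have "x \<noteq> 0" using x by (auto simp: off_lines_def)
  define \<alpha> where "\<alpha> = Re (\<xi> / x)"
  define \<beta> where "\<beta> = Im (\<xi> / x)"
  have "\<xi> / x = of_real \<alpha> + of_real \<beta> * \<i>" by (simp add: \<alpha>_def \<beta>_def complex_eq_iff)
  then have xi: "\<xi> = of_real \<alpha> * x + of_real \<beta> * (\<i> * x)"
    using \<open>x \<noteq> 0\<close> by (simp add: field_simps)
  have nz: "Im (half j x) \<noteq> 0" for j using x by (simp add: off_lines_iff)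
  have d: "(\<lambda>n. Re (ddir y n x \<xi>)) sums deriv (\<lambda>t. Eker y (x + of_real t * \<xi>)) 0"
    using Eker_directional[of y x \<xi>] by (simp add: DERIV_imp_deriv summable_sums)
  have t: "kap (int j) * (dih_root k j \<bullet> \<xi>) * D / (dih_root k j \<bullet> x)
     = kap (int j) * (\<alpha> + \<beta> * cq (int j) x) * D" for j D
    unfolding xi dih_root_inner_polar unfolding dih_root_inner cq_def using nz[of "int j"]
    by (simp add: field_simps)
  have "(\<lambda>n. Re (ddir y n x \<xi>) + (\<Sum>j<2*k. kap (int j) * (\<alpha> + \<beta> * cq (int j) x)
         * (ker y n x - ker y n (rfl (int j) x)))) sums dunkl_op k a b \<xi> (Eker y) x"
    unfolding dunkl_op_def t mult_kappa_eq dih_refl_eq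
    by (intro sums_add d sums_sum sums_mult sums_diff ker_sums)
  moreover have "Re (ddir y n x \<xi>) + (\<Sum>j<2*k. kap (int j) * (\<alpha> + \<beta> * cq (int j) x)
         * (ker y n x - ker y n (rfl (int j) x))) = (if n = 0 then 0 else (\<xi> \<bullet> y) * ker y (n - 1) x)" for n
  proof -
    have S: "(\<Sum>j<2*k. kap (int j) * (\<alpha> + \<beta> * cq (int j) x) * (ker y n x - ker y n (rfl (int j) x)))
      = \<alpha> * (N * ker y n x - Kop (ker y n) x) + \<beta> * Mop (ker y n) x"
      unfolding Kop_def Mop_def sum_kap[symmetric] sum_distrib_left sum_distrib_right
           sum_subtractf[symmetric] sum.distrib[symmetric]
      by (intro sum.cong) (simp_all add: algebra_simps)
    have R: "(real n + N) * ker y n x - Kop (ker y n) x = (if n = 0 then 0 else (x \<bullet> y) * ker y (n - 1) x)"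
      using ker_Suc[of "n - 1" y x] by (cases n) (simp_all add: Kop_def sum_kap)
    have "Re (ddir y n x \<xi>) + (\<Sum>j<2*k. kap (int j) * (\<alpha> + \<beta> * cq (int j) x)
         * (ker y n x - ker y n (rfl (int j) x)))
       = \<alpha> * (if n = 0 then 0 else (x \<bullet> y) * ker y (n - 1) x)
        + \<beta> * (if n = 0 then 0 else ((\<i> * x) \<bullet> y) * ker y (n - 1) x)"
      unfolding S kang_Mop[OF x, symmetric] R[symmetric] unfolding xi Re_ddir_polar
      by (simp only: algebra_simps)
    also have "\<dots> = (if n = 0 then 0 else (\<xi> \<bullet> y) * ker y (n - 1) x)"
    proof -
      have "\<xi> \<bullet> y = \<alpha> * (x \<bullet> y) + \<beta> * ((\<i> * x) \<bullet> y)"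
        unfolding xi by (simp add: inner_complex_def algebra_simps)
      then show ?thesis by (simp add: algebra_simps)
    qed
    finally show ?thesis .
  qed
  ultimately have "(\<lambda>n. if n = 0 then 0 else (\<xi> \<bullet> y) * ker y (n - 1) x) sums dunkl_op k a b \<xi> (Eker y) x"
    by simp
  then have "(\<lambda>n. (\<xi> \<bullet> y) * ker y n x) sums dunkl_op k a b \<xi> (Eker y) x"
    using sums_Suc_iff[of "\<lambda>n. if n = 0 then 0 else (\<xi> \<bullet> y) * ker y (n - 1) x"] by simp
  moreover have "(\<lambda>n. (\<xi> \<bullet> y) * ker y n x) sums ((\<xi> \<bullet> y) * Eker y x)"
    by (intro sums_mult ker_sums)
  ultimately show ?thesis by (rule sums_unique2)
qed

end

subsection \<open>Entire power series in two real variables\<close>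

lemma bij_betw_diagonals:
  "bij_betw (\<lambda>(n, i). (i, n - i)) (SIGMA n:UNIV. {..n}) (UNIV :: (nat \<times> nat) set)"
  by (rule bij_betwI[where g = "\<lambda>(i, j). (i + j, i)"]) auto

text \<open>\<open>norm x\<close> dominates both coordinates, so the coefficient norms give absolute
  summability over the diagonals, and the graded series may be rearranged into the double
  series.\<close>

lemma entire_psI:
  fixes d :: "nat \<Rightarrow> nat \<Rightarrow> complex"
  assumes summ: "\<And>r. 0 \<le> r \<Longrightarrow> summable (\<lambda>n. l1 n (d n) * r ^ n)"
    and f: "\<And>x. (\<lambda>n. Re (bform n (d n) (of_real (Re x)) (of_real (Im x)))) sums f x"
  shows "entire_ps f"
  unfolding entire_ps_def
proof (intro exI[of _ "\<lambda>(i, j). Re (d (i + j) i)"] allI)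
  fix x :: complex
  define s where "s = Re x"
  define t where "t = Im x"
  define c where "c = (\<lambda>(i, j). Re (d (i + j) i))"
  define r where "r = norm x"
  have st: "\<bar>s\<bar> \<le> r" "\<bar>t\<bar> \<le> r" by (auto simp: s_def t_def r_def abs_Re_le_cmod abs_Im_le_cmod)
  let ?h = "\<lambda>(n, i). \<bar>Re (d n i)\<bar> * \<bar>s\<bar> ^ i * \<bar>t\<bar> ^ (n - i)"
  let ?g = "\<lambda>(n, i). Re (d n i) * s ^ i * t ^ (n - i)"
  have ab: "?h summable_on (SIGMA n:UNIV. {..n})"
  proof (rule summable_on_SigmaI)
    show "((\<lambda>i. ?h (n, i)) has_sum (\<Sum>i\<le>n. \<bar>Re (d n i)\<bar> * \<bar>s\<bar> ^ i * \<bar>t\<bar> ^ (n - i))) {..n}" for n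
      by (rule has_sum_finiteI) auto
    have "(\<Sum>i\<le>n. \<bar>Re (d n i)\<bar> * \<bar>s\<bar> ^ i * \<bar>t\<bar> ^ (n - i)) \<le> l1 n (d n) * r ^ n" for n
      unfolding l1_def sum_distrib_right
    proof (rule sum_mono)
      fix i assume i: "i \<in> {..n}"
      have "\<bar>s\<bar> ^ i * \<bar>t\<bar> ^ (n - i) \<le> r ^ i * r ^ (n - i)"
        using st by (intro mult_mono power_mono) (auto simp: r_def)
      also have "\<dots> = r ^ n" using i by (simp flip: power_add)
      finally have "\<bar>s\<bar> ^ i * \<bar>t\<bar> ^ (n - i) \<le> r ^ n" .
      then show "\<bar>Re (d n i)\<bar> * \<bar>s\<bar> ^ i * \<bar>t\<bar> ^ (n - i) \<le> norm (d n i) * r ^ n"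
        unfolding mult.assoc by (intro mult_mono abs_Re_le_cmod) (auto simp: r_def)
    qed
    then have "summable (\<lambda>n. norm (\<Sum>i\<le>n. \<bar>Re (d n i)\<bar> * \<bar>s\<bar> ^ i * \<bar>t\<bar> ^ (n - i)))"
      by (intro summable_comparison_test'[OF summ[of r], of 0]) (auto simp: r_def abs_of_nonneg sum_nonneg)
    then show "(\<lambda>n. \<Sum>i\<le>n. \<bar>Re (d n i)\<bar> * \<bar>s\<bar> ^ i * \<bar>t\<bar> ^ (n - i)) summable_on UNIV"
      by (rule norm_summable_imp_summable_on)
  qed auto
  have gs: "?g summable_on (SIGMA n:UNIV. {..n})"
  proof (rule abs_summable_summable)
    show "(\<lambda>p. norm (?g p)) summable_on (SIGMA n:UNIV. {..n})"
      using ab by (rule summable_on_cong[THEN iffD1, rotated]) (auto simp: abs_mult power_abs)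
  qed
  have re: "Re (bform n (d n) (of_real s) (of_real t)) = (\<Sum>i\<le>n. Re (d n i) * s ^ i * t ^ (n - i))" for n
    by (simp add: bform_def flip: of_real_power)
  have "(?g has_sum f x) (SIGMA n:UNIV. {..n})"
  proof (rule has_sum_SigmaI[OF _ _ gs])
    show inner: "((\<lambda>i. ?g (n, i)) has_sum (\<Sum>i\<le>n. Re (d n i) * s ^ i * t ^ (n - i))) {..n}" for n
      by (rule has_sum_finiteI) auto
    have "(\<lambda>n. \<Sum>\<^sub>\<infinity>i\<in>{..n}. ?g (n, i)) summable_on UNIV"
      using gs by (rule summable_on_Sigma_banach[of "\<lambda>n i. ?g (n, i)", simplified case_prod_eta])
    then have "(\<lambda>n. \<Sum>i\<le>n. Re (d n i) * s ^ i * t ^ (n - i)) summable_on UNIV"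
      using infsumI[OF inner] by simp
    then have "((\<lambda>n. \<Sum>i\<le>n. Re (d n i) * s ^ i * t ^ (n - i)) has_sum
       (\<Sum>\<^sub>\<infinity>n. \<Sum>i\<le>n. Re (d n i) * s ^ i * t ^ (n - i))) UNIV" by (rule has_sum_infsum)
    moreover from has_sum_imp_sums[OF this]
    have "(\<Sum>\<^sub>\<infinity>n. \<Sum>i\<le>n. Re (d n i) * s ^ i * t ^ (n - i)) = f x"
      using f[of x] unfolding s_def[symmetric] t_def[symmetric] re by (rule sums_unique2)
    ultimately show "((\<lambda>n. \<Sum>i\<le>n. Re (d n i) * s ^ i * t ^ (n - i)) has_sum f x) UNIV" by simp
  qed
  then have "((\<lambda>p. (\<lambda>(i, j). c (i, j) * s ^ i * t ^ j) ((\<lambda>(n, i). (i, n - i)) p)) has_sum f x)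
      (SIGMA n:UNIV. {..n})"
    by (rule has_sum_cong[THEN iffD1, rotated]) (auto simp: c_def)
  then have 1: "((\<lambda>(i, j). c (i, j) * s ^ i * t ^ j) has_sum f x) UNIV"
    using has_sum_reindex_bij_betw[OF bij_betw_diagonals] by blast
  have "(\<lambda>p. (\<lambda>(i, j). \<bar>c (i, j)\<bar> * \<bar>s\<bar> ^ i * \<bar>t\<bar> ^ j) ((\<lambda>(n, i). (i, n - i)) p)) summable_on
      (SIGMA n:UNIV. {..n})"
    using ab by (rule summable_on_cong[THEN iffD1, rotated]) (auto simp: c_def)
  then have 2: "(\<lambda>(i, j). \<bar>c (i, j)\<bar> * \<bar>s\<bar> ^ i * \<bar>t\<bar> ^ j) summable_on UNIV"
    using summable_on_reindex_bij_betw[OF bij_betw_diagonals] by blast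
  show "((\<lambda>(m, n). (case (m, n) of (i, j) \<Rightarrow> Re (d (i + j) i)) * Re x ^ m * Im x ^ n) has_sum f x) UNIV \<and>
     (\<lambda>(m, n). \<bar>case (m, n) of (i, j) \<Rightarrow> Re (d (i + j) i)\<bar> * \<bar>Re x\<bar> ^ m * \<bar>Im x\<bar> ^ n) summable_on UNIV"
    using 1 2 by (simp add: c_def s_def t_def)
qed

text \<open>Lets two candidates for the kernel be compared degree by degree: the diagonals of the
  double series are its homogeneous components.\<close>

lemma entire_psD:
  assumes "entire_ps f"
  obtains q :: "nat \<Rightarrow> complex \<Rightarrow> real"
  where "\<And>n. continuous_on UNIV (q n)"
    and "\<And>n t x. q n (of_real t * x) = t ^ n * q n x"
    and "\<And>x. (\<lambda>n. q n x) sums f x"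
proof -
  from assms obtain c :: "nat \<times> nat \<Rightarrow> real" where
    c: "\<And>x. ((\<lambda>(m,n). c (m,n) * Re x ^ m * Im x ^ n) has_sum f x) UNIV"
    unfolding entire_ps_def by blast
  define q where "q n x = (\<Sum>i\<le>n. c (i, n - i) * Re x ^ i * Im x ^ (n - i))" for n x
  show thesis
  proof (rule that[of q])
    show "continuous_on UNIV (q n)" for n
      unfolding q_def by (intro continuous_intros)
    show "q n (of_real t * x) = t ^ n * q n x" for n t x
    proof -
      have "c (i, n - i) * (t * Re x) ^ i * (t * Im x) ^ (n - i) = t ^ n * (c (i, n - i) * Re x ^ i * Im x ^ (n - i))"
        if "i \<le> n" for i
      proof -
        have "t ^ n = t ^ i * t ^ (n - i)" using that by (simp flip: power_add)
        then show ?thesis by (simp add: power_mult_distrib)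
      qed
      then show ?thesis unfolding q_def sum_distrib_left by (intro sum.cong) auto
    qed
    fix x
    have "((\<lambda>p. (\<lambda>(i, j). c (i, j) * Re x ^ i * Im x ^ j) ((\<lambda>(n, i). (i, n - i)) p)) has_sum f x)
        (SIGMA n:UNIV. {..n})"
      using has_sum_reindex_bij_betw[OF bij_betw_diagonals] c[of x] by blast
    then have "((\<lambda>n. q n x) has_sum f x) UNIV"
      by (rule has_sum_SigmaD) (auto intro!: has_sum_finiteI simp: q_def)
    then show "(\<lambda>n. q n x) sums f x" by (rule has_sum_imp_sums)
  qed
qed

text \<open>The hypothesis omits \<open>t = 0\<close> because the eigenvalue equation on the ray
  through \<open>x\<close> is available only off the mirrors, all of which contain the
  origin.\<close>

lemma powser_eq_0_coeff:
  fixes c :: "nat \<Rightarrow> real"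
  assumes "\<And>t. t \<noteq> 0 \<Longrightarrow> (\<lambda>n. c n * t ^ n) sums 0"
  shows "c n = 0"
proof (induction n rule: less_induct)
  case (less m)
  have "(\<lambda>n. c (n + m) * t ^ n) sums 0" if "t \<noteq> 0" for t
  proof -
    have "(\<lambda>n. c (n + m) * t ^ (n + m)) sums (0 - (\<Sum>i<m. c i * t ^ i))"
      using assms[OF that] by (rule sums_split_initial_segment)
    then have "(\<lambda>n. c (n + m) * t ^ (n + m)) sums 0" using less by simp
    from sums_mult[OF this, of "1 / t ^ m"] show ?thesis
      using that by (simp add: power_add)
  qed
  then have "((\<lambda>_. 0) \<longlongrightarrow> c (0 + m)) (at (0::real))"
    by (intro powser_limit_0_strong[of 1 "\<lambda>n. c (n + m)"]) auto
  then show ?case by (simp add: tendsto_const_iff)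
qed

lemma monomial_cartesian:
  "\<exists>e. (\<forall>u v. (u + \<i> * v) ^ m * (u - \<i> * v) ^ l = bform (m + l) e u v) \<and> l1 (m + l) e \<le> 2 ^ (m + l)"
proof (induction m)
  case 0
  show ?case
  proof (induction l)
    case 0 show ?case by (rule exI[of _ "\<lambda>_. 1"]) (simp add: bform_def l1_def)
  next
    case (Suc l)
    then obtain e where e: "\<And>u v. (u - \<i> * v) ^ l = bform l e u v" "l1 l e \<le> 2 ^ l" by auto
    have "l1 (Suc l) (mul_lin 1 (- \<i>) l e) \<le> 2 ^ Suc l"
      using l1_mul_lin[of l 1 "- \<i>" e] e(2) by simp
    moreover have "(u - \<i> * v) ^ Suc l = bform (Suc l) (mul_lin 1 (- \<i>) l e) u v" for u v
      by (simp add: bform_mul_lin e(1))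
    ultimately show ?case by auto
  qed
next
  case (Suc m)
  then obtain e where e: "\<And>u v. (u + \<i> * v) ^ m * (u - \<i> * v) ^ l = bform (m + l) e u v" "l1 (m + l) e \<le> 2 ^ (m + l)" by auto
  have "l1 (Suc (m + l)) (mul_lin 1 \<i> (m + l) e) \<le> 2 ^ Suc (m + l)"
    using l1_mul_lin[of "m + l" 1 "\<i>" e] e(2) by simp
  moreover have "(u + \<i> * v) ^ Suc m * (u - \<i> * v) ^ l = bform (Suc (m + l)) (mul_lin 1 \<i> (m + l) e) u v" for u v
    by (simp add: bform_mul_lin e(1)[symmetric] mult.assoc)
  ultimately show ?case by auto
qed

text \<open>Each factor \<open>u + \<i> v\<close> or \<open>u - \<i> v\<close> has coefficient norm
  2. The resulting \<open>2 ^ n\<close> is absorbed by the factorial in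
  \<open>l1_cf\<close>.\<close>

lemma bform_cartesian:
  "\<exists>d. (\<forall>u v. bform n c (u + \<i> * v) (u - \<i> * v) = bform n d u v) \<and> l1 n d \<le> 2 ^ n * l1 n c"
proof -
  have "\<exists>e. (\<forall>u v. (u + \<i> * v) ^ i * (u - \<i> * v) ^ (n - i) = bform n e u v) \<and> l1 n e \<le> 2 ^ n" if "i \<le> n" for i
    using monomial_cartesian[of i "n - i"] that by simp
  then obtain e where e: "\<And>i u v. i \<le> n \<Longrightarrow> (u + \<i> * v) ^ i * (u - \<i> * v) ^ (n - i) = bform n (e i) u v"
    "\<And>i. i \<le> n \<Longrightarrow> l1 n (e i) \<le> 2 ^ n" by metis
  define d where "d j = (\<Sum>i\<le>n. c i * e i j)" for j
  have "bform n c (u + \<i> * v) (u - \<i> * v) = bform n d u v" for u v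
    unfolding d_def bform_sum bform_smult unfolding bform_def[of n c]
    by (intro sum.cong) (auto simp: e(1)[symmetric] mult.assoc)
  moreover have "l1 n d \<le> 2 ^ n * l1 n c"
  proof -
    have "l1 n d \<le> (\<Sum>j\<le>n. \<Sum>i\<le>n. norm (c i) * norm (e i j))"
      unfolding l1_def d_def by (intro sum_mono order_trans[OF norm_sum]) (simp add: norm_mult)
    also have "\<dots> = (\<Sum>i\<le>n. norm (c i) * l1 n (e i))"
      unfolding l1_def sum_distrib_left by (rule sum.swap)
    also have "\<dots> \<le> (\<Sum>i\<le>n. norm (c i) * 2 ^ n)"
      by (intro sum_mono mult_left_mono e(2)) auto
    finally show ?thesis by (simp add: l1_def sum_distrib_left mult.commute)
  qed
  ultimately show ?thesis by blast
qed

context dihedral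
begin

lemma entire_Eker: "entire_ps (Eker y)"
proof -
  have "\<forall>n. \<exists>d. (\<forall>u v. bform n (cf y n) (u + \<i> * v) (u - \<i> * v) = bform n d u v) \<and> l1 n d \<le> 2 ^ n * l1 n (cf y n)"
    using bform_cartesian by blast
  then obtain d where d: "\<And>n u v. bform n (cf y n) (u + \<i> * v) (u - \<i> * v) = bform n (d n) u v"
    "\<And>n. l1 n (d n) \<le> 2 ^ n * l1 n (cf y n)" by metis
  show ?thesis
  proof (rule entire_psI)
    fix r :: real assume r: "0 \<le> r"
    have S: "summable (\<lambda>n. (2 * norm y * r) ^ n / fact n)"
      using summable_exp[of "2 * norm y * r"] by (simp add: field_simps)
    have le: "l1 n (d n) * r ^ n \<le> (2 * norm y * r) ^ n / fact n" for n
    proof -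
      have "l1 n (d n) * r ^ n \<le> (2 ^ n * (norm y ^ n / fact n)) * r ^ n"
        using r by (intro mult_right_mono order_trans[OF d(2)] mult_left_mono l1_cf) auto
      then show ?thesis by (simp add: power_mult_distrib)
    qed
    have "norm (l1 n (d n) * r ^ n) \<le> (2 * norm y * r) ^ n / fact n" for n
      using le[of n] r l1_nonneg[of n "d n"] by (simp only: real_norm_def abs_mult abs_of_nonneg zero_le_power)
    then show "summable (\<lambda>n. l1 n (d n) * r ^ n)"
      by (rule summable_comparison_test'[OF S])
  next
    fix x :: complex
    have x: "of_real (Re x) + \<i> * of_real (Im x) = x" "of_real (Re x) - \<i> * of_real (Im x) = cnj x"
      by (simp_all add: complex_eq_iff)
    have "cker y n x = bform n (d n) (of_real (Re x)) (of_real (Im x))" for n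
      by (simp only: cker_def d(1)[symmetric] x)
    then show "(\<lambda>n. Re (bform n (d n) (of_real (Re x)) (of_real (Im x)))) sums Eker y x"
      using ker_sums[of y x] by (simp add: ker_def)
  qed
qed

lemma is_dunkl_kernel_Eker: "is_dunkl_kernel k a b y (Eker y)"
  unfolding is_dunkl_kernel_def using entire_Eker Eker_0 dunkl_op_Eker off_linesI by blast

subsection \<open>Uniqueness of the kernel\<close>

lemma recursion_unique:
  fixes u v :: "nat \<Rightarrow> complex \<Rightarrow> real"
  assumes inv: "\<And>z j. S z \<Longrightarrow> S (rfl j z)"
    and 0: "\<And>z. S z \<Longrightarrow> u 0 z = v 0 z"
    and u: "\<And>n z. S z \<Longrightarrow> (real (Suc n) + N) * u (Suc n) z - Kop (u (Suc n)) z = (z \<bullet> y) * u n z"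
    and v: "\<And>n z. S z \<Longrightarrow> (real (Suc n) + N) * v (Suc n) z - Kop (v (Suc n)) z = (z \<bullet> y) * v n z"
  shows "S x \<Longrightarrow> u n x = v n x"
proof (induction n arbitrary: x)
  case 0 then show ?case using assms by simp
next
  case (Suc n)
  define W where "W z = u (Suc n) z - v (Suc n) z" for z
  have "W x = 0"
  proof (rule orbit_max_principle[where S = S and s = "real (Suc n)"])
    fix z assume z: "S z"
    have "Kop W z = Kop (u (Suc n)) z - Kop (v (Suc n)) z"
      by (simp add: Kop_def W_def sum_subtractf algebra_simps)
    then have "(real (Suc n) + N) * W z = Kop W z"
      using u[OF z, of n] v[OF z, of n] Suc.IH[OF z] by (simp add: W_def algebra_simps)
    then show "\<bar>(real (Suc n) + N) * W z\<bar> = \<bar>Kop W z\<bar>" by simp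
  qed (use Suc.prems inv in auto)
  then show ?case by (simp add: W_def)
qed

lemma off_lines_scale: "off_lines x \<Longrightarrow> t \<noteq> 0 \<Longrightarrow> off_lines (of_real t * x)"
  by (simp add: off_lines_def mult.assoc)

text \<open>The equation is tested at \<open>t x\<close> in the direction \<open>t x\<close> itself.
  Both sides are power series in \<open>t\<close>, and comparing coefficients yields the radial
  recursion.\<close>

lemma kernel_components:
  assumes f: "is_dunkl_kernel k a b y f"
    and hom: "\<And>n t x. q n (of_real t * x) = t ^ n * q n x"
    and sums: "\<And>x. (\<lambda>n. q n x) sums f x"
    and x: "off_lines x"
  shows "q 0 x = 1"
    and "(real (Suc n) + N) * q (Suc n) x - Kop (q (Suc n)) x = (x \<bullet> y) * q n x"
proof -
  have ps: "(\<lambda>n. q n z * t ^ n) sums f (of_real t * z)" for z and t :: real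
    using sums[of "of_real t * z"] unfolding hom by (simp only: mult.commute)
  have "f 0 = 1" using f by (simp add: is_dunkl_kernel_def)
  moreover have "q 0 x = f 0"
    using ps[of x 0] by (simp only: powser_sums_zero_iff of_real_0 mult_zero_left)
  ultimately show "q 0 x = 1" by simp
  define D where "D n = (real n + N) * q n x - Kop (q n) x - (if n = 0 then 0 else (x \<bullet> y) * q (n - 1) x)" for n
  have D: "(\<lambda>n. D n * t ^ n) sums 0" if t: "t \<noteq> 0" for t :: real
  proof -
    have deriv: "((\<lambda>t. f (of_real t * x)) has_real_derivative (\<Sum>n. diffs (\<lambda>n. q n x) n * t ^ n)) (at t)"
    proof -
      have "((\<lambda>t. \<Sum>n. q n x * t ^ n) has_real_derivative (\<Sum>n. diffs (\<lambda>n. q n x) n * t ^ n)) (at t)"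
        using sums_summable[OF ps[of x "\<bar>t\<bar> + 1"]] by (rule termdiffs_strong) auto
      moreover have "(\<Sum>n. q n x * t ^ n) = f (of_real t * x)" for t
        using ps[of x t] by (simp add: sums_iff)
      ultimately show ?thesis by simp
    qed
    have ds: "summable (\<lambda>n. diffs (\<lambda>n. q n x) n * t ^ n)"
      by (rule termdiff_converges_all) (rule sums_summable[OF ps])
    have 1: "(\<lambda>n. real n * q n x * t ^ n) sums (t * (\<Sum>n. diffs (\<lambda>n. q n x) n * t ^ n))"
    proof -
      have "(\<lambda>n. t * (diffs (\<lambda>n. q n x) n * t ^ n)) sums (t * (\<Sum>n. diffs (\<lambda>n. q n x) n * t ^ n))"
        by (intro sums_mult summable_sums ds)
      then have "(\<lambda>n. real (Suc n) * q (Suc n) x * t ^ (Suc n)) sums (t * (\<Sum>n. diffs (\<lambda>n. q n x) n * t ^ n))"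
        by (simp add: diffs_def mult_ac)
      then show ?thesis using sums_Suc_iff[of "\<lambda>n. real n * q n x * t ^ n"] by simp
    qed
    have "((\<lambda>s. f (of_real (t + s * t) * x)) has_real_derivative (\<Sum>n. diffs (\<lambda>n. q n x) n * t ^ n) * t) (at 0)"
    proof -
      have "((\<lambda>s. t + s * t) has_real_derivative t) (at 0)" by (auto intro!: derivative_eq_intros)
      moreover have "((\<lambda>t. f (of_real t * x)) has_real_derivative (\<Sum>n. diffs (\<lambda>n. q n x) n * t ^ n)) (at (t + 0 * t))"
        using deriv by simp
      ultimately show ?thesis using DERIV_chain2 by fast
    qed
    then have "deriv (\<lambda>s. f (of_real t * x + of_real s * (of_real t * x))) 0 = t * (\<Sum>n. diffs (\<lambda>n. q n x) n * t ^ n)"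
      by (intro DERIV_imp_deriv) (simp add: algebra_simps)
    moreover have "off_lines (of_real t * x)" using x t by (rule off_lines_scale)
    then have nz: "dih_root k j \<bullet> (of_real t * x) \<noteq> 0" for j
      by (simp add: dih_root_inner off_lines_iff)
    then have "dunkl_op k a b (of_real t * x) f (of_real t * x) = ((of_real t * x) \<bullet> y) * f (of_real t * x)"
      using f by (simp add: is_dunkl_kernel_def)
    moreover have "dunkl_op k a b (of_real t * x) f (of_real t * x) =
       deriv (\<lambda>s. f (of_real t * x + of_real s * (of_real t * x))) 0
       + (\<Sum>j<2*k. kap (int j) * (f (of_real t * x) - f (of_real t * rfl (int j) x)))"
    proof -
      have "rfl j (of_real t * x) = of_real t * rfl j x" for j by (simp add: rfl_def mult_ac)
      then show ?thesis using nz
        by (simp add: dunkl_op_def mult_kappa_eq dih_refl_eq)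
    qed
    ultimately have eq: "t * (\<Sum>n. diffs (\<lambda>n. q n x) n * t ^ n)
       + (\<Sum>j<2*k. kap (int j) * (f (of_real t * x) - f (of_real t * rfl (int j) x)))
       - t * (x \<bullet> y) * f (of_real t * x) = 0"
      by (simp add: scaleR_conv_of_real[symmetric])
    have 2: "(\<lambda>n. if n = 0 then 0 else (x \<bullet> y) * q (n - 1) x * t ^ n) sums (t * (x \<bullet> y) * f (of_real t * x))"
    proof -
      have "(\<lambda>n. t * (x \<bullet> y) * (q n x * t ^ n)) sums (t * (x \<bullet> y) * f (of_real t * x))"
        by (intro sums_mult ps)
      then show ?thesis
        using sums_Suc_iff[of "\<lambda>n. if n = 0 then 0 else (x \<bullet> y) * q (n - 1) x * t ^ n"] by (simp add: mult_ac)
    qed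
    have "(\<lambda>n. real n * q n x * t ^ n + (\<Sum>j<2*k. kap (int j) * (q n x * t ^ n - q n (rfl (int j) x) * t ^ n))
       - (if n = 0 then 0 else (x \<bullet> y) * q (n - 1) x * t ^ n)) sums
       (t * (\<Sum>n. diffs (\<lambda>n. q n x) n * t ^ n)
       + (\<Sum>j<2*k. kap (int j) * (f (of_real t * x) - f (of_real t * rfl (int j) x)))
       - t * (x \<bullet> y) * f (of_real t * x))"
      by (intro sums_diff sums_add 1 2 sums_sum sums_mult ps)
    moreover have "real n * q n x * t ^ n + (\<Sum>j<2*k. kap (int j) * (q n x * t ^ n - q n (rfl (int j) x) * t ^ n))
       - (if n = 0 then 0 else (x \<bullet> y) * q (n - 1) x * t ^ n) = D n * t ^ n" for n
    proof -
      have S: "(\<Sum>j<2*k. kap (int j) * (q n x * t ^ n - q n (rfl (int j) x) * t ^ n)) = (N * q n x - Kop (q n) x) * t ^ n"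
        unfolding sum_kap[symmetric] Kop_def sum_distrib_right sum_subtractf[symmetric]
        by (intro sum.cong) (auto simp: algebra_simps)
      show ?thesis unfolding S by (simp add: D_def algebra_simps)
    qed
    ultimately show ?thesis unfolding eq by simp
  qed
  have "D n = 0" for n by (rule powser_eq_0_coeff) (rule D)
  from this[of "Suc n"] show "(real (Suc n) + N) * q (Suc n) x - Kop (q (Suc n)) x = (x \<bullet> y) * q n x"
    by (simp add: D_def)
qed

text \<open>This direction bisects the adjacent mirrors 0 and 1; lying on a mirror would equate an
  odd with an even integer. Along it every point can be approached from off the mirrors.\<close>

lemma off_lines_direction: "off_lines (cis (pi / (4 * real k)))"
  unfolding off_lines_def
proof
  fix j :: int
  have e: "pi / (4 * real k) + - of_int j * pi / (2 * real k) = of_int (1 - 2 * j) * pi / (4 * real k)"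
    using k_pos by (simp add: field_simps)
  show "Im (cis (pi / (4 * real k)) * cis (- of_int j * pi / (2 * real k))) \<noteq> 0"
  proof
    assume "Im (cis (pi / (4 * real k)) * cis (- of_int j * pi / (2 * real k))) = 0"
    then have "sin (of_int (1 - 2 * j) * pi / (4 * real k)) = 0" unfolding cis_mult e by simp
    then obtain i :: int where "of_int (1 - 2 * j) * pi / (4 * real k) = of_int i * pi"
      using sin_zero_iff_int2 by blast
    then have "pi * of_int (1 - 2 * j) = (pi * of_int (4 * int k * i) :: real)"
      using k_pos by (simp add: field_simps)
    then have "of_int (1 - 2 * j) = (of_int (4 * int k * i) :: real)"
      by (simp only: mult_cancel_left pi_neq_zero) simp
    then have "1 - 2 * j = 4 * int k * i" by (simp only: of_int_eq_iff)
    moreover have "odd (1 - 2 * j)" "even (4 * int k * i)" by simp_all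
    ultimately show False by simp
  qed
qed

lemma eventually_off_lines:
  assumes v: "off_lines v"
  shows "\<forall>\<^sub>F s in at (0::real). off_lines (x + of_real s * v)"
proof -
  have "\<forall>\<^sub>F s in at (0::real). dih_root k j \<bullet> (x + of_real s * v) \<noteq> 0" for j
  proof -
    have eq: "dih_root k j \<bullet> (x + of_real s * v) = dih_root k j \<bullet> x + s * (dih_root k j \<bullet> v)" for s
      by (simp add: inner_add_right flip: scaleR_conv_of_real)
    have v0: "dih_root k j \<bullet> v \<noteq> 0" using v by (simp add: dih_root_inner off_lines_iff)
    show ?thesis
    proof (cases "dih_root k j \<bullet> x = 0")
      case True
      then show ?thesis using v0 by (auto simp: eq eventually_at_filter)
    next
      case False
      have "((\<lambda>s. dih_root k j \<bullet> x + s * (dih_root k j \<bullet> v)) \<longlongrightarrow> dih_root k j \<bullet> x + 0 * (dih_root k j \<bullet> v)) (at 0)"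
        by (intro tendsto_intros)
      then show ?thesis unfolding eq using False by (intro tendsto_imp_eventually_ne) auto
    qed
  qed
  then have "\<forall>\<^sub>F s in at (0::real). \<forall>j\<in>{..<2*k}. dih_root k j \<bullet> (x + of_real s * v) \<noteq> 0"
    by (intro eventually_ball_finite) auto
  then show ?thesis by eventually_elim (auto intro: off_linesI)
qed

text \<open>Off the mirrors the components of both candidates obey one recursion with one initial
  value; continuity carries the equality onto the mirrors.\<close>

lemma dunkl_kernel_unique:
  assumes f: "is_dunkl_kernel k a b y f" and g: "is_dunkl_kernel k a b y g"
  shows "f = g"
proof -
  obtain p where p: "\<And>n. continuous_on UNIV (p n)"
    "\<And>n t x. p n (of_real t * x) = t ^ n * p n x" "\<And>x. (\<lambda>n. p n x) sums f x"
    using f entire_psD unfolding is_dunkl_kernel_def by metis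
  obtain q where q: "\<And>n. continuous_on UNIV (q n)"
    "\<And>n t x. q n (of_real t * x) = t ^ n * q n x" "\<And>x. (\<lambda>n. q n x) sums g x"
    using g entire_psD unfolding is_dunkl_kernel_def by metis
  have off: "p n x = q n x" if "off_lines x" for n x
  proof (rule recursion_unique[where S = off_lines and y = y])
    show "p 0 z = q 0 z" if "off_lines z" for z
      using kernel_components(1)[OF f p(2,3) that] kernel_components(1)[OF g q(2,3) that] by simp
  qed (use kernel_components(2)[OF f p(2,3)] kernel_components(2)[OF g q(2,3)] off_lines_refl that in auto)
  have "p n x = q n x" for n x
  proof -
    define v where "v = cis (pi / (4 * real k))"
    define h where "h s = p n (x + of_real s * v) - q n (x + of_real s * v)" for s :: real
    have "continuous_on UNIV h"
      unfolding h_def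
      by (intro continuous_on_diff continuous_on_compose2[OF p(1)] continuous_on_compose2[OF q(1)]
           continuous_intros) auto
    then have "(h \<longlongrightarrow> h 0) (at 0)" by (simp add: continuous_on_def)
    moreover have "\<forall>\<^sub>F s in at 0. h s = 0"
      using eventually_off_lines[OF off_lines_direction, of x]
      by eventually_elim (simp add: h_def v_def off)
    ultimately have "((\<lambda>_. 0) \<longlongrightarrow> h 0) (at (0::real))" using tendsto_cong[of h "\<lambda>_. 0"] by simp
    then show ?thesis by (simp add: tendsto_const_iff h_def)
  qed
  then show "f = g" using p(3) q(3) by (metis ext sums_unique2)
qed

lemma dunkl_kernel_eq: "dunkl_kernel k a b x y = Eker y x"
  unfolding dunkl_kernel_def
  using the_equality[of "is_dunkl_kernel k a b y", OF is_dunkl_kernel_Eker]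
    dunkl_kernel_unique[OF _ is_dunkl_kernel_Eker] by metis

end

subsection \<open>Class sums of the kernel\<close>

text \<open>With \<open>P\<close> the product, this is the logarithmic derivative:
  \<open>1 / (1 - c X) = 1 + c X / (1 - c X)\<close>, so the sum of the reciprocals is
  \<open>card I - X P' / P\<close>. It applies because all \<open>T i\<close> share the right-hand
  side \<open>K\<close>.\<close>

lemma prod_linear_fps_logderiv:
  fixes c :: "'i \<Rightarrow> real" and T :: "'i \<Rightarrow> real fps"
  assumes "finite I" and T: "\<And>i. i \<in> I \<Longrightarrow> (1 - fps_const (c i) * fps_X) * T i = K"
  shows "(\<Prod>i\<in>I. 1 - fps_const (c i) * fps_X) * (\<Sum>i\<in>I. T i) =
    (of_nat (card I) * (\<Prod>i\<in>I. 1 - fps_const (c i) * fps_X)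
      - fps_X * fps_deriv (\<Prod>i\<in>I. 1 - fps_const (c i) * fps_X)) * K"
  using assms
proof (induction I rule: finite_induct)
  case empty show ?case by simp
next
  case (insert j J)
  define P where "P = (\<Prod>i\<in>J. 1 - fps_const (c i) * fps_X)"
  define L where "L = 1 - fps_const (c j) * fps_X"
  have dL: "fps_deriv L = - fps_const (c j)" by (simp add: L_def)
  have IH: "P * (\<Sum>i\<in>J. T i) = (of_nat (card J) * P - fps_X * fps_deriv P) * K"
    unfolding P_def using insert by auto
  have Tj: "L * T j = K" unfolding L_def using insert by simp
  have "(L * P) * (T j + (\<Sum>i\<in>J. T i)) = P * (L * T j) + L * (P * (\<Sum>i\<in>J. T i))"
    by (simp add: algebra_simps)
  also have "\<dots> = P * K + L * ((of_nat (card J) * P - fps_X * fps_deriv P) * K)"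
    by (simp only: IH Tj)
  also have "\<dots> = (of_nat (Suc (card J)) * (L * P) - fps_X * fps_deriv (L * P)) * K"
  proof -
    have "P = L * P + fps_X * fps_const (c j) * P" by (simp add: L_def algebra_simps)
    then have "P * K = (L * P + fps_X * fps_const (c j) * P) * K" by simp
    then show ?thesis by (simp add: dL algebra_simps del: fps_const_neg)
  qed
  finally show ?case
    using insert.hyps by (simp add: P_def L_def)
qed

text \<open>The maximum principle again, now on four classes. \<open>k - X D' / D\<close> has
  constant term \<open>k\<close>, so at the first undecided degree \<open>n\<close> only that term
  acts; adding the four inequalities gives \<open>n\<close> times the sum of absolute values \<le>
  0.\<close>

lemma fps_system_zero:
  fixes Z D :: "bool \<Rightarrow> bool \<Rightarrow> real fps" and k :: nat
  assumes ab: "a > 0" "b > 0"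
    and D0: "\<And>e d. fps_nth (D e d) 0 = 1"
    and Z0: "\<And>e d. fps_nth (Z e d) 0 = 0"
    and eq: "\<And>e d. D e d * (fps_X * fps_deriv (Z e d) + fps_const (real k * (a + b)) * Z e d) =
        (of_nat k * D e d - fps_X * fps_deriv (D e d)) * (fps_const a * Z (\<not> e) d + fps_const b * Z e (\<not> d))"
  shows "Z e d = 0"
proof -
  define H where "H e d = inverse (D e d) * (of_nat k * D e d - fps_X * fps_deriv (D e d))" for e d
  have H0: "fps_nth (H e d) 0 = real k" for e d
    using D0 by (simp add: H_def fps_mult_nth_0)
  have eq': "fps_X * fps_deriv (Z e d) + fps_const (real k * (a + b)) * Z e d =
        H e d * (fps_const a * Z (\<not> e) d + fps_const b * Z e (\<not> d))" for e d
  proof -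
    have "inverse (D e d) * D e d = 1" using D0 by (intro inverse_mult_eq_1) simp
    then show ?thesis
      using arg_cong[OF eq[of e d], of "\<lambda>f. inverse (D e d) * f"]
      unfolding H_def mult.assoc[symmetric] by simp
  qed
  have "\<forall>e d. fps_nth (Z e d) n = 0" for n
  proof (induction n rule: less_induct)
    case (less n)
    show ?case
    proof (cases "n = 0")
      case True then show ?thesis using Z0 by simp
    next
      case False
      define z where "z e d = fps_nth (Z e d) n" for e d
      have z: "(real n + real k * (a + b)) * z e d = real k * (a * z (\<not> e) d + b * z e (\<not> d))" for e d
      proof -
        define V where "V = fps_const a * Z (\<not> e) d + fps_const b * Z e (\<not> d)"
        have "fps_nth V m = 0" if "m < n" for m using less that by (simp add: V_def)
        then have "fps_nth (H e d * V) n = (\<Sum>i=0..n. if i = 0 then fps_nth (H e d) 0 * fps_nth V n else 0)"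
          unfolding fps_mult_nth using False by (intro sum.cong) auto
        also have "\<dots> = real k * fps_nth V n" by (simp add: H0)
        finally have "fps_nth (H e d * V) n = real k * (a * z (\<not> e) d + b * z e (\<not> d))"
          by (simp add: V_def z_def)
        moreover have "fps_nth (fps_X * fps_deriv (Z e d) + fps_const (real k * (a + b)) * Z e d) n
            = (real n + real k * (a + b)) * z e d"
          using False by (cases n) (simp_all add: z_def algebra_simps)
        ultimately show ?thesis using eq'[of e d] by (simp add: V_def)
      qed
      have "(real n + real k * (a + b)) * \<bar>z e d\<bar> \<le> real k * (a * \<bar>z (\<not> e) d\<bar> + b * \<bar>z e (\<not> d)\<bar>)" for e d
      proof -
        have "(real n + real k * (a + b)) * \<bar>z e d\<bar> = \<bar>real k * (a * z (\<not> e) d + b * z e (\<not> d))\<bar>"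
          using ab by (simp add: z[symmetric] abs_mult)
        also have "\<dots> = real k * \<bar>a * z (\<not> e) d + b * z e (\<not> d)\<bar>" by (simp add: abs_mult)
        also have "\<bar>a * z (\<not> e) d + b * z e (\<not> d)\<bar> \<le> a * \<bar>z (\<not> e) d\<bar> + b * \<bar>z e (\<not> d)\<bar>"
          using ab abs_triangle_ineq[of "a * z (\<not> e) d" "b * z e (\<not> d)"] by (simp add: abs_mult)
        finally show ?thesis by (simp add: mult_left_mono)
      qed
      note le = this[of True True] this[of True False] this[of False True] this[of False False]
      define t where "t = \<bar>z True True\<bar> + \<bar>z True False\<bar> + \<bar>z False True\<bar> + \<bar>z False False\<bar>"
      have "(real n + real k * (a + b)) * t \<le> real k * (a + b) * t"
        using le unfolding t_def by (simp add: algebra_simps)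
      then have "real n * t \<le> 0" by (simp add: algebra_simps)
      then have "t \<le> 0" using False by (simp add: mult_le_0_iff)
      then have "z e d = 0" for e d unfolding t_def by (cases e; cases d) auto
      then show ?thesis by (simp add: z_def)
    qed
  qed
  then show ?thesis by (simp add: fps_eq_iff)
qed

context dihedral
begin

text \<open>Equivariance of the kernel: both sides solve the recursion for the rotated parameter.
  Moving the rotation past a reflection shifts its index by the even number \<open>2 j\<close>,
  which preserves \<open>kap\<close>.\<close>

lemma ker_rot: "ker (y * om j) n x = ker y n (x * om (- j))"
proof (rule recursion_unique[where S = "\<lambda>_. True" and y = "y * om j"
    and u = "ker (y * om j)" and v = "\<lambda>n x. ker y n (x * om (- j))"])
  fix n z
  have "Kop (\<lambda>x. ker y (Suc n) (x * om (- j))) z =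
     (\<Sum>i<2*k. kap (int i + - 2 * j) * ker y (Suc n) (rfl (int i + - 2 * j) (z * om (- j))))"
    unfolding Kop_def
  proof (rule sum.cong)
    fix i :: nat
    have "rfl (int i) z * om (- j) = rfl (int i + - 2 * j) (z * om (- j))"
      by (simp add: rfl_def mult.assoc flip: om_add)
    moreover have "kap (int i + - 2 * j) = kap (int i)" by (simp add: kap_def)
    ultimately show "kap (int i) * ker y (Suc n) (rfl (int i) z * om (- j)) =
       kap (int i + - 2 * j) * ker y (Suc n) (rfl (int i + - 2 * j) (z * om (- j)))" by simp
  qed simp
  also have "\<dots> = Kop (ker y (Suc n)) (z * om (- j))"
    unfolding Kop_def by (rule sum_periodic_shift) simp
  finally have "Kop (\<lambda>x. ker y (Suc n) (x * om (- j))) z = Kop (ker y (Suc n)) (z * om (- j))" .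
  moreover have "z \<bullet> (y * om j) = (z * om (- j)) \<bullet> y"
    by (simp add: om_def inner_complex_def algebra_simps)
  ultimately show "(real (Suc n) + N) * ker y (Suc n) (z * om (- j)) - Kop (\<lambda>x. ker y (Suc n) (x * om (- j))) z
     = (z \<bullet> (y * om j)) * ker y n (z * om (- j))"
    using ker_Suc[of n y "z * om (- j)"] by simp
  show "(real (Suc n) + N) * ker (y * om j) (Suc n) z - Kop (ker (y * om j) (Suc n)) z
     = (z \<bullet> (y * om j)) * ker (y * om j) n z" by (rule ker_Suc)
qed simp_all

lemma ker_refl: "ker (rfl j y) n x = ker y n (rfl j x)"
proof (rule recursion_unique[where S = "\<lambda>_. True" and y = "rfl j y"
    and u = "ker (rfl j y)" and v = "\<lambda>n x. ker y n (rfl j x)"])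
  fix n z
  have "Kop (\<lambda>x. ker y (Suc n) (rfl j x)) z =
     (\<Sum>i<2*k. kap (2 * j - int i) * ker y (Suc n) (rfl (2 * j - int i) (rfl j z)))"
    unfolding Kop_def by (simp add: rfl_rfl)
  also have "\<dots> = Kop (ker y (Suc n)) (rfl j z)"
    unfolding Kop_def by (rule sum_periodic_reflect) simp
  finally have "Kop (\<lambda>x. ker y (Suc n) (rfl j x)) z = Kop (ker y (Suc n)) (rfl j z)" .
  moreover have "z \<bullet> rfl j y = rfl j z \<bullet> y"
    by (simp add: om_def rfl_def inner_complex_def algebra_simps)
  ultimately show "(real (Suc n) + N) * ker y (Suc n) (rfl j z) - Kop (\<lambda>x. ker y (Suc n) (rfl j x)) z
     = (z \<bullet> rfl j y) * ker y n (rfl j z)"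
    using ker_Suc[of n y "rfl j z"] by simp
  show "(real (Suc n) + N) * ker (rfl j y) (Suc n) z - Kop (ker (rfl j y) (Suc n)) z
     = (z \<bullet> rfl j y) * ker (rfl j y) n z" by (rule ker_Suc)
qed simp_all

text \<open>Sum over a coset of the rotations by \<open>2 \<pi> / k\<close>. The parity of
  \<open>p\<close> and the choice between \<open>x\<close> and \<open>cnj x\<close> give the four
  classes.\<close>

definition cls :: "complex \<Rightarrow> nat \<Rightarrow> complex \<Rightarrow> int \<Rightarrow> real" where
  "cls y n x p = (\<Sum>l<k. ker y n (x * om (2 * int l + p)))"

lemma cls_shift: "(\<Sum>l<k. ker y n (x * om (2 * (int l + s) + p))) = cls y n x p"
  unfolding cls_def
proof (rule sum_periodic_shift)
  fix l
  have "2 * (l + int k) + p = (2 * l + p) + 2 * int k" by simp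
  then show "ker y n (x * om (2 * (l + int k) + p)) = ker y n (x * om (2 * l + p))" by (simp only: om_period)
qed

text \<open>Even reflections reach rotation indices of the parity of \<open>- p\<close>, hence of
  \<open>p\<close>; odd ones those of \<open>1 - p\<close>. Each coset is met in full, so the value
  does not depend on \<open>l\<close>.\<close>

lemma Kop_class:
  "Kop (ker y n) (x * om (2 * l + p)) = a * cls y n (cnj x) p + b * cls y n (cnj x) (1 - p)"
proof -
  have "Kop (ker y n) (x * om (2 * l + p)) =
     (\<Sum>m<k. a * ker y n (cnj x * om (2 * int m - (2 * l + p))))
     + (\<Sum>m<k. b * ker y n (cnj x * om (2 * int m + 1 - (2 * l + p))))"
    unfolding Kop_def rfl_rot sum_lessThan_double by (simp add: kap_def add.commute)
  also have "(\<Sum>m<k. a * ker y n (cnj x * om (2 * int m - (2 * l + p)))) = a * cls y n (cnj x) p"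
    unfolding cls_shift[of y n "cnj x" "- l - p" p, symmetric] sum_distrib_left
    by (simp add: algebra_simps)
  also have "(\<Sum>m<k. b * ker y n (cnj x * om (2 * int m + 1 - (2 * l + p)))) = b * cls y n (cnj x) (1 - p)"
    unfolding cls_shift[of y n "cnj x" "- l" "1 - p", symmetric] sum_distrib_left
    by (simp add: algebra_simps)
  finally show ?thesis .
qed

text \<open>The factor \<open>pochhammer N n\<close> is a formal Laplace transform; it turns the radial equation into an
  Okubo system, of which the right-hand side is constant on classes of group elements.\<close>

definition efps :: "complex \<Rightarrow> complex \<Rightarrow> real fps" where
  "efps y x = Abs_fps (\<lambda>n. pochhammer N n * ker y n x)"

definition Sfps :: "complex \<Rightarrow> complex \<Rightarrow> int \<Rightarrow> real fps" where
  "Sfps y x p = Abs_fps (\<lambda>n. pochhammer N n * cls y n x p)"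

definition Dfps :: "complex \<Rightarrow> complex \<Rightarrow> int \<Rightarrow> real fps" where
  "Dfps y x p = (\<Prod>l<k. 1 - fps_const ((x * om (2 * int l + p)) \<bullet> y) * fps_X)"

lemma efps_ode:
  "(1 - fps_const (x \<bullet> y) * fps_X) * (fps_X * fps_deriv (efps y x) + fps_const N * efps y x)
   = Abs_fps (\<lambda>n. pochhammer N n * Kop (ker y n) x)"
proof (rule fps_ext)
  fix n
  define T where "T = fps_X * fps_deriv (efps y x) + fps_const N * efps y x"
  have T: "fps_nth T n = (real n + N) * (pochhammer N n * ker y n x)" for n
    by (cases n) (simp_all add: T_def efps_def algebra_simps)
  have "fps_nth ((1 - fps_const (x \<bullet> y) * fps_X) * T) n = fps_nth T n - (x \<bullet> y) * (if n = 0 then 0 else fps_nth T (n - 1))"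
    by (simp add: algebra_simps)
  also have "\<dots> = pochhammer N n * Kop (ker y n) x"
  proof (cases n)
    case 0 then show ?thesis by (simp add: T Kop_def sum_kap)
  next
    case (Suc m)
    \<comment> \<open>\<open>pochhammer N (Suc m)\<close> supplies the factor \<open>m + N\<close>
      that makes the term in \<open>ker y m\<close> equal to coefficient \<open>m\<close> of
      \<open>T\<close>.\<close>
    have "fps_nth T n - (x \<bullet> y) * (if n = 0 then 0 else fps_nth T (n - 1)) =
       pochhammer N n * ((real (Suc m) + N) * ker y (Suc m) x - (x \<bullet> y) * ker y m x)"
      by (simp add: T Suc pochhammer_Suc algebra_simps)
    also have "(real (Suc m) + N) * ker y (Suc m) x - (x \<bullet> y) * ker y m x = Kop (ker y n) x"
      using ker_Suc[of m y x] by (simp add: Suc)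
    finally show ?thesis .
  qed
  finally show "fps_nth ((1 - fps_const (x \<bullet> y) * fps_X) * (fps_X * fps_deriv (efps y x) + fps_const N * efps y x)) n
    = fps_nth (Abs_fps (\<lambda>n. pochhammer N n * Kop (ker y n) x)) n" by (simp add: T_def)
qed

lemma Sfps_ode:
  "Dfps y x p * (fps_X * fps_deriv (Sfps y x p) + fps_const N * Sfps y x p) =
   (of_nat k * Dfps y x p - fps_X * fps_deriv (Dfps y x p))
   * (fps_const a * Sfps y (cnj x) p + fps_const b * Sfps y (cnj x) (1 - p))"
proof -
  define T where "T l = fps_X * fps_deriv (efps y (x * om (2 * int l + p)))
     + fps_const N * efps y (x * om (2 * int l + p))" for l
  define K where "K = fps_const a * Sfps y (cnj x) p + fps_const b * Sfps y (cnj x) (1 - p)"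
  have T: "(1 - fps_const ((x * om (2 * int l + p)) \<bullet> y) * fps_X) * T l = K" for l
    unfolding T_def efps_ode Kop_class K_def
    by (rule fps_ext) (simp add: Sfps_def algebra_simps)
  have S: "Sfps y x p = (\<Sum>l<k. efps y (x * om (2 * int l + p)))"
    by (rule fps_ext) (simp add: Sfps_def efps_def cls_def fps_sum_nth sum_distrib_left)
  have "(\<Sum>l<k. T l) = fps_X * fps_deriv (Sfps y x p) + fps_const N * Sfps y x p"
    by (simp add: T_def S fps_deriv_sum sum.distrib sum_distrib_left)
  then show ?thesis
    using prod_linear_fps_logderiv[of "{..<k}" "\<lambda>l. (x * om (2 * int l + p)) \<bullet> y" T K] T
    by (simp add: Dfps_def K_def)
qed

text \<open>By equivariance the group acts on \<open>z\<close> instead of \<open>w\<close>, and its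
  \<open>4 k\<close> elements split into the four classes.\<close>

lemma gen_bessel_sums:
  "(\<lambda>n. (cls w n z 0 + cls w n z 1 + cls w n (cnj z) 0 + cls w n (cnj z) 1) / (4 * real k))
   sums gen_bessel k a b z w"
proof -
  have rot: "dunkl_kernel k a b z (dih_rot k j w) = Eker w (z * om (- int j))" for j
  proof -
    have "dih_rot k j w = w * om (int j)" by (simp add: dih_rot_def om_def)
    then show ?thesis by (simp add: dunkl_kernel_eq Eker_def ker_rot)
  qed
  have refl': "dunkl_kernel k a b z (dih_refl k j w) = Eker w (cnj z * om (int j))" for j
    by (simp add: dunkl_kernel_eq Eker_def ker_refl dih_refl_eq) (simp add: rfl_def)
  have "(\<lambda>n. 1 / (4 * real k) * (\<Sum>j<2*k. ker w n (z * om (- int j)) + ker w n (cnj z * om (int j))))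
     sums gen_bessel k a b z w"
    unfolding gen_bessel_def rot refl' by (intro sums_mult sums_sum sums_add ker_sums)
  moreover have "(\<Sum>j<2*k. ker w n (z * om (- int j)) + ker w n (cnj z * om (int j))) =
     cls w n z 0 + cls w n z 1 + cls w n (cnj z) 0 + cls w n (cnj z) 1" for n
  proof -
    have "(\<Sum>j<2*k. ker w n (z * om (0 - int j))) = (\<Sum>j<2*k. ker w n (z * om (int j)))"
      by (rule sum_periodic_reflect) simp
    moreover have "(\<Sum>j<2*k. ker w n (u * om (int j))) = cls w n u 0 + cls w n u 1" for u
      unfolding sum_lessThan_double cls_def by (simp add: add.commute)
    ultimately show ?thesis by (simp add: sum.distrib)
  qed
  ultimately show ?thesis by simp
qed

end

subsection \<open>Real powers of formal power series\<close>

text \<open>Formal counterpart of \<open>Q = f powr r\<close>: the logarithmic derivative of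
  \<open>Q\<close> is \<open>r\<close> times that of \<open>f\<close>. Products and substitutions
  then reduce to the product and chain rules.\<close>

definition is_fps_powr :: "real \<Rightarrow> real fps \<Rightarrow> real fps \<Rightarrow> bool" where
  "is_fps_powr r f Q \<longleftrightarrow> f * fps_deriv Q = fps_const r * fps_deriv f * Q \<and> fps_nth Q 0 = 1"

lemma is_fps_powr_exists:
  assumes "fps_nth f 0 = 1"
  shows "is_fps_powr r f (fps_binomial r oo (f - 1))"
proof -
  have f0: "fps_nth (f - 1) 0 = 0" using assms by simp
  have "(1 + fps_X) * fps_deriv (fps_binomial r) = fps_const r * fps_binomial r"
  proof -
    have "(1 + fps_X :: real fps) * inverse (1 + fps_X) = 1"
      using inverse_mult_eq_1[of "1 + fps_X :: real fps"] by (simp add: mult.commute)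
    then show ?thesis
      by (simp add: fps_binomial_deriv fps_divide_unit mult_ac)
  qed
  then have "((1 + fps_X) * fps_deriv (fps_binomial r)) oo (f - 1) = (fps_const r * fps_binomial r) oo (f - 1)"
    by simp
  then have "f * (fps_deriv (fps_binomial r) oo (f - 1)) = fps_const r * (fps_binomial r oo (f - 1))"
    by (simp add: fps_compose_mult_distrib[OF f0] fps_compose_add_distrib fps_X_fps_compose_startby0[OF f0])
  then have "f * (fps_deriv (fps_binomial r) oo (f - 1)) * fps_deriv f = fps_const r * (fps_binomial r oo (f - 1)) * fps_deriv f"
    by simp
  then show ?thesis
    by (simp add: is_fps_powr_def fps_compose_deriv[OF f0] mult_ac)
qed

text \<open>The quotient of two solutions has derivative zero and constant term 1.\<close>

lemma is_fps_powr_unique: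
  assumes f: "fps_nth f 0 = 1" and Q: "is_fps_powr r f Q" and R: "is_fps_powr r f R"
  shows "Q = R"
proof -
  have Q0: "fps_nth Q 0 \<noteq> 0" "Q \<noteq> 0" "f \<noteq> 0" using Q f by (auto simp: is_fps_powr_def)
  have iQ: "inverse Q * Q = 1" using Q0 by (intro inverse_mult_eq_1) auto
  define T where "T = R * inverse Q"
  have RT: "R = T * Q" using iQ by (simp add: T_def mult.assoc)
  have "f * fps_deriv R = fps_const r * fps_deriv f * R" using R by (simp add: is_fps_powr_def)
  then have "f * fps_deriv T * Q + T * (f * fps_deriv Q) = T * (fps_const r * fps_deriv f * Q)"
    unfolding RT by (simp add: algebra_simps)
  then have "f * fps_deriv T * Q = 0" using Q by (simp add: is_fps_powr_def)
  then have "fps_deriv T = 0" using Q0 by simp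
  then have "T = fps_const (fps_nth T 0)" by (simp add: fps_deriv_eq_0_iff)
  moreover have "fps_nth T 0 = 1"
    using Q R by (simp add: T_def is_fps_powr_def)
  ultimately show ?thesis using RT by simp
qed

lemma is_fps_powr_mult:
  assumes "is_fps_powr r f Q" "is_fps_powr r g R"
  shows "is_fps_powr r (f * g) (Q * R)"
proof -
  have "f * g * fps_deriv (Q * R) = (f * fps_deriv Q) * (g * R) + (g * fps_deriv R) * (f * Q)"
    by (simp add: algebra_simps)
  also have "\<dots> = (fps_const r * fps_deriv f * Q) * (g * R) + (fps_const r * fps_deriv g * R) * (f * Q)"
    using assms by (simp add: is_fps_powr_def)
  finally show ?thesis using assms by (simp add: is_fps_powr_def algebra_simps)
qed

lemma is_fps_powr_prod:
  "finite I \<Longrightarrow> (\<And>i. i \<in> I \<Longrightarrow> is_fps_powr r (f i) (Q i)) \<Longrightarrow> is_fps_powr r (\<Prod>i\<in>I. f i) (\<Prod>i\<in>I. Q i)"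
  by (induction I rule: finite_induct) (auto simp: is_fps_powr_mult, simp add: is_fps_powr_def)

text \<open>The binomial series of \<open>(1 - x X) powr (- c)\<close>.\<close>

definition geom_fps :: "real \<Rightarrow> real \<Rightarrow> real fps" where
  "geom_fps c x = Abs_fps (\<lambda>n. pochhammer c n / fact n * x ^ n)"

lemma geom_fps_ode: "(1 - fps_const x * fps_X) * fps_deriv (geom_fps c x) = fps_const (c * x) * geom_fps c x"
proof (rule fps_ext)
  fix n
  define T where "T = fps_deriv (geom_fps c x)"
  have d: "fps_nth T n = (c + real n) * x * (pochhammer c n / fact n * x ^ n)" for n
    by (simp add: T_def geom_fps_def pochhammer_Suc divide_simps)
  have "fps_nth ((1 - fps_const x * fps_X) * T) n = fps_nth T n - x * (if n = 0 then 0 else fps_nth T (n - 1))"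
    by (simp add: algebra_simps)
  also have "(if n = 0 then 0 else fps_nth T (n - 1)) = real n * (pochhammer c n / fact n * x ^ n)"
    by (simp add: T_def geom_fps_def)
  finally show "fps_nth ((1 - fps_const x * fps_X) * fps_deriv (geom_fps c x)) n = fps_nth (fps_const (c * x) * geom_fps c x) n"
    unfolding d T_def[symmetric] by (simp add: geom_fps_def algebra_simps add_divide_distrib)
qed

lemma is_fps_powr_geom: "is_fps_powr (- c) (1 - fps_const x * fps_X) (geom_fps c x)"
  using geom_fps_ode[of x c] by (simp add: is_fps_powr_def) (simp add: geom_fps_def mult_ac)

subsection \<open>Pulling back the rank one system\<close>

text \<open>Here \<open>\<tau> = q / P\<close> is the new variable and \<open>Q\<close> plays
  \<open>P powr (- c)\<close>. Assumption \<open>qd\<close> makes \<open>q\<close> a multiple of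
  \<open>X ^ k\<close>.\<close>

locale pullback =
  fixes k :: nat and c :: real and P q Q \<tau> :: "real fps"
  assumes P0: "fps_nth P 0 = 1" and P_tau: "P * \<tau> = q" and tau0 [simp]: "fps_nth \<tau> 0 = 0"
    and qd: "fps_X * fps_deriv q = of_nat k * q"
    and Q: "is_fps_powr (- c) P Q"
begin

lemma P_nz: "P \<noteq> 0" using P0 by auto

lemma dQ: "P * fps_deriv Q = - fps_const c * fps_deriv P * Q"
  using Q by (simp add: is_fps_powr_def)

lemma dq: "fps_deriv q = fps_deriv P * \<tau> + P * fps_deriv \<tau>"
  unfolding P_tau[symmetric] by (simp add: algebra_simps)

text \<open>Put \<open>R = k P - X P'\<close>. By \<open>qd\<close>, \<open>X d/dX\<close> becomes
  \<open>(R / P) \<tau> d/d\<tau>\<close>. The prefactor \<open>Q\<close> together with the constant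
  \<open>k c\<close> gives \<open>c R / P\<close>, the same factor. Finally \<open>q\<close> drops
  out of the right-hand bracket, which equals \<open>R\<close> for every \<open>X1\<close>.\<close>

lemma pullback_ode:
  assumes F: "(1 - fps_const X1 * fps_X) * (fps_X * fps_deriv F + fps_const c * F) = K"
  shows "(P - fps_const X1 * q) * (fps_X * fps_deriv (Q * (F oo \<tau>)) + fps_const (real k * c) * (Q * (F oo \<tau>))) =
    (of_nat k * (P - fps_const X1 * q) - fps_X * fps_deriv (P - fps_const X1 * q)) * (Q * (K oo \<tau>))"
proof -
  define G where "G = F oo \<tau>"
  define G1 where "G1 = fps_deriv F oo \<tau>"
  define KK where "KK = K oo \<tau>"
  have dG: "fps_deriv G = G1 * fps_deriv \<tau>" by (simp add: G_def G1_def fps_compose_deriv)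
  have KK: "(1 - fps_const X1 * \<tau>) * (\<tau> * G1 + fps_const c * G) = KK"
    unfolding KK_def F[symmetric] G_def G1_def
    by (simp add: fps_compose_mult_distrib fps_compose_add_distrib fps_compose_sub_distrib)
  define R where "R = of_nat k * P - fps_X * fps_deriv P"
  have Xt: "fps_X * P * fps_deriv \<tau> = R * \<tau>"
  proof -
    have "fps_X * fps_deriv q = of_nat k * (P * \<tau>)" by (simp add: qd P_tau)
    then show ?thesis unfolding dq R_def by (simp add: algebra_simps)
  qed
  have kc: "fps_const (real k * c) = of_nat k * fps_const c"
    by (simp flip: fps_const_mult fps_of_nat)
  have "P * (fps_X * fps_deriv (Q * G) + fps_const (real k * c) * (Q * G))
     = fps_X * (P * fps_deriv Q) * G + Q * (fps_X * P * fps_deriv \<tau>) * G1 + of_nat k * fps_const c * P * Q * G"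
    unfolding kc by (simp add: dG algebra_simps)
  also have "\<dots> = Q * R * (\<tau> * G1 + fps_const c * G)"
    unfolding dQ Xt unfolding R_def by (simp add: algebra_simps del: fps_const_neg)
  finally have *: "P * (fps_X * fps_deriv (Q * G) + fps_const (real k * c) * (Q * G)) = Q * R * (\<tau> * G1 + fps_const c * G)" .
  have "P * ((P - fps_const X1 * q) * (fps_X * fps_deriv (Q * G) + fps_const (real k * c) * (Q * G)))
     = (P - fps_const X1 * q) * (P * (fps_X * fps_deriv (Q * G) + fps_const (real k * c) * (Q * G)))"
    by (simp only: mult_ac)
  also have "\<dots> = P * (1 - fps_const X1 * \<tau>) * (Q * R * (\<tau> * G1 + fps_const c * G))"
    unfolding * unfolding P_tau[symmetric] by (simp add: algebra_simps)
  also have "\<dots> = P * (R * (Q * KK))" unfolding KK[symmetric] by (simp only: mult_ac)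
  finally have "(P - fps_const X1 * q) * (fps_X * fps_deriv (Q * G) + fps_const (real k * c) * (Q * G)) = R * (Q * KK)"
    using P_nz by (simp only: mult_cancel_left) simp
  moreover have "of_nat k * (P - fps_const X1 * q) - fps_X * fps_deriv (P - fps_const X1 * q) = R"
  proof -
    have e: "fps_X * fps_deriv (P - fps_const X1 * q) = fps_X * fps_deriv P - fps_const X1 * (fps_X * fps_deriv q)"
      by (simp add: algebra_simps)
    show ?thesis unfolding e qd R_def by (simp add: algebra_simps)
  qed
  ultimately show ?thesis by (simp add: G_def KK_def)
qed

text \<open>Formal version of \<open>P - x q = P (1 - x \<tau>)\<close> raised to the power
  \<open>- c\<close>.\<close>

lemma is_fps_powr_pullback:
  "is_fps_powr (- c) (P - fps_const x * q) (Q * (geom_fps c x oo \<tau>))"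
proof -
  define B where "B = geom_fps c x oo \<tau>"
  define B1 where "B1 = fps_deriv (geom_fps c x) oo \<tau>"
  have dB: "fps_deriv B = B1 * fps_deriv \<tau>" by (simp add: B_def B1_def fps_compose_deriv)
  have B1: "(1 - fps_const x * \<tau>) * B1 = fps_const (c * x) * B"
    using arg_cong[OF geom_fps_ode[of x c], of "\<lambda>f. f oo \<tau>"]
    by (simp add: fps_compose_mult_distrib fps_compose_sub_distrib B_def B1_def)
  have "(P - fps_const x * q) * fps_deriv (Q * B) =
     (1 - fps_const x * \<tau>) * (P * fps_deriv Q) * B + P * Q * fps_deriv \<tau> * ((1 - fps_const x * \<tau>) * B1)"
    unfolding P_tau[symmetric] by (simp add: dB algebra_simps)
  also have "\<dots> = fps_const (- c) * (fps_deriv P - fps_const x * fps_deriv q) * (Q * B)"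
    unfolding dQ B1 dq by (simp add: algebra_simps flip: fps_const_mult fps_const_neg)
  finally show ?thesis
    using Q by (simp add: is_fps_powr_def B_def) (simp add: geom_fps_def)
qed

text \<open>The weights do not involve \<open>F\<close>. The kernel side and the \<open>G\<close>
  side thus use the same weights, and only the coefficients of the two series \<open>F\<close>
  remain to be compared.\<close>

lemma pullback_nth:
  "fps_nth (Q * (F oo \<tau>)) n = (\<Sum>i\<le>n. fps_nth (Q * \<tau> ^ i) n * fps_nth F i)"
proof -
  have "fps_nth (Q * (F oo \<tau>)) n = (\<Sum>l=0..n. \<Sum>i\<le>n. fps_nth Q l * fps_nth (\<tau> ^ i) (n - l) * fps_nth F i)"
    unfolding fps_mult_nth
  proof (rule sum.cong)
    fix l assume "l \<in> {0..n}"
    have "fps_nth (F oo \<tau>) (n - l) = (\<Sum>i\<le>n. fps_nth F i * fps_nth (\<tau> ^ i) (n - l))"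
      unfolding fps_compose_nth
      by (rule sum.mono_neutral_left) (auto simp: startsby_zero_power_prefix)
    then show "fps_nth Q l * fps_nth (F oo \<tau>) (n - l) =
       (\<Sum>i\<le>n. fps_nth Q l * fps_nth (\<tau> ^ i) (n - l) * fps_nth F i)"
      by (simp add: sum_distrib_left mult_ac)
  qed simp
  also have "\<dots> = (\<Sum>i\<le>n. \<Sum>l=0..n. fps_nth Q l * fps_nth (\<tau> ^ i) (n - l) * fps_nth F i)"
    by (rule sum.swap)
  finally show ?thesis by (simp add: fps_mult_nth sum_distrib_right)
qed

end

section \<open>Rank one kernels and their products\<close>

definition rk1 :: "(nat \<Rightarrow> real) \<Rightarrow> real \<Rightarrow> real \<Rightarrow> real fps" where
  "rk1 M A s = Abs_fps (\<lambda>l. A ^ l / fact l * (M l + s * M (Suc l)))"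

text \<open>When \<open>M\<close> lists the moments of a measure in \<open>u\<close>,
  \<open>rk1\<close> is the integral of \<open>exp (A u X) (1 + s u)\<close>; the two signs
  \<open>s\<close> are the two points of a rank one orbit. The hypothesis on \<open>M\<close> is the
  integration by parts rule proved in \<open>nu_moment_Suc\<close>.\<close>

lemma rk1_ode:
  assumes M: "\<And>j. (2 * a + real j) * M (Suc j) = real j * M (j - 1)" and s: "s * s = 1"
  shows "fps_X * fps_deriv (rk1 M A s) + fps_const a * (rk1 M A s - rk1 M A (- s)) = fps_const (s * A) * fps_X * rk1 M A s"
proof (rule fps_ext)
  fix n
  show "fps_nth (fps_X * fps_deriv (rk1 M A s) + fps_const a * (rk1 M A s - rk1 M A (- s))) n
     = fps_nth (fps_const (s * A) * fps_X * rk1 M A s) n"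
  proof (cases n)
    case 0
    \<comment> \<open>At \<open>j = 0\<close> the recursion says that the first moment
      vanishes.\<close>
    then show ?thesis using M[of 0] by (auto simp: rk1_def)
  next
    case (Suc m)
    have "fps_nth (fps_X * fps_deriv (rk1 M A s) + fps_const a * (rk1 M A s - rk1 M A (- s))) n =
       real (Suc m) * (A ^ Suc m / fact (Suc m)) * M (Suc m)
       + s * (A ^ Suc m / fact (Suc m)) * ((2 * a + real (Suc m)) * M (Suc (Suc m)))"
      unfolding Suc by (simp add: rk1_def algebra_simps del: fact_Suc of_nat_Suc)
    also have "\<dots> = (real (Suc m) * (A ^ Suc m / fact (Suc m))) * (M (Suc m) + s * M m)"
      unfolding M by (simp add: algebra_simps add_divide_distrib del: fact_Suc of_nat_Suc)
    also have "real (Suc m) * (A ^ Suc m / fact (Suc m)) = A * (A ^ m / fact m)"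
      by (simp add: divide_simps)
    also have "M (Suc m) + s * M m = s * (M m + s * M (Suc m))"
      using s by (simp add: algebra_simps)
    finally show ?thesis unfolding Suc by (simp add: rk1_def mult.assoc mult_ac)
  qed
qed

definition sg :: "bool \<Rightarrow> real" where "sg e = (if e then 1 else -1)"

lemma sg_simps [simp]: "sg e * sg e = 1" "sg (\<not> e) = - sg e" "sg True = 1" "sg False = -1"
  by (simp_all add: sg_def)

text \<open>The system for \<open>k = 1\<close>, where the group is a product of two rank one
  groups. \<open>A\<close> and \<open>B\<close> become the product of cosines and the product of
  sines.\<close>

locale rank_two_moments =
  fixes a b A B :: real and Ma Mb :: "nat \<Rightarrow> real"
  assumes Ma: "\<And>j. (2 * a + real j) * Ma (Suc j) = real j * Ma (j - 1)"
    and Mb: "\<And>j. (2 * b + real j) * Mb (Suc j) = real j * Mb (j - 1)"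
    and Ma0: "Ma 0 = 1" and Mb0: "Mb 0 = 1" and ab: "a > 0" "b > 0"
begin

definition wfps :: "bool \<Rightarrow> bool \<Rightarrow> real fps" where
  "wfps e d = rk1 Ma B (sg e) * rk1 Mb A (sg d)"

definition Ffps :: "bool \<Rightarrow> bool \<Rightarrow> real fps" where
  "Ffps e d = Abs_fps (\<lambda>m. pochhammer (a + b) m * fps_nth (wfps e d) m)"

lemma wfps_ode:
  "fps_X * fps_deriv (wfps e d) + fps_const (a + b) * wfps e d
   = fps_const a * wfps (\<not> e) d + fps_const b * wfps e (\<not> d) + fps_const (sg d * A + sg e * B) * fps_X * wfps e d"
proof -
  define u where "u = rk1 Ma B (sg e)"
  define u' where "u' = rk1 Ma B (- sg e)"
  define v where "v = rk1 Mb A (sg d)"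
  define v' where "v' = rk1 Mb A (- sg d)"
  have 1: "fps_X * fps_deriv u = fps_const (sg e * B) * fps_X * u - fps_const a * (u - u')"
    using rk1_ode[OF Ma sg_simps(1), where A = B, of e] unfolding u_def u'_def by (simp add: eq_diff_eq)
  have 2: "fps_X * fps_deriv v = fps_const (sg d * A) * fps_X * v - fps_const b * (v - v')"
    using rk1_ode[OF Mb sg_simps(1), where A = A, of d] unfolding v_def v'_def by (simp add: eq_diff_eq)
  have "fps_X * fps_deriv (u * v) = (fps_X * fps_deriv u) * v + u * (fps_X * fps_deriv v)"
    by (simp add: algebra_simps)
  also have "\<dots> = fps_const a * (u' * v) + fps_const b * (u * v') + fps_const (sg d * A + sg e * B) * fps_X * (u * v)
      - fps_const (a + b) * (u * v)"
    unfolding 1 2 by (simp add: algebra_simps flip: fps_const_add)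
  finally show ?thesis
    by (simp add: wfps_def u_def v_def u'_def v'_def)
qed

lemma Ffps_ode:
  "(1 - fps_const (sg d * A + sg e * B) * fps_X) * (fps_X * fps_deriv (Ffps e d) + fps_const (a + b) * Ffps e d)
   = fps_const a * Ffps (\<not> e) d + fps_const b * Ffps e (\<not> d)"
proof (rule fps_ext)
  fix n
  define X1 where "X1 = sg d * A + sg e * B"
  define T where "T = fps_X * fps_deriv (Ffps e d) + fps_const (a + b) * Ffps e d"
  have T: "fps_nth T n = pochhammer (a + b) (Suc n) * fps_nth (wfps e d) n" for n
    by (cases n) (simp_all add: T_def Ffps_def pochhammer_Suc algebra_simps)
  have w: "(real n + (a + b)) * fps_nth (wfps e d) n = a * fps_nth (wfps (\<not> e) d) n + b * fps_nth (wfps e (\<not> d)) n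
      + X1 * (if n = 0 then 0 else fps_nth (wfps e d) (n - 1))"
    using arg_cong[OF wfps_ode[of e d], of "\<lambda>f. fps_nth f n"]
    by (cases n) (simp_all add: X1_def algebra_simps)
  have "fps_nth ((1 - fps_const X1 * fps_X) * T) n = fps_nth T n - X1 * (if n = 0 then 0 else fps_nth T (n - 1))"
    by (simp add: algebra_simps)
  also have "\<dots> = pochhammer (a + b) n * ((real n + (a + b)) * fps_nth (wfps e d) n
       - X1 * (if n = 0 then 0 else fps_nth (wfps e d) (n - 1)))"
    by (cases n) (simp_all add: T pochhammer_Suc algebra_simps)
  also have "\<dots> = fps_nth (fps_const a * Ffps (\<not> e) d + fps_const b * Ffps e (\<not> d)) n"
    unfolding w by (simp add: Ffps_def algebra_simps)
  finally show "fps_nth ((1 - fps_const (sg d * A + sg e * B) * fps_X) * (fps_X * fps_deriv (Ffps e d) + fps_const (a + b) * Ffps e d)) n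
    = fps_nth (fps_const a * Ffps (\<not> e) d + fps_const b * Ffps e (\<not> d)) n"
    by (simp add: T_def X1_def)
qed

lemma Ffps_0 [simp]: "fps_nth (Ffps e d) 0 = 1"
  using Ma[of 0] Mb[of 0] ab by (simp add: Ffps_def wfps_def rk1_def Ma0 Mb0)

text \<open>Moment of order \<open>m\<close> of \<open>v A + u B\<close> for independent
  \<open>u\<close>, \<open>v\<close> with moments \<open>Ma\<close>, \<open>Mb\<close>.\<close>

definition biv_moment :: "nat \<Rightarrow> real" where
  "biv_moment m = (\<Sum>l\<le>m. real (m choose l) * (A ^ l * Mb l) * (B ^ (m - l) * Ma (m - l)))"

text \<open>The four factors \<open>(1 + s u) (1 + s' v)\<close> add up to 4, so only the plain
  exponential is left.\<close>

lemma Ffps_average: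
  "fps_nth (Ffps True True) m + fps_nth (Ffps True False) m + fps_nth (Ffps False True) m + fps_nth (Ffps False False) m
   = 4 * (pochhammer (a + b) m / fact m * biv_moment m)"
proof -
  have s: "rk1 M C 1 + rk1 M C (-1) = 2 * Abs_fps (\<lambda>l. C ^ l / fact l * M l)" for M C
    by (rule fps_ext) (simp add: rk1_def field_simps numeral_fps_const)
  have "wfps True True + wfps True False + wfps False True + wfps False False
     = (rk1 Mb A 1 + rk1 Mb A (-1)) * (rk1 Ma B 1 + rk1 Ma B (-1))"
    by (simp add: wfps_def algebra_simps)
  also have "\<dots> = fps_const 4 * (Abs_fps (\<lambda>l. A ^ l / fact l * Mb l) * Abs_fps (\<lambda>l. B ^ l / fact l * Ma l))"
    unfolding s numeral_fps_const[symmetric] by simp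
  finally have "fps_nth (wfps True True + wfps True False + wfps False True + wfps False False) m
     = 4 * (\<Sum>l=0..m. (A ^ l / fact l * Mb l) * (B ^ (m - l) / fact (m - l) * Ma (m - l)))"
    by (simp only: fps_mult_left_const_nth) (simp add: fps_mult_nth)
  also have "(\<Sum>l=0..m. (A ^ l / fact l * Mb l) * (B ^ (m - l) / fact (m - l) * Ma (m - l))) = biv_moment m / fact m"
    unfolding biv_moment_def sum_divide_distrib atMost_atLeast0
    by (intro sum.cong) (auto simp: binomial_fact)
  finally have e: "fps_nth (wfps True True) m + fps_nth (wfps True False) m + fps_nth (wfps False True) m
      + fps_nth (wfps False False) m = 4 * (biv_moment m / fact m)" by simp
  have "fps_nth (Ffps True True) m + fps_nth (Ffps True False) m + fps_nth (Ffps False True) m + fps_nth (Ffps False False) m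
     = pochhammer (a + b) m * (fps_nth (wfps True True) m + fps_nth (wfps True False) m + fps_nth (wfps False True) m
      + fps_nth (wfps False False) m)" by (simp add: Ffps_def algebra_simps)
  then show ?thesis unfolding e by simp
qed

lemma odd_moments:
  assumes "c > 0" "\<And>j. (2 * c + real j) * M (Suc j) = real j * M (j - 1)" "odd j"
  shows "M j = 0"
proof -
  have "M (Suc (2 * i)) = 0" for i
  proof (induction i)
    case 0 then show ?case using assms(2)[of 0] assms(1) by simp
  next
    case (Suc i)
    have "(2 * c + real (2 * Suc i)) * M (Suc (2 * Suc i)) = 0" unfolding assms(2) using Suc by simp
    moreover have "2 * c + real (2 * Suc i) > 0" using assms(1) by simp
    ultimately show ?case by (metis less_irrefl mult_eq_0_iff)
  qed
  then show ?thesis using \<open>odd j\<close> by (metis oddE Suc_eq_plus1)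
qed

text \<open>Ensures that making \<open>g\<close> even in \<open>\<xi>\<close> leaves the double
  integral unchanged.\<close>

lemma biv_moment_odd: "odd m \<Longrightarrow> biv_moment m = 0"
  unfolding biv_moment_def
proof (rule sum.neutral, safe)
  fix l assume "odd m" "l \<le> m"
  then have "odd l \<or> odd (m - l)" by auto
  then have "Mb l = 0 \<or> Ma (m - l) = 0"
    using odd_moments[OF ab(1) Ma] odd_moments[OF ab(2) Mb] by blast
  then show "real (m choose l) * (A ^ l * Mb l) * (B ^ (m - l) * Ma (m - l)) = 0" by auto
qed

end

subsection \<open>A product over a regular polygon\<close>

lemma prod_roots_of_unity:
  fixes z :: complex
  assumes "k > 0"
  shows "(\<Prod>l<k. z - cis (2 * pi * real l / real k)) = z ^ k - 1"
proof -
  let ?f = "\<lambda>l. cis (2 * pi * real l / real k)"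
  have bij: "bij_betw ?f {..<k} {z. z ^ k = 1}" using assms by (rule Complex.bij_betw_roots_unity)
  define p where "p = (\<Prod>l<k. [:- ?f l, 1:])"
  have p1: "p = (\<Prod>x\<in>{z. z ^ k = 1}. [:- x, 1:])"
    unfolding p_def by (rule prod.reindex_bij_betw[OF bij])
  have deg: "degree p = k" unfolding p_def by (simp add: degree_prod_sum_eq)
  have lc: "lead_coeff p = 1" unfolding p_def by (simp add: lead_coeff_prod)
  have "p = monom 1 k - 1"
  proof (rule poly_eqI_degree_lead_coeff[where A = "{z. z ^ k = 1}" and n = k])
    show "card {z::complex. z ^ k = 1} \<ge> k" using bij_betw_same_card[OF bij] by simp
    show "poly p x = poly (monom 1 k - 1) x" if "x \<in> {z. z ^ k = 1}" for x
    proof -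
      have "poly p x = 0" unfolding p1 poly_prod
        using that bij_betw_finite[OF bij] by (intro prod_zero) auto
      then show ?thesis using that by (simp add: poly_monom)
    qed
    show "degree p \<le> k" "coeff p k = coeff (monom 1 k - 1) k"
      using deg lc assms by (auto simp: coeff_1)
    show "degree (monom 1 k - 1 :: complex poly) \<le> k"
      by (intro degree_diff_le) (auto simp: degree_monom_le)
  qed
  then have "poly p z = z ^ k - 1" by (simp add: poly_monom)
  then show ?thesis by (simp add: p_def poly_prod)
qed

lemma prod_one_minus_cis:
  fixes u :: complex
  assumes "k > 0"
  shows "(\<Prod>l<k. 1 - u * cis (2 * pi * real l / real k)) = 1 - u ^ k"
proof (cases "u = 0")
  case True then show ?thesis using assms by simp
next
  case False
  have r: "(\<Prod>l<k. 1 / u - cis (2 * pi * real l / real k)) = (1 / u) ^ k - 1"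
    using assms by (rule prod_roots_of_unity)
  have "(\<Prod>l<k. 1 - u * cis (2 * pi * real l / real k)) = (\<Prod>l<k. u * (1 / u - cis (2 * pi * real l / real k)))"
    using False by (intro prod.cong) (auto simp: algebra_simps)
  also have "\<dots> = u ^ k * ((1 / u) ^ k - 1)" by (simp only: prod.distrib r) simp
  also have "\<dots> = 1 - u ^ k" using False by (simp add: algebra_simps power_one_over)
  finally show ?thesis .
qed

text \<open>For \<open>x = 2 y / (1 + y^2)\<close> each factor \<open>1 - x cos t\<close> is the
  squared norm of \<open>1 - y cis t\<close> over \<open>1 + y^2\<close>, and the product over the
  polygon is the factorization of \<open>1 - u ^ k\<close>.\<close>

lemma prod_cos_polygon_aux:
  fixes y \<theta> :: real
  assumes "k > 0"
  shows "(\<Prod>l<k. 1 - 2 * y / (1 + y\<^sup>2) * cos (\<theta> + 2 * pi * real l / real k))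
    = (1 - 2 * y ^ k * cos (real k * \<theta>) + y ^ (2 * k)) / (1 + y\<^sup>2) ^ k"
proof -
  have nz: "1 + y\<^sup>2 > 0" by (simp add: add_pos_nonneg)
  have nrm: "(norm (1 - of_real s * cis t))\<^sup>2 = 1 - 2 * s * cos t + s\<^sup>2" for s t :: real
  proof -
    have "s\<^sup>2 = (s * cos t)\<^sup>2 + (s * sin t)\<^sup>2"
      by (simp add: power_mult_distrib flip: distrib_left)
    then show ?thesis unfolding cmod_power2 by (simp add: power2_eq_square algebra_simps)
  qed
  have "(\<Prod>l<k. 1 - 2 * y / (1 + y\<^sup>2) * cos (\<theta> + 2 * pi * real l / real k))
     = (\<Prod>l<k. (norm (1 - of_real y * cis \<theta> * cis (2 * pi * real l / real k)))\<^sup>2 / (1 + y\<^sup>2))"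
  proof (rule prod.cong)
    fix l
    have "of_real y * cis \<theta> * cis (2 * pi * real l / real k) = of_real y * cis (\<theta> + 2 * pi * real l / real k)"
      by (simp only: mult.assoc cis_mult)
    then show "1 - 2 * y / (1 + y\<^sup>2) * cos (\<theta> + 2 * pi * real l / real k)
      = (norm (1 - of_real y * cis \<theta> * cis (2 * pi * real l / real k)))\<^sup>2 / (1 + y\<^sup>2)"
      using nz by (simp only: nrm) (simp add: diff_divide_distrib add_divide_distrib[symmetric], simp add: field_simps)
  qed simp
  also have "\<dots> = (norm (\<Prod>l<k. 1 - of_real y * cis \<theta> * cis (2 * pi * real l / real k)))\<^sup>2 / (1 + y\<^sup>2) ^ k"
    by (simp add: prod_dividef prod_norm[symmetric] prod_power_distrib)
  also have "(\<Prod>l<k. 1 - of_real y * cis \<theta> * cis (2 * pi * real l / real k)) = 1 - of_real (y ^ k) * cis (real k * \<theta>)"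
    unfolding prod_one_minus_cis[OF assms] by (simp add: power_mult_distrib Complex.DeMoivre)
  also have "(norm \<dots>)\<^sup>2 = 1 - 2 * y ^ k * cos (real k * \<theta>) + y ^ (2 * k)"
    unfolding nrm by (simp add: power_mult mult.commute)
  finally show ?thesis .
qed

text \<open>Under this substitution \<open>(x / 2) ^ k = y ^ k / (1 + y^2) ^ k\<close>, so the added
  term cancels all dependence on \<open>\<theta>\<close>. Both sides are polynomials in
  \<open>x\<close>, so the interval \<open>0 < x < 1\<close> suffices.\<close>

lemma prod_cos_polygon:
  fixes x \<theta> :: real
  assumes k: "k > 0"
  shows "(\<Prod>l<k. 1 - x * cos (\<theta> + 2 * pi * real l / real k)) + 2 * (x / 2) ^ k * cos (real k * \<theta>)
    = (\<Prod>l<k. 1 - x * cos (2 * pi * real l / real k)) + 2 * (x / 2) ^ k"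
proof -
  define p where "p t = (\<Prod>l<k. [:1, - cos (t + 2 * pi * real l / real k):])
     + monom (2 * (1 / 2) ^ k * cos (real k * t)) k" for t
  have p: "poly (p t) x = (\<Prod>l<k. 1 - x * cos (t + 2 * pi * real l / real k)) + 2 * (x / 2) ^ k * cos (real k * t)" for t x
    by (simp add: p_def poly_prod poly_monom power_divide)
  have "p \<theta> = p 0"
  proof -
    have "poly (p \<theta>) x = poly (p 0) x" if x: "x \<in> {0<..<1}" for x
    proof -
    define s where "s = sqrt (1 - x\<^sup>2)"
    \<comment> \<open>The smaller root of \<open>x (1 + y^2) = 2 y\<close>.\<close>
    define y where "y = (1 - s) / x"
    have x2: "0 < x\<^sup>2" "x\<^sup>2 < 1" using x by (auto simp: power_less_one_iff)
    have s: "s\<^sup>2 = 1 - x\<^sup>2" "s < 1" using x2 by (auto simp: s_def)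
    have "1 + y\<^sup>2 = 2 * (1 - s) / x\<^sup>2"
      using x s(1) by (simp add: y_def field_simps power2_eq_square)
    then have xy: "x = 2 * y / (1 + y\<^sup>2)"
      using x s(2) by (simp add: y_def field_simps power2_eq_square)
    have nz: "1 + y\<^sup>2 > 0" by (simp add: add_pos_nonneg)
    have "x / 2 = y / (1 + y\<^sup>2)" unfolding xy using nz by (simp add: field_simps)
    then have half: "(x / 2) ^ k = y ^ k / (1 + y\<^sup>2) ^ k" by (simp only: power_divide)
    have "poly (p t) x = (1 + y ^ (2 * k)) / (1 + y\<^sup>2) ^ k" for t
      unfolding p half unfolding xy prod_cos_polygon_aux[OF k]
      by (simp add: add_divide_distrib diff_divide_distrib mult.assoc)
    then show ?thesis by simp
    qed
    then have "{0<..<1} \<subseteq> {x. poly (p \<theta> - p 0) x = 0}" by auto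
    moreover have "infinite {0<..<1::real}" by (simp add: infinite_Ioo)
    ultimately have "infinite {x. poly (p \<theta> - p 0) x = 0}" using finite_subset by blast
    then have "p \<theta> - p 0 = 0" using poly_roots_finite by blast
    then show ?thesis by simp
  qed
  then have "poly (p \<theta>) x = poly (p 0) x" by simp
  then show ?thesis unfolding p by simp
qed

text \<open>The polygon product at angle 0, with \<open>qfps\<close> added back to strip it of its
  angular part.\<close>

definition Pfps :: "nat \<Rightarrow> real \<Rightarrow> real fps" where
  "Pfps k r = (\<Prod>l<k. 1 - fps_const (r * cos (2 * pi * real l / real k)) * fps_X) + fps_const (2 * (r / 2) ^ k) * fps_X ^ k"

definition qfps :: "nat \<Rightarrow> real \<Rightarrow> real fps" where
  "qfps k r = fps_const (2 * (r / 2) ^ k) * fps_X ^ k"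

lemma prod_cos_fps:
  assumes "k > 0"
  shows "(\<Prod>l<k. 1 - fps_const (r * cos (\<theta> + 2 * pi * real l / real k)) * fps_X) = Pfps k r - fps_const (cos (real k * \<theta>)) * qfps k r"
proof -
  define p where "p t = (\<Prod>l<k. [:1, - r * cos (t + 2 * pi * real l / real k):])
     + monom (2 * (r / 2) ^ k * cos (real k * t)) k" for t
  have pp: "poly (p t) x = (\<Prod>l<k. 1 - (r * x) * cos (t + 2 * pi * real l / real k)) + 2 * (r * x / 2) ^ k * cos (real k * t)" for t x
    by (simp add: p_def poly_prod poly_monom power_divide power_mult_distrib mult_ac)
  have "poly (p \<theta>) = poly (p 0)"
    by (rule ext) (use prod_cos_polygon[OF assms] in \<open>simp add: pp\<close>)
  then have "p \<theta> = p 0" by (simp only: poly_eq_poly_eq_iff)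
  moreover have "fps_of_poly (p t) = (\<Prod>l<k. 1 - fps_const (r * cos (t + 2 * pi * real l / real k)) * fps_X)
      + fps_const (cos (real k * t)) * qfps k r" for t
  proof -
    have "fps_of_poly [:1, - r * u:] = 1 - fps_const (r * u) * fps_X" for u
      unfolding fps_of_poly_linear' by (rule fps_ext) simp
    moreover have "fps_of_poly (monom (2 * (r / 2) ^ k * cos (real k * t)) k) = fps_const (cos (real k * t)) * qfps k r"
      unfolding fps_of_poly_monom qfps_def by (rule fps_ext) simp
    ultimately show ?thesis by (simp only: p_def fps_of_poly_add fps_of_poly_prod)
  qed
  ultimately have "(\<Prod>l<k. 1 - fps_const (r * cos (\<theta> + 2 * pi * real l / real k)) * fps_X)
      + fps_const (cos (real k * \<theta>)) * qfps k r
     = (\<Prod>l<k. 1 - fps_const (r * cos (0 + 2 * pi * real l / real k)) * fps_X)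
      + fps_const (cos (real k * 0)) * qfps k r" by metis
  also have "\<dots> = Pfps k r" by (simp add: Pfps_def qfps_def)
  finally show ?thesis by (simp only: eq_diff_eq)
qed

lemma fps_nth_prod_0: "fps_nth (\<Prod>i\<in>I. f i) 0 = (\<Prod>i\<in>I. fps_nth (f i) 0)"
  by (induction I rule: infinite_finite_induct) auto

lemma pullback_Pfps:
  assumes "k > 0"
  shows "pullback k c (Pfps k r) (qfps k r) (fps_binomial (- c) oo (Pfps k r - 1)) (qfps k r * inverse (Pfps k r))"
proof
  show P0: "fps_nth (Pfps k r) 0 = 1"
    using assms by (simp add: Pfps_def fps_nth_prod_0 power_0_left)
  show "fps_nth (qfps k r * inverse (Pfps k r)) 0 = 0" using assms by (simp add: qfps_def)
  have "inverse (Pfps k r) * Pfps k r = 1" using P0 by (intro inverse_mult_eq_1) simp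
  then show "Pfps k r * (qfps k r * inverse (Pfps k r)) = qfps k r"
    by (simp only: mult.left_commute[of "Pfps k r"] mult.commute[of "Pfps k r"]) simp
  show "fps_X * fps_deriv (qfps k r) = of_nat k * qfps k r"
  proof -
    obtain m where k: "k = Suc m" using assms by (cases k) auto
    have "fps_deriv (fps_X ^ k :: real fps) = of_nat k * fps_X ^ m"
      unfolding k by (simp add: fps_deriv_power' del: power_Suc)
    then have d: "fps_X * fps_deriv (fps_X ^ k :: real fps) = of_nat k * fps_X ^ k"
      unfolding k by (simp only: power_Suc mult_ac)
    have "fps_X * fps_deriv (qfps k r) = fps_const (2 * (r / 2) ^ k) * (fps_X * fps_deriv (fps_X ^ k))"
      unfolding qfps_def by (simp only: fps_deriv_mult_const_left mult.left_commute)
    then show ?thesis unfolding d qfps_def by (simp only: mult.left_commute)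
  qed
  show "is_fps_powr (- c) (Pfps k r) (fps_binomial (- c) oo (Pfps k r - 1))"
    using P0 by (rule is_fps_powr_exists)
qed

subsection \<open>Dirichlet integrals\<close>

lemma nn_integral_Beta_Ioo:
  assumes p: "p > 0" and q: "q > (0::real)"
  shows "(\<integral>\<^sup>+t. ennreal (indicator {0<..<1} t * (t powr (p - 1) * (1 - t) powr (q - 1))) \<partial>lborel) = ennreal (Beta p q)"
proof (rule nn_integral_has_integral_lborel)
  have "((\<lambda>t. t powr (p - 1) * (1 - t) powr (q - 1)) has_integral Beta p q) {0<..<1}"
    using has_integral_Beta_real[OF p q] by (simp add: has_integral_Icc_iff_Ioo)
  then have "((\<lambda>t. if t \<in> {0<..<1} then t powr (p - 1) * (1 - t) powr (q - 1) else 0) has_integral Beta p q) UNIV"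
    by (simp only: has_integral_restrict_UNIV)
  moreover have "(\<lambda>t. if t \<in> {0<..<1} then t powr (p - 1) * (1 - t) powr (q - 1) else 0)
      = (\<lambda>t. indicator {0<..<1} t * (t powr (p - 1) * (1 - t) powr (q - 1)))"
    by (auto simp: fun_eq_iff indicator_def)
  ultimately show "((\<lambda>t. indicator {0<..<1} t * (t powr (p - 1) * (1 - t) powr (q - 1))) has_integral Beta p q) UNIV"
    by simp
qed auto

lemma Beta_nonneg: "p > 0 \<Longrightarrow> q > 0 \<Longrightarrow> Beta p (q::real) \<ge> 0"
  unfolding Beta_def by (intro divide_nonneg_nonneg mult_nonneg_nonneg less_imp_le Gamma_real_pos) auto

lemma nn_integral_Beta_scaled:
  assumes p: "p > 0" and q: "q > (0::real)" and R: "R > 0"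
  shows "(\<integral>\<^sup>+t. ennreal (indicator {0<..<R} t * (t powr (p - 1) * (R - t) powr (q - 1))) \<partial>lborel)
    = ennreal (R powr (p + q - 1) * Beta p q)"
proof -
  have "(\<integral>\<^sup>+t. ennreal (indicator {0<..<R} t * (t powr (p - 1) * (R - t) powr (q - 1))) \<partial>lborel)
     = ennreal R * (\<integral>\<^sup>+t. ennreal (indicator {0<..<R} (0 + R * t) * ((0 + R * t) powr (p - 1) * (R - (0 + R * t)) powr (q - 1))) \<partial>lborel)"
    using R by (subst nn_integral_real_affine[of _ R 0]) auto
  also have "(\<integral>\<^sup>+t. ennreal (indicator {0<..<R} (0 + R * t) * ((0 + R * t) powr (p - 1) * (R - (0 + R * t)) powr (q - 1))) \<partial>lborel)
     = (\<integral>\<^sup>+t. ennreal (R powr (p + q - 2)) * ennreal (indicator {0<..<1} t * (t powr (p - 1) * (1 - t) powr (q - 1))) \<partial>lborel)"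
  proof (rule nn_integral_cong)
    fix t :: real
    show "ennreal (indicator {0<..<R} (0 + R * t) * ((0 + R * t) powr (p - 1) * (R - (0 + R * t)) powr (q - 1)))
       = ennreal (R powr (p + q - 2)) * ennreal (indicator {0<..<1} t * (t powr (p - 1) * (1 - t) powr (q - 1)))"
    proof (cases "0 < t \<and> t < 1")
      case True
      have "R - (0 + R * t) = R * (1 - t)" by (simp add: algebra_simps)
      moreover have "R powr (p - 1) * R powr (q - 1) = R powr (p + q - 2)"
        by (simp flip: powr_add)
      ultimately have "(0 + R * t) powr (p - 1) * (R - (0 + R * t)) powr (q - 1)
         = R powr (p + q - 2) * (t powr (p - 1) * (1 - t) powr (q - 1))"
        using True R by (simp add: powr_mult mult_ac)
      then show ?thesis using True R by (simp add: ennreal_mult')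
    next
      case False
      then have "R * t \<notin> {0<..<R}" using R by (auto simp: zero_less_mult_iff)
      then show ?thesis using False by auto
    qed
  qed
  also have "\<dots> = ennreal (R powr (p + q - 2)) * ennreal (Beta p q)"
    unfolding nn_integral_Beta_Ioo[OF p q, symmetric] by (rule nn_integral_cmult) simp
  also have "ennreal R * \<dots> = ennreal (R powr (p + q - 1) * Beta p q)"
  proof -
    have "R * R powr (p + q - 2) = R powr (p + q - 1)"
      using R powr_add[of R 1 "p + q - 2"] by (simp add: algebra_simps)
    moreover have "Beta p q \<ge> 0" using p q by (rule Beta_nonneg)
    ultimately show ?thesis using R by (simp add: ennreal_mult'[symmetric] mult.assoc[symmetric])
  qed
  finally show ?thesis .
qed

text \<open>Over an arbitrary index set, so that the induction on the set can adjoin one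
  coordinate.\<close>

definition std_simplex :: "nat set \<Rightarrow> (nat \<Rightarrow> real) set" where
  "std_simplex I = {t. (\<forall>i\<in>I. 0 < t i) \<and> (\<Sum>i\<in>I. t i) < 1}"

lemma measurable_std_simplex [measurable]:
  "finite I \<Longrightarrow> (\<lambda>t. indicator (std_simplex I) t :: real) \<in> borel_measurable (PiM I (\<lambda>_. lborel))"
proof -
  assume [simp]: "finite I"
  have comp: "(\<lambda>t. t i) \<in> borel_measurable (PiM I (\<lambda>_. lborel :: real measure))" if "i \<in> I" for i
    using measurable_component_singleton[OF that, of "\<lambda>_. lborel :: real measure"] by simp
  have s: "(\<lambda>t. \<Sum>i\<in>I. t i) \<in> borel_measurable (PiM I (\<lambda>_. lborel :: real measure))"
    by (intro borel_measurable_sum comp)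
  have "(\<lambda>t. (\<Prod>i\<in>I. indicator {0<..} (t i :: real)) * indicator {..<1} (\<Sum>i\<in>I. t i) :: real)
      \<in> borel_measurable (PiM I (\<lambda>_. lborel))"
  proof (intro borel_measurable_times borel_measurable_prod)
    have ind: "indicat_real A \<in> borel_measurable borel" if "A \<in> sets borel" for A :: "real set"
      using that by (rule borel_measurable_indicator)
    show "(\<lambda>t. indicat_real {..<1::real} (\<Sum>i\<in>I. t i)) \<in> borel_measurable (PiM I (\<lambda>_. lborel))"
      by (rule measurable_compose[OF s ind]) simp
    show "(\<lambda>t. indicat_real {0::real<..} (t i)) \<in> borel_measurable (PiM I (\<lambda>_. lborel))" if "i \<in> I" for i
      by (rule measurable_compose[OF comp[OF that] ind]) simp
  qed
  moreover have "(\<lambda>t. (\<Prod>i\<in>I. indicator {0<..} (t i :: real)) * indicator {..<1} (\<Sum>i\<in>I. t i) :: real)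
      = (\<lambda>t. indicator (std_simplex I) t)"
  proof
    fix t :: "nat \<Rightarrow> real"
    show "(\<Prod>i\<in>I. indicator {0<..} (t i)) * indicator {..<1} (\<Sum>i\<in>I. t i) = (indicator (std_simplex I) t :: real)"
    proof (cases "\<forall>i\<in>I. 0 < t i")
      case True then show ?thesis by (simp add: std_simplex_def indicator_def)
    next
      case False
      then have "(\<Prod>i\<in>I. indicator {0<..} (t i)) = (0::real)" by (intro prod_zero) (auto simp: indicator_def)
      then show ?thesis using False by (auto simp: std_simplex_def)
    qed
  qed
  ultimately show ?thesis by simp
qed

text \<open>Integrating out coordinate \<open>i\<close> over \<open>0 < y < R\<close>, where
  \<open>R\<close> is one minus the other coordinates, is a scaled Beta integral; it raises the
  parameter of the remaining slack from \<open>q\<close> to \<open>p i + q\<close>. Hence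
  \<open>q\<close> is general in the induction.\<close>

lemma dirichlet_nn_integral:
  fixes p :: "nat \<Rightarrow> real"
  assumes "finite I" "\<And>i. i \<in> I \<Longrightarrow> p i > 0" "q > 0"
  shows "(\<integral>\<^sup>+t. ennreal (indicator (std_simplex I) t * ((\<Prod>i\<in>I. t i powr (p i - 1)) * (1 - (\<Sum>i\<in>I. t i)) powr (q - 1)))
      \<partial>PiM I (\<lambda>_. lborel)) = ennreal ((\<Prod>i\<in>I. Gamma (p i)) * Gamma q / Gamma ((\<Sum>i\<in>I. p i) + q))"
  using assms
proof (induction I arbitrary: q rule: finite_induct)
  case empty
  interpret product_sigma_finite "\<lambda>_::nat. lborel :: real measure" ..
  have "Gamma q > 0" using empty by (simp add: Gamma_real_pos)
  then show ?case by (subst nn_integral_empty) (auto simp: std_simplex_def)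
next
  case (insert i I)
  interpret product_sigma_finite "\<lambda>_::nat. lborel :: real measure" ..
  have fin: "finite I" and i: "i \<notin> I" using insert by auto
  have pi: "p i > 0" using insert by simp
  let ?f = "\<lambda>J q t. indicator (std_simplex J) t * ((\<Prod>i\<in>J. t i powr (p i - 1)) * (1 - (\<Sum>i\<in>J. t i)) powr (q - 1)) :: real"
  have meas: "?f J q \<in> borel_measurable (PiM J (\<lambda>_. lborel))" if "finite J" for J q
    using that by measurable
  have "(\<integral>\<^sup>+t. ennreal (?f (insert i I) q t) \<partial>PiM (insert i I) (\<lambda>_. lborel))
     = (\<integral>\<^sup>+x. (\<integral>\<^sup>+y. ennreal (?f (insert i I) q (x(i := y))) \<partial>lborel) \<partial>PiM I (\<lambda>_. lborel))"
    using meas[of "insert i I" q] fin i by (intro product_nn_integral_insert) auto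
  also have "\<dots> = (\<integral>\<^sup>+x. ennreal (Beta (p i) q) * ennreal (?f I (p i + q) x) \<partial>PiM I (\<lambda>_. lborel))"
  proof (rule nn_integral_cong)
    fix x :: "nat \<Rightarrow> real"
    define R where "R = 1 - (\<Sum>j\<in>I. x j)"
    have sm: "(\<Sum>j\<in>insert i I. (x(i := y)) j) = y + (\<Sum>j\<in>I. x j)" for y
    proof -
      have "(\<Sum>j\<in>I. (x(i := y)) j) = (\<Sum>j\<in>I. x j)" using i by (intro sum.cong) auto
      then show ?thesis using fin i by simp
    qed
    have pr: "(\<Prod>j\<in>insert i I. (x(i := y)) j powr (p j - 1)) = y powr (p i - 1) * (\<Prod>j\<in>I. x j powr (p j - 1))" for y
    proof -
      have "(\<Prod>j\<in>I. (x(i := y)) j powr (p j - 1)) = (\<Prod>j\<in>I. x j powr (p j - 1))"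
        using i by (intro prod.cong) auto
      then show ?thesis using fin i by simp
    qed
    show "(\<integral>\<^sup>+y. ennreal (?f (insert i I) q (x(i := y))) \<partial>lborel) = ennreal (Beta (p i) q) * ennreal (?f I (p i + q) x)"
    proof (cases "x \<in> std_simplex I")
      case True
      then have R: "R > 0" by (simp add: std_simplex_def R_def)
      define c where "c = (\<Prod>j\<in>I. x j powr (p j - 1))"
      have c: "c \<ge> 0" by (simp add: c_def prod_nonneg)
      have "?f (insert i I) q (x(i := y)) = c * (indicator {0<..<R} y * (y powr (p i - 1) * (R - y) powr (q - 1)))" for y
      proof -
        have "x(i := y) \<in> std_simplex (insert i I) \<longleftrightarrow> y \<in> {0<..<R}"
          using True i unfolding std_simplex_def mem_Collect_eq sm R_def by auto
        moreover have e: "1 - (y + (\<Sum>j\<in>I. x j)) = R - y" by (simp add: R_def)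
        ultimately show ?thesis unfolding sm pr c_def[symmetric] e by (auto simp: indicator_def mult_ac)
      qed
      then have "(\<integral>\<^sup>+y. ennreal (?f (insert i I) q (x(i := y))) \<partial>lborel)
         = (\<integral>\<^sup>+y. ennreal c * ennreal (indicator {0<..<R} y * (y powr (p i - 1) * (R - y) powr (q - 1))) \<partial>lborel)"
        using c by (simp add: ennreal_mult')
      also have "\<dots> = ennreal c * ennreal (R powr (p i + q - 1) * Beta (p i) q)"
        unfolding nn_integral_Beta_scaled[OF pi insert.prems(2) R, symmetric] by (rule nn_integral_cmult) simp
      also have "\<dots> = ennreal (Beta (p i) q) * ennreal (?f I (p i + q) x)"
      proof -
        have "Beta (p i) q \<ge> 0" using pi insert.prems(2) by (rule Beta_nonneg)
        then show ?thesis
          using True c unfolding c_def[symmetric] R_def[symmetric]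
          by (simp add: ennreal_mult'[symmetric] mult_ac)
      qed
      finally show ?thesis .
    next
      case False
      have "x(i := y) \<notin> std_simplex (insert i I)" for y
      proof
        assume "x(i := y) \<in> std_simplex (insert i I)"
        then have h: "\<forall>j\<in>insert i I. 0 < (x(i := y)) j" "y + (\<Sum>j\<in>I. x j) < 1"
          unfolding std_simplex_def mem_Collect_eq sm by auto
        then have "\<forall>j\<in>I. 0 < x j" "0 < y" using i by (auto split: if_splits)
        then show False using False h(2) by (auto simp: std_simplex_def)
      qed
      then show ?thesis using False by simp
    qed
  qed
  also have "\<dots> = ennreal (Beta (p i) q) * (\<integral>\<^sup>+x. ennreal (?f I (p i + q) x) \<partial>PiM I (\<lambda>_. lborel))"
    using meas[OF fin] by (intro nn_integral_cmult) auto
  also have "(\<integral>\<^sup>+x. ennreal (?f I (p i + q) x) \<partial>PiM I (\<lambda>_. lborel))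
      = ennreal ((\<Prod>i\<in>I. Gamma (p i)) * Gamma (p i + q) / Gamma ((\<Sum>i\<in>I. p i) + (p i + q)))"
    using insert.prems add_pos_pos[OF pi insert.prems(2)] by (intro insert.IH) auto
  also have "ennreal (Beta (p i) q) * \<dots> = ennreal ((\<Prod>i\<in>insert i I. Gamma (p i)) * Gamma q / Gamma ((\<Sum>i\<in>insert i I. p i) + q))"
  proof -
    have B: "Beta (p i) q \<ge> 0" using pi insert.prems(2) by (rule Beta_nonneg)
    have "Gamma (p i + q) > 0" by (rule Gamma_real_pos[OF add_pos_pos[OF pi insert.prems(2)]])
    then show ?thesis using fin i
      unfolding ennreal_mult'[OF B, symmetric]
      by (simp add: Beta_def add_ac mult_ac)
  qed
  finally show ?case .
qed

section \<open>Moments of the Dirichlet density on the simplex\<close>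

definition simplex_wt :: "nat \<Rightarrow> real \<Rightarrow> (nat \<Rightarrow> real) \<Rightarrow> real" where
  "simplex_wt k c t = indicator (open_simplex k) t * (\<Prod>j<k. simplex_coord k t j powr (c - 1))"

abbreviation simplex_M :: "nat \<Rightarrow> (nat \<Rightarrow> real) measure" where
  "simplex_M k \<equiv> PiM {1..k-1} (\<lambda>_. lborel)"

lemma simplex_coord_pos: "t \<in> open_simplex k \<Longrightarrow> j < k \<Longrightarrow> 0 < simplex_coord k t j"
  by (auto simp: open_simplex_def simplex_coord_def)

lemma sum_simplex_coord:
  assumes "k > 0" shows "(\<Sum>j<k. simplex_coord k t j) = 1"
proof -
  have "{..<k} = insert 0 {1..k-1}" using assms by auto
  then show ?thesis by (simp add: simplex_coord_def)
qed

lemma simplex_wt_nonneg: "0 \<le> simplex_wt k c t"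
  by (simp add: simplex_wt_def prod_nonneg)

lemma measurable_simplex_coord [measurable]:
  assumes "j < k"
  shows "(\<lambda>t. simplex_coord k t j) \<in> borel_measurable (simplex_M k)"
proof (cases "j = 0")
  case True
  have "(\<lambda>t. 1 - (\<Sum>i\<in>{1..k-1}. t i)) \<in> borel_measurable (simplex_M k)" by measurable
  then show ?thesis using True by (simp add: simplex_coord_def)
next
  case False
  have "(\<lambda>t. t j) \<in> measurable (simplex_M k) lborel"
    by (rule measurable_component_singleton) (use False assms in auto)
  then show ?thesis using False by (simp add: simplex_coord_def)
qed

lemma measurable_open_simplex [measurable]: "open_simplex k \<in> sets (simplex_M k)"
  unfolding open_simplex_def by measurable

lemma measurable_simplex_wt [measurable]: "simplex_wt k c \<in> borel_measurable (simplex_M k)"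
proof -
  have "(\<lambda>t. \<Prod>j<k. simplex_coord k t j powr (c - 1)) \<in> borel_measurable (simplex_M k)"
    by (intro borel_measurable_prod powr_real_measurable measurable_simplex_coord) auto
  then show ?thesis unfolding simplex_wt_def by measurable
qed

lemma dirichlet_moment:
  fixes \<nu> :: "nat \<Rightarrow> nat"
  assumes k: "k > 0" and c: "c > 0"
  shows "has_bochner_integral (simplex_M k)
     (\<lambda>t. (\<Prod>j<k. simplex_coord k t j ^ \<nu> j) * simplex_wt k c t)
     ((\<Prod>j<k. Gamma (c + real (\<nu> j))) / Gamma (real k * c + real (\<Sum>j<k. \<nu> j)))"
proof (rule has_bochner_integral_nn_integral)
  have ins: "{..<k} = insert 0 {1..k-1}" using k by auto
  have "(\<lambda>t. \<Prod>j<k. simplex_coord k t j ^ \<nu> j) \<in> borel_measurable (simplex_M k)"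
    by (intro borel_measurable_prod borel_measurable_power measurable_simplex_coord) auto
  then show "(\<lambda>t. (\<Prod>j<k. simplex_coord k t j ^ \<nu> j) * simplex_wt k c t) \<in> borel_measurable (simplex_M k)"
    by measurable
  have nn: "0 \<le> (\<Prod>j<k. simplex_coord k t j ^ \<nu> j) * simplex_wt k c t" for t
  proof (cases "t \<in> open_simplex k")
    case True
    then show ?thesis using simplex_coord_pos[OF True]
      by (intro mult_nonneg_nonneg prod_nonneg simplex_wt_nonneg) (simp add: less_imp_le)
  qed (simp add: simplex_wt_def)
  then show "AE t in simplex_M k. 0 \<le> (\<Prod>j<k. simplex_coord k t j ^ \<nu> j) * simplex_wt k c t" by simp
  show "0 \<le> (\<Prod>j<k. Gamma (c + real (\<nu> j))) / Gamma (real k * c + real (\<Sum>j<k. \<nu> j))"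
  proof -
    have "real k * c + real (\<Sum>j<k. \<nu> j) > 0" using k c by (intro add_pos_nonneg of_nat_0_le_iff) auto
    moreover have "c + real (\<nu> j) > 0" for j using c by (intro add_pos_nonneg) auto
    ultimately show ?thesis by (intro divide_nonneg_nonneg prod_nonneg less_imp_le Gamma_real_pos)
  qed
  define p where "p j = c + real (\<nu> j)" for j
  have pp: "p j > 0" for j using c by (simp add: p_def add_pos_nonneg)
  have "(\<integral>\<^sup>+t. ennreal ((\<Prod>j<k. simplex_coord k t j ^ \<nu> j) * simplex_wt k c t) \<partial>simplex_M k)
     = (\<integral>\<^sup>+t. ennreal (indicator (std_simplex {1..k-1}) t * ((\<Prod>i\<in>{1..k-1}. t i powr (p i - 1))
         * (1 - (\<Sum>i\<in>{1..k-1}. t i)) powr (p 0 - 1))) \<partial>simplex_M k)"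
  proof (rule nn_integral_cong)
    fix t assume "t \<in> space (simplex_M k)"
    then have mem: "t \<in> open_simplex k \<longleftrightarrow> t \<in> std_simplex {1..k-1}"
      by (simp add: open_simplex_def std_simplex_def)
    show "ennreal ((\<Prod>j<k. simplex_coord k t j ^ \<nu> j) * simplex_wt k c t)
       = ennreal (indicator (std_simplex {1..k-1}) t * ((\<Prod>i\<in>{1..k-1}. t i powr (p i - 1))
         * (1 - (\<Sum>i\<in>{1..k-1}. t i)) powr (p 0 - 1)))"
    proof (cases "t \<in> open_simplex k")
      case True
      have "(\<Prod>j<k. simplex_coord k t j ^ \<nu> j) * simplex_wt k c t
         = (\<Prod>j<k. simplex_coord k t j ^ \<nu> j * simplex_coord k t j powr (c - 1))"
        using True by (simp add: simplex_wt_def prod.distrib)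
      also have "\<dots> = (\<Prod>j<k. simplex_coord k t j powr (p j - 1))"
      proof (rule prod.cong)
        fix j assume "j \<in> {..<k}"
        then have "simplex_coord k t j > 0" using simplex_coord_pos[OF True] by simp
        then have "simplex_coord k t j ^ \<nu> j * simplex_coord k t j powr (c - 1)
           = simplex_coord k t j powr (real (\<nu> j) + (c - 1))"
          by (simp add: powr_realpow[symmetric] powr_add[symmetric])
        also have "real (\<nu> j) + (c - 1) = p j - 1" by (simp add: p_def)
        finally show "simplex_coord k t j ^ \<nu> j * simplex_coord k t j powr (c - 1) = simplex_coord k t j powr (p j - 1)" .
      qed simp
      also have "\<dots> = (\<Prod>i\<in>{1..k-1}. t i powr (p i - 1)) * (1 - (\<Sum>i\<in>{1..k-1}. t i)) powr (p 0 - 1)"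
        unfolding ins by (simp add: simplex_coord_def mult.commute)
      finally show ?thesis using True mem by simp
    next
      case False then show ?thesis using mem by (simp add: simplex_wt_def)
    qed
  qed
  also have "\<dots> = ennreal ((\<Prod>i\<in>{1..k-1}. Gamma (p i)) * Gamma (p 0) / Gamma ((\<Sum>i\<in>{1..k-1}. p i) + p 0))"
    using pp by (intro dirichlet_nn_integral) auto
  also have "(\<Prod>i\<in>{1..k-1}. Gamma (p i)) * Gamma (p 0) = (\<Prod>j<k. Gamma (c + real (\<nu> j)))"
    unfolding ins by (simp add: p_def mult.commute)
  also have "(\<Sum>i\<in>{1..k-1}. p i) + p 0 = (\<Sum>j<k. p j)" unfolding ins by simp
  also have "(\<Sum>j<k. p j) = real k * c + real (\<Sum>j<k. \<nu> j)" by (simp add: p_def sum.distrib)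
  finally show "(\<integral>\<^sup>+t. ennreal ((\<Prod>j<k. simplex_coord k t j ^ \<nu> j) * simplex_wt k c t) \<partial>simplex_M k)
    = ennreal ((\<Prod>j<k. Gamma (c + real (\<nu> j))) / Gamma (real k * c + real (\<Sum>j<k. \<nu> j)))" .
qed

lemma fps_exp_sum: "finite I \<Longrightarrow> fps_exp (\<Sum>i\<in>I. f i :: real) = (\<Prod>i\<in>I. fps_exp (f i))"
  by (induction I rule: finite_induct) (auto simp: fps_exp_add_mult)

text \<open>Expand the power by the multinomial theorem, read off from the exponential of a sum. The
  Gamma quotients of each monomial are the Pochhammer symbols in the coefficients of
  \<open>geom_fps\<close>, so the terms reassemble into the product.\<close>

lemma dirichlet_linear_form_moment:
  fixes x :: "nat \<Rightarrow> real"
  assumes k: "k > 0" and c: "c > 0"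
  shows "has_bochner_integral (simplex_M k)
     (\<lambda>t. (\<Sum>j<k. x j * simplex_coord k t j) ^ n / fact n * simplex_wt k c t)
     (Gamma c ^ k / Gamma (real k * c) * (fps_nth (\<Prod>j<k. geom_fps c (x j)) n / pochhammer (real k * c) n))"
proof -
  let ?X = "multisets_of_size {..<k} n"
  have "has_bochner_integral (simplex_M k)
     (\<lambda>t. \<Sum>X\<in>?X. (\<Prod>j<k. x j ^ count X j / fact (count X j))
        * ((\<Prod>j<k. simplex_coord k t j ^ count X j) * simplex_wt k c t))
     (\<Sum>X\<in>?X. (\<Prod>j<k. x j ^ count X j / fact (count X j))
        * ((\<Prod>j<k. Gamma (c + real (count X j))) / Gamma (real k * c + real (\<Sum>j<k. count X j))))"
    by (intro has_bochner_integral_sum has_bochner_integral_mult_right dirichlet_moment k c)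
  moreover have "(\<Sum>X\<in>?X. (\<Prod>j<k. x j ^ count X j / fact (count X j))
        * ((\<Prod>j<k. simplex_coord k t j ^ count X j) * simplex_wt k c t))
     = (\<Sum>j<k. x j * simplex_coord k t j) ^ n / fact n * simplex_wt k c t" for t
  proof -
    have "(\<Sum>j<k. x j * simplex_coord k t j) ^ n / fact n = fps_nth (fps_exp (\<Sum>j<k. x j * simplex_coord k t j)) n"
      by simp
    also have "\<dots> = (\<Sum>X\<in>?X. \<Prod>j<k. (x j * simplex_coord k t j) ^ count X j / fact (count X j))"
      by (simp add: fps_exp_sum fps_prod_nth')
    also have "\<dots> = (\<Sum>X\<in>?X. (\<Prod>j<k. x j ^ count X j / fact (count X j)) * (\<Prod>j<k. simplex_coord k t j ^ count X j))"
      by (simp add: power_mult_distrib prod.distrib[symmetric])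
    finally show ?thesis by (simp add: sum_distrib_right mult.assoc)
  qed
  moreover have "(\<Sum>X\<in>?X. (\<Prod>j<k. x j ^ count X j / fact (count X j))
        * ((\<Prod>j<k. Gamma (c + real (count X j))) / Gamma (real k * c + real (\<Sum>j<k. count X j))))
     = Gamma c ^ k / Gamma (real k * c) * (fps_nth (\<Prod>j<k. geom_fps c (x j)) n / pochhammer (real k * c) n)"
  proof -
    have Gm: "Gamma (d + real m) = pochhammer d m * Gamma d" if "d > 0" for d m
    proof -
      have "d \<notin> \<int>\<^sub>\<le>\<^sub>0" using that by (auto simp: nonpos_Ints_def)
      moreover have "Gamma d \<noteq> 0" using Gamma_real_pos[OF that] by simp
      ultimately show ?thesis by (simp add: pochhammer_Gamma)
    qed
    have kc: "real k * c > 0" using k c by simp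
    have "(\<Prod>j<k. x j ^ count X j / fact (count X j))
        * ((\<Prod>j<k. Gamma (c + real (count X j))) / Gamma (real k * c + real (\<Sum>j<k. count X j)))
      = Gamma c ^ k / Gamma (real k * c) * ((\<Prod>j<k. fps_nth (geom_fps c (x j)) (count X j)) / pochhammer (real k * c) n)"
      if X: "X \<in> ?X" for X
    proof -
      have "size X = (\<Sum>j<k. count X j)"
        using X unfolding size_multiset_overloaded_eq
        by (intro sum.mono_neutral_left) (auto simp: multisets_of_size_def not_in_iff)
      then have n: "(\<Sum>j<k. count X j) = n" using X by (simp add: multisets_of_size_def)
      have "(\<Prod>j<k. Gamma (c + real (count X j))) = (\<Prod>j<k. pochhammer c (count X j)) * Gamma c ^ k"
        using c by (simp add: Gm prod.distrib)
      moreover have "(\<Prod>j<k. fps_nth (geom_fps c (x j)) (count X j))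
         = (\<Prod>j<k. x j ^ count X j / fact (count X j)) * (\<Prod>j<k. pochhammer c (count X j))"
        by (simp add: geom_fps_def prod.distrib[symmetric] mult_ac)
      ultimately show ?thesis unfolding n Gm[OF kc] by (simp add: mult_ac)
    qed
    then show ?thesis
      by (simp add: fps_prod_nth' sum_distrib_left sum_divide_distrib)
  qed
  ultimately show ?thesis by simp
qed

text \<open>On the simplex the exponent is a convex combination of the \<open>x j\<close>, so its
  absolute value is at most \<open>r\<close>; this dominates the exchange of series and integral.
  The first conclusion is the matching moment bound, reused for the coefficients of
  \<open>g\<close>.\<close>

lemma dirichlet_exp_sums:
  fixes x :: "nat \<Rightarrow> real"
  assumes k: "k > 0" and c: "c > 0" and x: "\<And>j. j < k \<Longrightarrow> \<bar>x j\<bar> \<le> r"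
  shows "\<bar>fps_nth (\<Prod>j<k. geom_fps c (x j)) n / pochhammer (real k * c) n\<bar> \<le> r ^ n / fact n" (is ?A)
    and "integrable (simplex_M k) (\<lambda>t. exp (\<Sum>j<k. x j * simplex_coord k t j) * simplex_wt k c t)" (is ?B)
    and "(\<lambda>n. fps_nth (\<Prod>j<k. geom_fps c (x j)) n / pochhammer (real k * c) n) sums
      (Gamma (real k * c) / Gamma c ^ k *
       (\<integral>t. exp (\<Sum>j<k. x j * simplex_coord k t j) * simplex_wt k c t \<partial>simplex_M k))" (is ?C)
proof -
  let ?M = "simplex_M k"
  define Y where "Y t = (\<Sum>j<k. x j * simplex_coord k t j)" for t
  define W where "W = simplex_wt k c"
  define C where "C = Gamma c ^ k / Gamma (real k * c)"
  define A where "A n = fps_nth (\<Prod>j<k. geom_fps c (x j)) n / pochhammer (real k * c) n" for n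
  have C: "C > 0" using k c by (simp add: C_def Gamma_real_pos)
  have Cinv: "Gamma (real k * c) / Gamma c ^ k = 1 / C" by (simp add: C_def)
  have I: "has_bochner_integral ?M (\<lambda>t. Y t ^ n / fact n * W t) (C * A n)" for n
    unfolding Y_def W_def C_def A_def by (rule dirichlet_linear_form_moment[OF k c])
  have "has_bochner_integral ?M W (C * fps_nth (\<Prod>j<k. geom_fps c 0) 0)"
    using dirichlet_linear_form_moment[OF k c, of "\<lambda>_. 0" 0] by (simp add: W_def C_def)
  then have IW: "has_bochner_integral ?M W C"
    by (simp add: fps_power_zeroth geom_fps_def)
  have r: "r \<ge> 0" using x[OF k] abs_ge_zero order_trans by blast
  have Yn: "\<bar>Y t ^ n / fact n * W t\<bar> \<le> r ^ n / fact n * W t" for t n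
  proof -
    have *: "\<bar>Y t\<bar> \<le> r" if "t \<in> open_simplex k"
    proof -
      have "\<bar>Y t\<bar> \<le> (\<Sum>j<k. \<bar>x j * simplex_coord k t j\<bar>)" unfolding Y_def by (rule sum_abs)
      also have "\<dots> \<le> (\<Sum>j<k. r * simplex_coord k t j)"
        using simplex_coord_pos[OF that] x by (intro sum_mono) (auto simp: abs_mult abs_of_pos intro!: mult_right_mono less_imp_le)
      also have "\<dots> = r" by (simp add: sum_distrib_left[symmetric] sum_simplex_coord[OF k])
      finally show ?thesis .
    qed
    have W0: "W t = 0" if "t \<notin> open_simplex k" using that by (simp add: W_def simplex_wt_def)
    have Wn: "W t \<ge> 0" by (simp add: W_def simplex_wt_nonneg)
    show "\<bar>Y t ^ n / fact n * W t\<bar> \<le> r ^ n / fact n * W t"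
    proof (cases "t \<in> open_simplex k")
      case True
      have "\<bar>Y t\<bar> ^ n \<le> r ^ n" using *[OF True] by (intro power_mono) auto
      then show ?thesis using Wn by (simp add: abs_mult power_abs divide_right_mono mult_right_mono)
    qed (use W0 in simp)
  qed
  have le: "(\<integral>t. norm (Y t ^ n / fact n * W t) \<partial>?M) \<le> r ^ n / fact n * C" for n
  proof -
    have "(\<integral>t. norm (Y t ^ n / fact n * W t) \<partial>?M) \<le> (\<integral>t. r ^ n / fact n * W t \<partial>?M)"
    proof (rule integral_mono)
      show "integrable ?M (\<lambda>t. norm (Y t ^ n / fact n * W t))"
        using I[of n] unfolding has_bochner_integral_iff by (intro integrable_norm) simp
      show "integrable ?M (\<lambda>t. r ^ n / fact n * W t)"
        using IW unfolding has_bochner_integral_iff by (intro integrable_mult_right) simp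
      show "norm (Y t ^ n / fact n * W t) \<le> r ^ n / fact n * W t" for t using Yn[of t n] by simp
    qed
    also have "\<dots> = r ^ n / fact n * C" using IW by (simp add: has_bochner_integral_iff)
    finally show ?thesis .
  qed
  have Ab: "\<bar>A n\<bar> \<le> r ^ n / fact n" for n
  proof -
    have "C * \<bar>A n\<bar> = norm (\<integral>t. Y t ^ n / fact n * W t \<partial>?M)"
      using I[of n] C by (simp add: has_bochner_integral_iff abs_mult)
    also have "\<dots> \<le> r ^ n / fact n * C" by (rule order_trans[OF integral_norm_bound le])
    finally have "C * \<bar>A n\<bar> \<le> C * (r ^ n / fact n)" by (simp only: mult.commute)
    then show ?thesis using C by (simp only: mult_le_cancel_left_pos)
  qed
  show ?A using Ab[of n] by (simp add: A_def)
  have es: "(\<lambda>n. Y t ^ n / fact n * W t) sums (exp (Y t) * W t)" for t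
    using sums_mult2[OF exp_converges[of "Y t"], of "W t"] by (simp add: field_simps)
  have sm: "summable (\<lambda>n. r ^ n / fact n)"
    using summable_exp[of r] by (simp add: field_simps)
  have conds: "\<And>n. integrable ?M (\<lambda>t. Y t ^ n / fact n * W t)"
    "AE t in ?M. summable (\<lambda>n. norm (Y t ^ n / fact n * W t))"
    "summable (\<lambda>n. \<integral>t. norm (Y t ^ n / fact n * W t) \<partial>?M)"
  proof -
    show "integrable ?M (\<lambda>t. Y t ^ n / fact n * W t)" for n using I by (simp add: has_bochner_integral_iff)
    have "summable (\<lambda>n. norm (Y t ^ n / fact n * W t))" for t
      using Yn by (intro summable_comparison_test'[OF summable_mult2[OF sm, of "W t"], of 0]) auto
    then show "AE t in ?M. summable (\<lambda>n. norm (Y t ^ n / fact n * W t))" by simp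
    show "summable (\<lambda>n. \<integral>t. norm (Y t ^ n / fact n * W t) \<partial>?M)"
      using le by (intro summable_comparison_test'[OF summable_mult2[OF sm, of C], of 0]) (auto simp: integral_nonneg)
  qed
  have se: "(\<Sum>n. Y t ^ n / fact n * W t) = exp (Y t) * W t" for t
    using es by (simp add: sums_iff)
  show ?B using integrable_suminf[OF conds] unfolding se by (simp add: Y_def W_def)
  have "(\<lambda>n. C * A n) sums (\<integral>t. exp (Y t) * W t \<partial>?M)"
    using sums_integral[OF conds] I unfolding se by (simp add: has_bochner_integral_iff)
  from sums_mult[OF this, of "1 / C"] show ?C
    unfolding Cinv using C by (simp add: A_def Y_def W_def)
qed

subsection \<open>Moments of the symmetric beta measure\<close>

definition nu_density :: "real \<Rightarrow> real \<Rightarrow> real" where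
  "nu_density a u = indicator {-1..1} u * (Gamma (a + 1/2) / (sqrt pi * Gamma a)) * (1 - u\<^sup>2) powr (a - 1)"

lemma nu_measure_eq: "nu_measure a = density lborel (\<lambda>u. ennreal (nu_density a u))"
  by (simp add: nu_measure_def nu_density_def)

lemma nu_density_measurable [measurable]: "nu_density a \<in> borel_measurable borel"
  unfolding nu_density_def by measurable

lemma nu_density_nonneg: "a > 0 \<Longrightarrow> 0 \<le> nu_density a u"
  using Gamma_real_pos[of a] Gamma_real_pos[of "a + 1/2"] by (simp add: nu_density_def)

lemma sets_nu_measure [measurable_cong, simp]: "sets (nu_measure a) = sets borel"
  by (simp add: nu_measure_eq)

lemma space_nu_measure [simp]: "space (nu_measure a) = UNIV"
  by (simp add: nu_measure_eq)

lemma Gamma_duplication_real: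
  assumes "a > (0::real)"
  shows "Gamma a * Gamma (a + 1/2) = 2 powr (1 - 2 * a) * sqrt pi * Gamma (2 * a)"
proof -
  have nn: "complex_of_real x \<notin> \<int>\<^sub>\<le>\<^sub>0" if "x > 0" for x
    using that by (auto simp: nonpos_Ints_def complex_eq_iff)
  have "Gamma (complex_of_real a) * Gamma (complex_of_real a + 1/2) =
     exp ((1 - 2 * complex_of_real a) * of_real (ln 2)) * of_real (sqrt pi) * Gamma (2 * complex_of_real a)"
    using nn[of a] nn[of "a + 1/2"] assms by (intro Gamma_legendre_duplication) auto
  also have "Gamma (complex_of_real a + 1/2) = of_real (Gamma (a + 1/2))"
    using Gamma_complex_of_real[of "a + 1/2"] by simp
  also have "Gamma (2 * complex_of_real a) = of_real (Gamma (2 * a))"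
    using Gamma_complex_of_real[of "2 * a"] by simp
  also have "exp ((1 - 2 * complex_of_real a) * of_real (ln 2)) = of_real (2 powr (1 - 2 * a))"
    by (simp add: powr_def flip: exp_of_real)
  finally have "complex_of_real (Gamma a * Gamma (a + 1/2)) = of_real (2 powr (1 - 2 * a) * sqrt pi * Gamma (2 * a))"
    by (simp add: Gamma_complex_of_real)
  then show ?thesis by (simp only: of_real_eq_iff)
qed

text \<open>The substitution \<open>u = 2 s - 1\<close> leads to \<open>Beta a a\<close>, which the
  duplication formula evaluates.\<close>

lemma emeasure_nu_measure:
  assumes a: "a > 0"
  shows "emeasure (nu_measure a) UNIV = 1"
proof -
  define C where "C = Gamma (a + 1/2) / (sqrt pi * Gamma a)"
  have G: "Gamma a > 0" "Gamma (a + 1/2) > 0" "Gamma (2 * a) > 0" using a by (auto intro!: Gamma_real_pos)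
  have C: "C > 0" using G by (simp add: C_def)
  have "emeasure (nu_measure a) UNIV = (\<integral>\<^sup>+u. ennreal (nu_density a u) \<partial>lborel)"
    by (simp add: nu_measure_eq emeasure_density)
  also have "\<dots> = 2 * (\<integral>\<^sup>+s. ennreal (nu_density a (- 1 + 2 * s)) \<partial>lborel)"
    by (subst nn_integral_real_affine[of _ 2 "-1"]) auto
  also have "(\<integral>\<^sup>+s. ennreal (nu_density a (- 1 + 2 * s)) \<partial>lborel)
     = (\<integral>\<^sup>+s. ennreal (C * 4 powr (a - 1)) * ennreal (indicator {0<..<1} s * (s powr (a - 1) * (1 - s) powr (a - 1))) \<partial>lborel)"
  proof (rule nn_integral_cong)
    fix s :: real
    have sq: "1 - (- 1 + 2 * s)\<^sup>2 = 4 * (s * (1 - s))" by (simp add: power2_eq_square algebra_simps)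
    \<comment> \<open>At the end points the closed and the open indicator differ, but
      \<open>0 powr (a - 1)\<close> is 0 by convention.\<close>
    consider "0 < s \<and> s < 1" | "s = 0 \<or> s = 1" | "s < 0 \<or> s > 1" by linarith
    then have "nu_density a (- 1 + 2 * s) = C * 4 powr (a - 1) * (indicator {0<..<1} s * (s powr (a - 1) * (1 - s) powr (a - 1)))"
    proof cases
      case 1
      then have "(4 * (s * (1 - s))) powr (a - 1) = 4 powr (a - 1) * (s powr (a - 1) * (1 - s) powr (a - 1))"
        by (simp only: powr_mult)
      then show ?thesis using 1 unfolding nu_density_def sq C_def by simp
    next
      case 2
      then show ?thesis unfolding nu_density_def sq C_def by auto
    next
      case 3
      then have "- 1 + 2 * s \<notin> {-1..1}" by auto
      then show ?thesis using 3 unfolding nu_density_def by auto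
    qed
    then show "ennreal (nu_density a (- 1 + 2 * s)) = ennreal (C * 4 powr (a - 1)) * ennreal (indicator {0<..<1} s * (s powr (a - 1) * (1 - s) powr (a - 1)))"
      using C by (simp add: ennreal_mult')
  qed
  also have "\<dots> = ennreal (C * 4 powr (a - 1)) * ennreal (Beta a a)"
    unfolding nn_integral_Beta_Ioo[OF a a, symmetric] by (rule nn_integral_cmult) simp
  also have "2 * \<dots> = ennreal (2 * (C * 4 powr (a - 1) * Beta a a))"
    using C Beta_nonneg[OF a a] by (simp add: ennreal_mult' mult.assoc)
  also have "2 * (C * 4 powr (a - 1) * Beta a a) = 1"
  proof -
    have p: "(4::real) powr (a - 1) = 2 powr (2 * a - 2)"
      using powr_powr[of 2 2 "a - 1"] by (simp add: algebra_simps)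
    have "2 * (4 powr (a - 1)) * 2 powr (1 - 2 * a) = 2 powr (1::real) * 2 powr (2 * a - 2) * 2 powr (1 - 2 * a)"
      unfolding p by simp
    also have "\<dots> = 1" by (simp only: powr_add[symmetric]) simp
    finally have e: "2 * (4 powr (a - 1)) * 2 powr (1 - 2 * a) = (1::real)" .
    have "C * Beta a a = (Gamma a * Gamma (a + 1/2)) / (sqrt pi * Gamma (2 * a))"
      using G by (simp add: C_def Beta_def field_simps flip: mult_2)
    also have "\<dots> = 2 powr (1 - 2 * a)"
      unfolding Gamma_duplication_real[OF a] using G by simp
    finally have "C * Beta a a = 2 powr (1 - 2 * a)" .
    then have "2 * (C * 4 powr (a - 1) * Beta a a) = 2 * (4 powr (a - 1)) * 2 powr (1 - 2 * a)" by simp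
    then show ?thesis unfolding e .
  qed
  finally show ?thesis by simp
qed

lemma finite_measure_nu: "a > 0 \<Longrightarrow> finite_measure (nu_measure a)"
  by standard (simp add: emeasure_nu_measure)

lemma measure_nu: "a > 0 \<Longrightarrow> measure (nu_measure a) UNIV = 1"
  by (simp add: measure_def emeasure_nu_measure)

lemma AE_nu_measure: "AE u in nu_measure a. u \<in> {-1..1}"
proof -
  have "0 < ennreal (nu_density a u) \<longrightarrow> u \<in> {-1..1}" for u
    by (cases "u \<in> {-1..1}") (auto simp: nu_density_def)
  then show ?thesis unfolding nu_measure_eq by (subst AE_density) simp_all
qed

lemma integrable_nu_bounded:
  assumes "a > 0" "f \<in> borel_measurable borel" "\<And>u. u \<in> {-1..1} \<Longrightarrow> \<bar>f u\<bar> \<le> (B::real)"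
  shows "integrable (nu_measure a) f"
proof -
  interpret finite_measure "nu_measure a" using assms(1) by (rule finite_measure_nu)
  show ?thesis
  proof (rule integrable_const_bound)
    show "AE u in nu_measure a. norm (f u) \<le> B"
      using AE_nu_measure by eventually_elim (use assms(3) in auto)
    show "f \<in> borel_measurable (nu_measure a)" using assms(2) by simp
  qed
qed

lemma integral_nu_bounded:
  assumes a: "a > 0" and f: "f \<in> borel_measurable borel" and B: "\<And>u. u \<in> {-1..1} \<Longrightarrow> \<bar>f u\<bar> \<le> (B::real)"
  shows "(\<integral>u. \<bar>f u\<bar> \<partial>nu_measure a) \<le> B"
proof -
  interpret finite_measure "nu_measure a" using a by (rule finite_measure_nu)
  have "(\<integral>u. \<bar>f u\<bar> \<partial>nu_measure a) \<le> (\<integral>u. B \<partial>nu_measure a)"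
  proof (rule integral_mono_AE)
    show "integrable (nu_measure a) (\<lambda>u. \<bar>f u\<bar>)"
      using integrable_nu_bounded[OF assms] by (rule integrable_abs)
    show "AE u in nu_measure a. \<bar>f u\<bar> \<le> B" using AE_nu_measure by eventually_elim (rule B)
  qed simp
  then show ?thesis by (simp add: measure_nu[OF a])
qed

definition nu_moment :: "real \<Rightarrow> nat \<Rightarrow> real" where
  "nu_moment a j = (\<integral>u. u ^ j \<partial>nu_measure a)"

lemma integrable_nu_power: "a > 0 \<Longrightarrow> integrable (nu_measure a) (\<lambda>u. u ^ j)"
  by (rule integrable_nu_bounded[where B = 1]) (auto simp: power_abs power_le_one)

lemma nu_moment_0: "a > 0 \<Longrightarrow> nu_moment a 0 = 1"
  by (simp add: nu_moment_def measure_nu)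

text \<open>Integration by parts against the derivative of \<open>(1 - u\<^sup>2) powr a * u ^ j\<close>.\<close>

lemma nu_moment_Suc:
  assumes a: "a > 0"
  shows "(2 * a + real j) * nu_moment a (Suc j) = real j * nu_moment a (j - 1)"
proof -
  define C where "C = Gamma (a + 1/2) / (sqrt pi * Gamma a)"
  define h where "h u = - 2 * a * u ^ Suc j + real j * (u ^ (j - 1) - u ^ Suc j)" for u :: real
  have ftc: "((\<lambda>u. (1 - u\<^sup>2) powr (a - 1) * h u) has_integral ((1 - 1\<^sup>2) powr a * 1 ^ j - (1 - (-1)\<^sup>2) powr a * (-1) ^ j)) {-1..1}"
  proof (rule fundamental_theorem_of_calculus_interior)
    show "continuous_on {-1..1} (\<lambda>u. (1 - u\<^sup>2) powr a * u ^ j)"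
    proof (intro continuous_on_mult continuous_on_powr' continuous_intros ballI)
      fix u :: real assume "u \<in> {-1..1}"
      then show "0 \<le> 1 - u\<^sup>2 \<and> (1 - u\<^sup>2 = 0 \<longrightarrow> 0 < a)"
        using a by (auto simp: abs_square_le_1 abs_le_iff)
    qed
    fix u :: real assume u: "u \<in> {-1<..<1}"
    then have pos: "1 - u\<^sup>2 > 0" by (simp add: abs_square_less_1 abs_less_iff)
    have d: "((\<lambda>u. (1 - u\<^sup>2) powr a * u ^ j) has_real_derivative
       (1 - u\<^sup>2) powr a * (real j * u ^ (j - 1)) + (a * (1 - u\<^sup>2) powr (a - 1) * (- 2 * u)) * u ^ j) (at u)"
      using pos by (auto intro!: derivative_eq_intros simp: powr_diff field_simps)
    have p: "(1 - u\<^sup>2) powr a = (1 - u\<^sup>2) powr (a - 1) * (1 - u\<^sup>2)"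
      using pos by (simp add: powr_diff)
    have q: "real j * (u ^ (j - 1) * u\<^sup>2) = real j * u ^ Suc j"
      by (cases j) (auto simp: power2_eq_square)
    have "(1 - u\<^sup>2) powr a * (real j * u ^ (j - 1))
        = (1 - u\<^sup>2) powr (a - 1) * (real j * u ^ (j - 1) - real j * (u ^ (j - 1) * u\<^sup>2))"
      unfolding p by (simp add: algebra_simps)
    then have e: "(1 - u\<^sup>2) powr a * (real j * u ^ (j - 1))
        = (1 - u\<^sup>2) powr (a - 1) * (real j * u ^ (j - 1) - real j * u ^ Suc j)"
      unfolding q .
    have "((\<lambda>u. (1 - u\<^sup>2) powr a * u ^ j) has_real_derivative (1 - u\<^sup>2) powr (a - 1) * h u) (at u)"
      using d unfolding e by (rule DERIV_cong) (simp add: h_def algebra_simps)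
    then show "((\<lambda>u. (1 - u\<^sup>2) powr a * u ^ j) has_vector_derivative (1 - u\<^sup>2) powr (a - 1) * h u) (at u)"
      by (simp add: has_real_derivative_iff_has_vector_derivative)
  qed simp
  have hb: "integrable (nu_measure a) h"
    unfolding h_def
    by (intro Bochner_Integration.integrable_add Bochner_Integration.integrable_diff integrable_mult_right
         integrable_nu_power a)
  have hm: "h \<in> borel_measurable borel" unfolding h_def by measurable
  have il: "integrable lborel (\<lambda>u. nu_density a u * h u)"
    using hb hm unfolding nu_measure_eq by (subst (asm) integrable_density) (auto simp: nu_density_nonneg[OF a])
  have eq: "(\<integral>u. h u \<partial>nu_measure a) = (\<integral>u. nu_density a u * h u \<partial>lborel)"
    unfolding nu_measure_eq using hm by (subst integral_density) (auto simp: nu_density_nonneg[OF a])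
  have "((\<lambda>u. C * (if u \<in> {-1..1} then (1 - u\<^sup>2) powr (a - 1) * h u else 0)) has_integral C * 0) UNIV"
    using ftc by (intro has_integral_mult_right) (simp only: has_integral_restrict_UNIV, simp)
  moreover have "(\<lambda>u. C * (if u \<in> {-1..1} then (1 - u\<^sup>2) powr (a - 1) * h u else 0)) = (\<lambda>u. nu_density a u * h u)"
    by (auto simp: fun_eq_iff nu_density_def C_def)
  ultimately have "((\<lambda>u. nu_density a u * h u) has_integral 0) UNIV" by simp
  then have "(\<integral>u. h u \<partial>nu_measure a) = 0"
    unfolding eq using has_integral_unique[OF has_integral_integral_lborel[OF il]] by simp
  moreover have "(\<integral>u. h u \<partial>nu_measure a) = - 2 * a * nu_moment a (Suc j) + real j * (nu_moment a (j - 1) - nu_moment a (Suc j))"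
    unfolding h_def nu_moment_def using integrable_nu_power[OF a] by (simp del: power_Suc)
  ultimately show ?thesis by (simp add: algebra_simps)
qed

lemma integral_nu_affine_power:
  assumes a: "a > 0"
  shows "(\<integral>u. (p + u * B) ^ i \<partial>nu_measure a) = (\<Sum>l\<le>i. real (i choose l) * p ^ l * (B ^ (i - l) * nu_moment a (i - l)))"
proof -
  have "(p + u * B) ^ i = (\<Sum>l\<le>i. real (i choose l) * p ^ l * B ^ (i - l) * u ^ (i - l))" for u
    by (simp add: binomial_ring power_mult_distrib mult_ac)
  then show ?thesis using integrable_nu_power[OF a] by (simp add: nu_moment_def mult.assoc)
qed

lemma integral_nu_suminf:
  fixes f :: "nat \<Rightarrow> real \<Rightarrow> real"
  assumes a: "a > 0" and m: "\<And>n. f n \<in> borel_measurable borel"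
    and b: "\<And>n u. u \<in> {-1..1} \<Longrightarrow> \<bar>f n u\<bar> \<le> B n" and B: "summable B"
  shows "(\<lambda>n. \<integral>u. f n u \<partial>nu_measure a) sums (\<integral>u. (\<Sum>n. f n u) \<partial>nu_measure a)"
proof (rule sums_integral)
  show "integrable (nu_measure a) (f n)" for n using a m b by (rule integrable_nu_bounded)
  show "AE u in nu_measure a. summable (\<lambda>n. norm (f n u))"
    using AE_nu_measure
  proof eventually_elim
    case (elim u)
    then show ?case using b by (intro summable_comparison_test'[OF B, of 0]) auto
  qed
  have "(\<integral>u. norm (f n u) \<partial>nu_measure a) \<le> B n" for n
    using integral_nu_bounded[OF a m b] by simp
  then show "summable (\<lambda>n. \<integral>u. norm (f n u) \<partial>nu_measure a)"
    by (intro summable_comparison_test'[OF B, of 0]) (auto simp: integral_nonneg_AE)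
qed

subsection \<open>The integral representation\<close>

text \<open>The sum of the two absolute values is the larger of \<open>|cos (x - y)|\<close> and
  \<open>|cos (x + y)|\<close>. This keeps \<open>\<xi>\<close> in the range of the coefficient
  bounds.\<close>

lemma cos_cos_sin_sin_le_1:
  fixes x y :: real
  assumes "\<bar>u\<bar> \<le> 1" "\<bar>v\<bar> \<le> 1"
  shows "\<bar>v * (cos x * cos y) + u * (sin x * sin y)\<bar> \<le> 1"
proof -
  have "\<bar>v * (cos x * cos y) + u * (sin x * sin y)\<bar> \<le> \<bar>v * (cos x * cos y)\<bar> + \<bar>u * (sin x * sin y)\<bar>"
    by (rule abs_triangle_ineq)
  also have "\<dots> \<le> \<bar>cos x * cos y\<bar> + \<bar>sin x * sin y\<bar>"
    using assms by (intro add_mono) (auto simp: abs_mult intro!: mult_left_le_one_le)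
  also have "\<dots> \<le> 1"
    using abs_cos_le_one[of "x - y"] abs_cos_le_one[of "x + y"] unfolding cos_diff cos_add by linarith
  finally show ?thesis .
qed

lemma inner_polar:
  assumes "z = of_real (cmod z) * cis \<phi>1" "w = of_real (cmod w) * cis \<phi>2"
  shows "w \<bullet> (z * cis t) = cmod (z * w) * cos (\<phi>1 - \<phi>2 + t)"
proof -
  have "w \<bullet> (z * cis t) = (of_real (cmod w) * cis \<phi>2) \<bullet> (of_real (cmod z) * cis \<phi>1 * cis t)"
    using assms by simp
  also have "\<dots> = cmod w * cmod z * (cos \<phi>2 * cos (\<phi>1 + t) + sin \<phi>2 * sin (\<phi>1 + t))"
    unfolding mult.assoc cis_mult by (simp add: inner_complex_def algebra_simps)
  also have "cos \<phi>2 * cos (\<phi>1 + t) + sin \<phi>2 * sin (\<phi>1 + t) = cos (\<phi>1 + t - \<phi>2)"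
    by (simp add: cos_diff mult.commute)
  finally show ?thesis by (simp add: norm_mult algebra_simps)
qed

context dihedral
begin

definition Qf :: "real \<Rightarrow> real fps" where
  "Qf r = fps_binomial (- (a + b)) oo (Pfps k r - 1)"

definition tauf :: "real \<Rightarrow> real fps" where
  "tauf r = qfps k r * inverse (Pfps k r)"

lemma pullback: "pullback k (a + b) (Pfps k r) (qfps k r) (Qf r) (tauf r)"
  unfolding Qf_def tauf_def using k_pos by (rule pullback_Pfps)

text \<open>Degree \<open>n\<close> term of one of the two exponential integrals in
  \<open>G\<close>, with \<open>cos (k \<theta>)\<close> replaced by a free variable.\<close>

definition acoef :: "real \<Rightarrow> nat \<Rightarrow> real \<Rightarrow> real" where
  "acoef r n \<xi> = fps_nth (Qf r * (geom_fps (a + b) \<xi> oo tauf r)) n / pochhammer N n"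

definition Kcoef :: "real \<Rightarrow> nat \<Rightarrow> nat \<Rightarrow> real" where
  "Kcoef r n i = fps_nth (Qf r * tauf r ^ i) n * (pochhammer (a + b) i / fact i) / pochhammer N n"

lemma acoef_eq: "acoef r n \<xi> = (\<Sum>i\<le>n. Kcoef r n i * \<xi> ^ i)"
  unfolding acoef_def pullback.pullback_nth[OF pullback]
  by (simp add: Kcoef_def geom_fps_def sum_divide_distrib mult_ac)

text \<open>Both sides are powers with exponent \<open>- (a + b)\<close> of the same polygon
  product.\<close>

lemma prod_geom_fps:
  "(\<Prod>l<k. geom_fps (a + b) (r * cos (\<theta> + 2 * pi * real l / real k)))
    = Qf r * (geom_fps (a + b) (cos (real k * \<theta>)) oo tauf r)"
proof (rule is_fps_powr_unique)
  let ?f = "Pfps k r - fps_const (cos (real k * \<theta>)) * qfps k r"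
  have f: "(\<Prod>l<k. 1 - fps_const (r * cos (\<theta> + 2 * pi * real l / real k)) * fps_X) = ?f"
    using k_pos by (rule prod_cos_fps)
  show "fps_nth ?f 0 = 1" unfolding f[symmetric] by (simp add: fps_nth_prod_0)
  show "is_fps_powr (- (a + b)) ?f (\<Prod>l<k. geom_fps (a + b) (r * cos (\<theta> + 2 * pi * real l / real k)))"
    unfolding f[symmetric] by (intro is_fps_powr_prod is_fps_powr_geom) auto
  show "is_fps_powr (- (a + b)) ?f (Qf r * (geom_fps (a + b) (cos (real k * \<theta>)) oo tauf r))"
    by (rule pullback.is_fps_powr_pullback[OF pullback])
qed

lemma abs_acoef:
  assumes "r \<ge> 0" "\<bar>\<xi>\<bar> \<le> 1"
  shows "\<bar>acoef r n \<xi>\<bar> \<le> r ^ n / fact n"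
proof -
  \<comment> \<open>Every \<open>\<xi>\<close> in \<open>[-1, 1]\<close> is some
    \<open>cos (k \<theta>)\<close>, so \<open>acoef\<close> there is a normalized Dirichlet moment
    and inherits its bound.\<close>
  define \<theta> where "\<theta> = arccos \<xi> / real k"
  have xi: "cos (real k * \<theta>) = \<xi>" using assms k_pos by (simp add: \<theta>_def cos_arccos_abs)
  have "\<bar>fps_nth (\<Prod>l<k. geom_fps (a + b) (r * cos (\<theta> + 2 * pi * real l / real k))) n / pochhammer (real k * (a + b)) n\<bar> \<le> r ^ n / fact n"
    using assms(1) a_pos b_pos k_pos
    by (intro dirichlet_exp_sums(1)) (auto simp: abs_mult intro!: mult_left_le)
  then show ?thesis unfolding prod_geom_fps xi by (simp add: acoef_def N_def)
qed

text \<open>The two signs stand for the two exponentials of \<open>G\<close>, whose polygons differ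
  by a turn through \<open>\<pi> / k\<close>.\<close>

definition gcoef :: "real \<Rightarrow> nat \<Rightarrow> real \<Rightarrow> real" where
  "gcoef r n \<xi> = (acoef r n \<xi> + acoef r n (- \<xi>)) / 2"

definition gfun :: "real \<Rightarrow> real \<Rightarrow> real" where
  "gfun r \<xi> = (\<Sum>n. gcoef r n \<xi>)"

lemma abs_gcoef:
  assumes "r \<ge> 0" "\<bar>\<xi>\<bar> \<le> 1"
  shows "\<bar>gcoef r n \<xi>\<bar> \<le> r ^ n / fact n"
proof -
  have "\<bar>acoef r n \<xi>\<bar> \<le> r ^ n / fact n" "\<bar>acoef r n (- \<xi>)\<bar> \<le> r ^ n / fact n"
    using assms by (auto intro: abs_acoef)
  moreover have "\<bar>(p + q) / 2\<bar> \<le> s" if "\<bar>p\<bar> \<le> s" "\<bar>q\<bar> \<le> s" for p q s :: real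
    using that by (simp add: abs_le_iff)
  ultimately show ?thesis unfolding gcoef_def by blast
qed

lemma acoef_sums:
  assumes "r \<ge> 0"
  shows "(\<lambda>n. acoef r n (cos (real k * \<theta>))) sums
    (Gamma N / Gamma (a + b) ^ k *
     (\<integral>t. exp (\<Sum>j<k. r * cos (\<theta> + 2 * pi * real j / real k) * simplex_coord k t j) * simplex_wt k (a + b) t \<partial>simplex_M k))" (is ?A)
    and "integrable (simplex_M k) (\<lambda>t. exp (\<Sum>j<k. r * cos (\<theta> + 2 * pi * real j / real k) * simplex_coord k t j) * simplex_wt k (a + b) t)" (is ?B)
proof -
  have b: "\<bar>r * cos (\<theta> + 2 * pi * real j / real k)\<bar> \<le> r" for j
    using assms by (auto simp: abs_mult intro!: mult_left_le)
  have c: "a + b > 0" using a_pos b_pos by simp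
  show ?B by (rule dirichlet_exp_sums(2)[OF k_pos c b])
  show ?A using dirichlet_exp_sums(3)[OF k_pos c, of "\<lambda>j. r * cos (\<theta> + 2 * pi * real j / real k)" r, OF b]
    unfolding prod_geom_fps by (simp add: acoef_def N_def)
qed

lemma G_fun_eq:
  assumes z: "z = of_real (cmod z) * cis \<phi>1" and w: "w = of_real (cmod w) * cis \<phi>2"
  shows "G_fun k a b z w = gfun (cmod (z * w)) (xi_uv 1 1 (real k * \<phi>1) (real k * \<phi>2))"
proof -
  define r where "r = cmod (z * w)"
  have r: "r \<ge> 0" by (simp add: r_def)
  \<comment> \<open>The first polygon runs clockwise in \<open>j\<close>, so the angle is negated
    and the evenness of the cosine used.\<close>
  define \<theta>1 where "\<theta>1 = \<phi>2 - \<phi>1"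
  \<comment> \<open>The shift by \<open>\<pi> / k\<close> becomes \<open>\<pi>\<close> after
    multiplication by \<open>k\<close> and yields \<open>- \<xi>\<close>.\<close>
  define \<theta>2 where "\<theta>2 = \<phi>1 - \<phi>2 - pi / real k"
  define \<xi> where "\<xi> = xi_uv 1 1 (real k * \<phi>1) (real k * \<phi>2)"
  define Y where "Y \<theta> t = (\<Sum>j<k. r * cos (\<theta> + 2 * pi * real j / real k) * simplex_coord k t j)" for \<theta> t
  define W where "W = simplex_wt k (a + b)"
  have xi: "\<xi> = cos (real k * \<phi>1 - real k * \<phi>2)"
    by (simp add: \<xi>_def xi_uv_def cos_diff)
  have c1: "cos (real k * \<theta>1) = \<xi>"
    unfolding xi \<theta>1_def by (simp add: cos_minus[of "real k * \<phi>1 - real k * \<phi>2", symmetric] right_diff_distrib)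
  have c2: "cos (real k * \<theta>2) = - \<xi>"
  proof -
    have "real k * \<theta>2 = (real k * \<phi>1 - real k * \<phi>2) - pi"
      using k_pos by (simp add: \<theta>2_def field_simps)
    then show ?thesis unfolding xi by (simp add: cos_diff)
  qed
  have lin: "w \<bullet> (z * (\<Sum>j<k. cis (f j) * of_real (s j))) = (\<Sum>j<k. r * cos (\<phi>1 - \<phi>2 + f j) * s j)" for f and s :: "nat \<Rightarrow> real"
  proof -
    have "w \<bullet> (z * (cis (f j) * of_real (s j))) = r * cos (\<phi>1 - \<phi>2 + f j) * s j" for j
    proof -
      have "z * (cis (f j) * of_real (s j)) = s j *\<^sub>R (z * cis (f j))" by (simp add: scaleR_conv_of_real mult_ac)
      then show ?thesis by (simp add: inner_polar[OF z w] r_def mult.commute)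
    qed
    then show ?thesis by (simp add: sum_distrib_left inner_sum_right)
  qed
  have e1: "w \<bullet> (z * (\<Sum>j<k. cis (- 2 * real j * pi / real k) * of_real (simplex_coord k t j))) = Y \<theta>1 t" for t
  proof -
    have "cos (\<phi>1 - \<phi>2 + - 2 * real j * pi / real k) = cos (\<theta>1 + 2 * pi * real j / real k)" for j
      unfolding \<theta>1_def using cos_minus[of "\<phi>2 - \<phi>1 + 2 * pi * real j / real k"] by (simp add: algebra_simps)
    then show ?thesis unfolding lin Y_def by simp
  qed
  have e2: "w \<bullet> (z * (\<Sum>j<k. cis ((2 * real j - 1) * pi / real k) * of_real (simplex_coord k t j))) = Y \<theta>2 t" for t
  proof -
    have "\<phi>1 - \<phi>2 + (2 * real j - 1) * pi / real k = \<theta>2 + 2 * pi * real j / real k" for j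
      unfolding \<theta>2_def by (simp add: algebra_simps diff_divide_distrib)
    then show ?thesis unfolding lin Y_def by simp
  qed
  have "G_fun k a b z w = Gamma N / (2 * Gamma (a + b) ^ k) * (\<integral>t. exp (Y \<theta>1 t) * W t + exp (Y \<theta>2 t) * W t \<partial>simplex_M k)"
    unfolding G_fun_def e1 e2 set_lebesgue_integral_def W_def simplex_wt_def N_def
    by (simp add: algebra_simps)
  also have "\<dots> = (Gamma N / Gamma (a + b) ^ k * (\<integral>t. exp (Y \<theta>1 t) * W t \<partial>simplex_M k)
      + Gamma N / Gamma (a + b) ^ k * (\<integral>t. exp (Y \<theta>2 t) * W t \<partial>simplex_M k)) / 2"
    using acoef_sums(2)[OF r, of \<theta>1] acoef_sums(2)[OF r, of \<theta>2]
    unfolding Y_def[symmetric] W_def[symmetric]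
    by (simp add: Bochner_Integration.integral_add algebra_simps add_divide_distrib)
  finally have G: "G_fun k a b z w = \<dots>" .
  have "(\<lambda>n. (acoef r n (cos (real k * \<theta>1)) + acoef r n (cos (real k * \<theta>2))) / 2) sums G_fun k a b z w"
    unfolding G Y_def W_def by (intro sums_divide sums_add acoef_sums(1) r)
  then have "(\<lambda>n. gcoef r n \<xi>) sums G_fun k a b z w"
    unfolding c1 c2 by (simp add: gcoef_def)
  then show ?thesis by (simp add: gfun_def r_def \<xi>_def sums_iff)
qed

lemma rank_two_moments_nu: "rank_two_moments a b (nu_moment a) (nu_moment b)"
  by standard (use a_pos b_pos nu_moment_Suc nu_moment_0 in auto)

abbreviation "bmom A B \<equiv> rank_two_moments.biv_moment A B (nu_moment a) (nu_moment b)"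

lemma Sfps_polar:
  assumes z: "z = of_real (cmod z) * cis \<phi>1" and w: "w = of_real (cmod w) * cis \<phi>2"
  shows "Dfps w z p = Pfps k (cmod (z * w)) - fps_const (cos (real k * \<phi>1 - real k * \<phi>2 + of_int p * pi)) * qfps k (cmod (z * w))"
proof -
  define \<theta> where "\<theta> = \<phi>1 - \<phi>2 + of_int p * pi / real k"
  have "(z * om (2 * int l + p)) \<bullet> w = cmod (z * w) * cos (\<theta> + 2 * pi * real l / real k)" for l
  proof -
    have "\<phi>1 - \<phi>2 + of_int (2 * int l + p) * pi / real k = \<theta> + 2 * pi * real l / real k"
      using k_pos by (simp add: \<theta>_def field_simps)
    then show ?thesis by (simp only: inner_commute[of _ w] om_def inner_polar[OF z w])
  qed
  then have "Dfps w z p = Pfps k (cmod (z * w)) - fps_const (cos (real k * \<theta>)) * qfps k (cmod (z * w))"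
    using prod_cos_fps[OF k_pos, of "cmod (z * w)" \<theta>] by (simp add: Dfps_def)
  moreover have "real k * \<theta> = real k * \<phi>1 - real k * \<phi>2 + of_int p * pi"
    using k_pos by (simp add: \<theta>_def field_simps)
  ultimately show ?thesis by simp
qed

lemma gen_bessel_coeff:
  assumes z: "z = of_real (cmod z) * cis \<phi>1" and w: "w = of_real (cmod w) * cis \<phi>2"
  defines "A \<equiv> cos (real k * \<phi>1) * cos (real k * \<phi>2)" and "B \<equiv> sin (real k * \<phi>1) * sin (real k * \<phi>2)"
  shows "(cls w n z 0 + cls w n z 1 + cls w n (cnj z) 0 + cls w n (cnj z) 1) / (4 * real k)
    = (\<Sum>i\<le>n. Kcoef (cmod (z * w)) n i * bmom A B i)"
proof -
  interpret M: rank_two_moments a b A B "nu_moment a" "nu_moment b" by (rule rank_two_moments_nu)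
  define r where "r = cmod (z * w)"
  interpret pb: pullback k "a + b" "Pfps k r" "qfps k r" "Qf r" "tauf r" by (rule pullback)
  \<comment> \<open>\<open>d\<close> and \<open>e\<close> are the signs of \<open>A\<close> and
    \<open>B\<close>. Conjugating \<open>z\<close> flips \<open>B\<close>, while odd
    \<open>p\<close> adds \<open>\<pi>\<close> to the angle and flips both; so \<open>d\<close>
    records the parity of \<open>p\<close>, and \<open>z\<close> is unconjugated exactly when the
    signs agree.\<close>
  define S where "S e d = Sfps w (if e = d then z else cnj z) (if d then 0 else 1)" for e d
  define D where "D e d = Dfps w (if e = d then z else cnj z) (if d then 0 else 1)" for e d
  define \<Phi> where "\<Phi> e d = Qf r * (M.Ffps e d oo tauf r)" for e d
  have cz: "cnj z = of_real (cmod (cnj z)) * cis (- \<phi>1)"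
    unfolding complex_mod_cnj using arg_cong[OF z, of cnj]
    by (simp only: complex_cnj_mult complex_cnj_complex_of_real cis_cnj)
  have D: "D e d = Pfps k r - fps_const (sg d * A + sg e * B) * qfps k r" for e d
  proof -
    have r': "cmod (cnj z * w) = r" by (simp add: r_def norm_mult)
    have "cos (real k * \<phi>1 - real k * \<phi>2) = A + B" "cos (real k * - \<phi>1 - real k * \<phi>2) = A - B"
      by (simp_all add: A_def B_def cos_diff)
    then show ?thesis
      using Sfps_polar[OF z w] Sfps_polar[OF cz w]
      by (cases e; cases d) (simp_all add: D_def r' r_def[symmetric])
  qed
  have S_ode: "D e d * (fps_X * fps_deriv (S e d) + fps_const (real k * (a + b)) * S e d) =
      (of_nat k * D e d - fps_X * fps_deriv (D e d)) * (fps_const a * S (\<not> e) d + fps_const b * S e (\<not> d))" for e d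
    using Sfps_ode[of w "if e = d then z else cnj z" "if d then 0 else 1"]
    by (cases e; cases d) (simp_all add: S_def D_def N_def)
  have Phi_ode: "D e d * (fps_X * fps_deriv (\<Phi> e d) + fps_const (real k * (a + b)) * \<Phi> e d) =
      (of_nat k * D e d - fps_X * fps_deriv (D e d)) * (fps_const a * \<Phi> (\<not> e) d + fps_const b * \<Phi> e (\<not> d))" for e d
  proof -
    have "(fps_const a * M.Ffps (\<not> e) d + fps_const b * M.Ffps e (\<not> d)) oo tauf r
       = fps_const a * (M.Ffps (\<not> e) d oo tauf r) + fps_const b * (M.Ffps e (\<not> d) oo tauf r)"
      by (simp add: fps_compose_add_distrib fps_compose_mult_distrib)
    then have "Qf r * ((fps_const a * M.Ffps (\<not> e) d + fps_const b * M.Ffps e (\<not> d)) oo tauf r)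
       = fps_const a * \<Phi> (\<not> e) d + fps_const b * \<Phi> e (\<not> d)"
      by (simp add: \<Phi>_def algebra_simps)
    then show ?thesis
      using pb.pullback_ode[OF M.Ffps_ode[of d e]] unfolding D \<Phi>_def[symmetric] by simp
  qed
  \<comment> \<open>A class has \<open>k\<close> elements, so \<open>S\<close> starts with
    \<open>k\<close> and \<open>\<Phi>\<close> with 1. Both solve the same linear system, hence the
    difference vanishes.\<close>
  define Z where "Z e d = S e d - of_nat k * \<Phi> e d" for e d
  have "Z e d = 0" for e d
  proof (rule fps_system_zero[where D = D and Z = Z and k = k and a = a and b = b])
    show "a > 0" "b > 0" using a_pos b_pos by auto
    show "fps_nth (D e d) 0 = 1" for e d by (simp add: D_def Dfps_def fps_nth_prod_0)
    show "fps_nth (Z e d) 0 = 0" for e d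
    proof -
      have "fps_nth (Qf r) 0 = 1" using pb.Q by (simp add: is_fps_powr_def)
      then have "fps_nth (\<Phi> e d) 0 = 1" by (simp add: \<Phi>_def)
      then show ?thesis by (simp add: Z_def S_def Sfps_def cls_def)
    qed
    show "D e d * (fps_X * fps_deriv (Z e d) + fps_const (real k * (a + b)) * Z e d) =
      (of_nat k * D e d - fps_X * fps_deriv (D e d)) * (fps_const a * Z (\<not> e) d + fps_const b * Z e (\<not> d))" for e d
    proof -
      define R where "R = of_nat k * D e d - fps_X * fps_deriv (D e d)"
      have "D e d * (fps_X * fps_deriv (Z e d) + fps_const (real k * (a + b)) * Z e d)
        = D e d * (fps_X * fps_deriv (S e d) + fps_const (real k * (a + b)) * S e d)
          - of_nat k * (D e d * (fps_X * fps_deriv (\<Phi> e d) + fps_const (real k * (a + b)) * \<Phi> e d))"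
        by (simp add: Z_def algebra_simps)
      also have "\<dots> = R * (fps_const a * Z (\<not> e) d + fps_const b * Z e (\<not> d))"
        unfolding S_ode Phi_ode R_def[symmetric] by (simp add: Z_def algebra_simps)
      finally show ?thesis by (simp add: R_def)
    qed
  qed
  then have "fps_nth (S e d) n = real k * fps_nth (\<Phi> e d) n" for e d
    by (simp add: Z_def flip: fps_of_nat)
  then have "fps_nth (S True True) n + fps_nth (S False False) n + fps_nth (S False True) n + fps_nth (S True False) n
     = real k * (fps_nth (\<Phi> True True) n + fps_nth (\<Phi> True False) n + fps_nth (\<Phi> False True) n + fps_nth (\<Phi> False False) n)"
    by (simp add: algebra_simps)
  also have "\<dots> = real k * (\<Sum>i\<le>n. fps_nth (Qf r * tauf r ^ i) n * (fps_nth (M.Ffps True True) i + fps_nth (M.Ffps True False) i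
       + fps_nth (M.Ffps False True) i + fps_nth (M.Ffps False False) i))"
    unfolding \<Phi>_def pb.pullback_nth by (simp only: sum.distrib distrib_left)
  also have "\<dots> = 4 * real k * (\<Sum>i\<le>n. fps_nth (Qf r * tauf r ^ i) n * (pochhammer (a + b) i / fact i) * M.biv_moment i)"
    unfolding M.Ffps_average by (simp add: sum_distrib_left mult_ac)
  also have "\<dots> = 4 * real k * (pochhammer N n * (\<Sum>i\<le>n. Kcoef r n i * M.biv_moment i))"
  proof -
    have "pochhammer N n \<noteq> 0" using pochhammer_pos[OF N_pos, of n] by simp
    then show ?thesis by (simp add: Kcoef_def sum_distrib_left)
  qed
  also have "fps_nth (S True True) n + fps_nth (S False False) n + fps_nth (S False True) n + fps_nth (S True False) n
     = pochhammer N n * (cls w n z 0 + cls w n z 1 + cls w n (cnj z) 0 + cls w n (cnj z) 1)"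
    by (simp add: S_def Sfps_def algebra_simps)
  finally have "pochhammer N n * (cls w n z 0 + cls w n z 1 + cls w n (cnj z) 0 + cls w n (cnj z) 1)
     = pochhammer N n * (4 * real k * (\<Sum>i\<le>n. Kcoef r n i * M.biv_moment i))" by (simp only: mult_ac)
  then have "cls w n z 0 + cls w n z 1 + cls w n (cnj z) 0 + cls w n (cnj z) 1 = 4 * real k * (\<Sum>i\<le>n. Kcoef r n i * M.biv_moment i)"
    using pochhammer_pos[OF N_pos, of n] by simp
  then show ?thesis using k_pos by (simp add: r_def)
qed

lemma integral_gcoef:
  fixes A B :: real
  shows "(\<integral>v. (\<integral>u. gcoef r n (v * A + u * B) \<partial>nu_measure a) \<partial>nu_measure b) = (\<Sum>i\<le>n. Kcoef r n i * bmom A B i)"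
    and "(\<lambda>v. \<integral>u. gcoef r n (v * A + u * B) \<partial>nu_measure a) \<in> borel_measurable borel"
proof -
  interpret M: rank_two_moments a b A B "nu_moment a" "nu_moment b" by (rule rank_two_moments_nu)
  \<comment> \<open>The even coefficients of \<open>acoef\<close>. The odd ones may be restored at
    the end because their bivariate moments are zero.\<close>
  define E where "E i = Kcoef r n i * ((1 + (-1) ^ i) / 2)" for i
  have g: "gcoef r n \<xi> = (\<Sum>i\<le>n. E i * \<xi> ^ i)" for \<xi>
  proof -
    have "(- \<xi>) ^ i = (-1) ^ i * \<xi> ^ i" for i by (rule power_minus)
    then show ?thesis
      unfolding gcoef_def acoef_eq E_def sum.distrib[symmetric] sum_divide_distrib
      by (intro sum.cong) (simp_all add: field_simps)
  qed
  have pint: "integrable (nu_measure a) (\<lambda>u. (p + u * B) ^ i)" for p i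
  proof -
    have "(\<lambda>u. (p + u * B) ^ i) = (\<lambda>u. \<Sum>l\<le>i. real (i choose l) * p ^ l * B ^ (i - l) * u ^ (i - l))"
      by (simp add: fun_eq_iff binomial_ring power_mult_distrib mult_ac)
    then show ?thesis using integrable_nu_power[OF a_pos] by simp
  qed
  have inner: "(\<integral>u. gcoef r n (v * A + u * B) \<partial>nu_measure a)
     = (\<Sum>i\<le>n. E i * (\<Sum>l\<le>i. real (i choose l) * (v * A) ^ l * (B ^ (i - l) * nu_moment a (i - l))))" for v
    unfolding g using pint by (simp add: integral_nu_affine_power[OF a_pos])
  show "(\<lambda>v. \<integral>u. gcoef r n (v * A + u * B) \<partial>nu_measure a) \<in> borel_measurable borel"
    unfolding inner by measurable
  have "(\<integral>v. (\<integral>u. gcoef r n (v * A + u * B) \<partial>nu_measure a) \<partial>nu_measure b)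
     = (\<integral>v. (\<Sum>i\<le>n. E i * (\<Sum>l\<le>i. real (i choose l) * A ^ l * (B ^ (i - l) * nu_moment a (i - l)) * v ^ l)) \<partial>nu_measure b)"
    unfolding inner by (simp add: power_mult_distrib mult_ac)
  also have "\<dots> = (\<Sum>i\<le>n. E i * M.biv_moment i)"
    unfolding M.biv_moment_def using integrable_nu_power[OF b_pos]
    by (simp add: nu_moment_def[of b] mult_ac)
  also have "\<dots> = (\<Sum>i\<le>n. Kcoef r n i * M.biv_moment i)"
  proof (rule sum.cong)
    show "E i * M.biv_moment i = Kcoef r n i * M.biv_moment i" for i
      using M.biv_moment_odd[of i] by (cases "even i") (simp_all add: E_def)
  qed simp
  finally show "(\<integral>v. (\<integral>u. gcoef r n (v * A + u * B) \<partial>nu_measure a) \<partial>nu_measure b) = (\<Sum>i\<le>n. Kcoef r n i * bmom A B i)" .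
qed

lemma integral_gfun_sums:
  fixes x y :: real
  assumes r: "r \<ge> 0"
  defines "A \<equiv> cos x * cos y" and "B \<equiv> sin x * sin y"
  shows "(\<lambda>n. \<Sum>i\<le>n. Kcoef r n i * bmom A B i) sums
    (\<integral>v. (\<integral>u. gfun r (v * A + u * B) \<partial>nu_measure a) \<partial>nu_measure b)"
proof -
  interpret a: finite_measure "nu_measure a" using a_pos by (rule finite_measure_nu)
  have bd: "\<bar>gcoef r n (v * A + u * B)\<bar> \<le> r ^ n / fact n" if "u \<in> {-1..1}" "v \<in> {-1..1}" for u v n
    using r that unfolding A_def B_def by (intro abs_gcoef cos_cos_sin_sin_le_1) auto
  have sm: "summable (\<lambda>n. r ^ n / fact n)" using summable_exp[of r] by (simp add: field_simps)
  have gm [measurable]: "gcoef r n \<in> borel_measurable borel" for n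
    unfolding gcoef_def acoef_eq by measurable
  define I where "I n v = (\<integral>u. gcoef r n (v * A + u * B) \<partial>nu_measure a)" for n v
  have Im: "I n \<in> borel_measurable borel" for n unfolding I_def by (rule integral_gcoef(2))
  have Ib: "\<bar>I n v\<bar> \<le> r ^ n / fact n" if "v \<in> {-1..1}" for n v
  proof -
    have "\<bar>I n v\<bar> \<le> (\<integral>u. \<bar>gcoef r n (v * A + u * B)\<bar> \<partial>nu_measure a)"
      unfolding I_def by (rule integral_abs_bound)
    also have "\<dots> \<le> r ^ n / fact n"
      using a_pos bd that by (intro integral_nu_bounded) auto
    finally show ?thesis .
  qed
  have inner: "(\<integral>u. gfun r (v * A + u * B) \<partial>nu_measure a) = (\<Sum>n. I n v)" if "v \<in> {-1..1}" for v
  proof -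
    have "(\<lambda>n. I n v) sums (\<integral>u. (\<Sum>n. gcoef r n (v * A + u * B)) \<partial>nu_measure a)"
      unfolding I_def using bd that by (intro integral_nu_suminf[OF a_pos _ _ sm]) auto
    then show ?thesis by (simp add: gfun_def sums_iff)
  qed
  have "(\<integral>v. (\<integral>u. gfun r (v * A + u * B) \<partial>nu_measure a) \<partial>nu_measure b) = (\<integral>v. (\<Sum>n. I n v) \<partial>nu_measure b)"
  proof (rule integral_cong_AE)
    show "(\<lambda>v. \<integral>u. gfun r (v * A + u * B) \<partial>nu_measure a) \<in> borel_measurable (nu_measure b)"
      unfolding gfun_def by measurable
    show "(\<lambda>v. \<Sum>n. I n v) \<in> borel_measurable (nu_measure b)" using Im by measurable
    \<comment> \<open>The series is controlled only for \<open>v\<close> in \<open>[-1, 1]\<close>,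
      which carries the whole measure.\<close>
    show "AE v in nu_measure b. (\<integral>u. gfun r (v * A + u * B) \<partial>nu_measure a) = (\<Sum>n. I n v)"
      using AE_nu_measure by eventually_elim (rule inner)
  qed
  moreover have "(\<lambda>n. \<integral>v. I n v \<partial>nu_measure b) sums (\<integral>v. (\<Sum>n. I n v) \<partial>nu_measure b)"
    by (rule integral_nu_suminf[OF b_pos Im Ib sm])
  ultimately show ?thesis unfolding I_def integral_gcoef(1) by simp
qed

lemma gen_bessel_eq:
  assumes z: "z = of_real (cmod z) * cis \<phi>1" and w: "w = of_real (cmod w) * cis \<phi>2"
  shows "gen_bessel k a b z w = (\<integral>v. (\<integral>u. gfun (cmod (z * w)) (xi_uv u v (real k * \<phi>1) (real k * \<phi>2)) \<partial>nu_measure a) \<partial>nu_measure b)"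
proof -
  have "(\<lambda>n. \<Sum>i\<le>n. Kcoef (cmod (z * w)) n i * bmom (cos (real k * \<phi>1) * cos (real k * \<phi>2)) (sin (real k * \<phi>1) * sin (real k * \<phi>2)) i)
     sums gen_bessel k a b z w"
    using gen_bessel_sums[of w z] unfolding gen_bessel_coeff[OF z w] .
  moreover have "xi_uv u v x y = v * (cos x * cos y) + u * (sin x * sin y)" for u v x y
    by (simp add: xi_uv_def mult.assoc)
  ultimately show ?thesis
    using integral_gfun_sums[of "cmod (z * w)" "real k * \<phi>1" "real k * \<phi>2"] sums_unique2 by simp
qed

end

theorem mainTheorem9:
  fixes k :: nat and a b :: real
  assumes "k \<ge> 2" and "a > 0" and "b > 0"
  shows "\<exists>g :: real \<Rightarrow> real \<Rightarrow> real.
    (\<forall>z w \<phi>1 \<phi>2. z = of_real (cmod z) * cis \<phi>1 \<longrightarrow> w = of_real (cmod w) * cis \<phi>2 \<longrightarrow>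
        G_fun k a b z w = g (cmod (z * w)) (xi_uv 1 1 (real k * \<phi>1) (real k * \<phi>2))) \<and>
    (\<forall>z w \<phi>1 \<phi>2. z = of_real (cmod z) * cis \<phi>1 \<longrightarrow> w = of_real (cmod w) * cis \<phi>2 \<longrightarrow>
        gen_bessel k a b z w =
          (\<integral>v. (\<integral>u. g (cmod (z * w)) (xi_uv u v (real k * \<phi>1) (real k * \<phi>2)) \<partial>nu_measure a)
             \<partial>nu_measure b))"
proof -
  interpret dihedral k a b using assms by unfold_locales auto
  show ?thesis using G_fun_eq gen_bessel_eq by blast
qed

end
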